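(* Let $\mathcal{V}$ be a locally presentable symmetric monoidal closed category that satisfies the fundamental theorem of comodules, let $A$ be a Hopf (resp. op-Hopf) monoid in $\mathcal{V}$, and let $B$ be a commutative monoid in $\mathcal{V}$. Then $P(A,B)$ is a Hopf (resp. op-Hopf) monoid.
   Context: An object of $\mathcal{V}$ is dualizable if it has a dual. For a comonoid $C$, a $C$-comodule is dualizable if its underlying object in $\mathcal{V}$ is. $\mathcal{V}$ satisfies the fundamental theorem of comodules if, for each comonoid $C$ in $\mathcal{V}$, each $C$-comodule is a filtered colimit of dualizable $C$-comodules. A Hopf monoid is a bimonoid $H$ with an antipode, i.e. an inverse of $1_H$ in the convolution monoid $\mathcal{V}(H,H)$ built from the comonoid $H$ and the monoid $H$. An op-Hopf monoid is a bimonoid $H$ with an opantipode, i.e. an inverse of $1_H$ in the convolution monoid built from the comonoid $H^{\mathrm{cop}}$ (with comultiplication $c_{H,H}^{-1}\cdot\Delta$, where $c$ is the symmetry) and the monoid $H$. For a comonoid $C$ and a monoid $B$, the internal hom $[C,B]$ has the convolution monoid structure. $P(A,B)$, the universal measuring comonoid, is the comonoid with natural bijections $\mathbf{Mon}(\mathcal{V})(A,[C,B])\cong\mathbf{Comon}(\mathcal{V})(C,P(A,B))$ for comonoids $C$; it exists under the stated hypotheses. Let $\eta\colon A\to[P(A,B),B]$ correspond to the identity. When $A$ is a bimonoid and $B$ is commutative, $P(A,B)$ is a bimonoid as follows. Its multiplication is the comonoid morphism corresponding to $$A\xrightarrow{\Delta}A\otimes A\xrightarrow{\eta\otimes\eta}[P(A,B),B]^{\otimes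 2}\to[P(A,B)^{\otimes 2},B\otimes B]\xrightarrow{[1,\mu_B]}[P(A,B)^{\otimes 2},B],$$ and its unit is the comonoid morphism $I\to P(A,B)$ corresponding to $A\xrightarrow{\varepsilon}I\xrightarrow{\iota_B}B\cong[I,B]$. *)

theory Defs
  imports Main "HOL-Library.FuncSet"
begin

unbundle cardinal_syntax

section \<open>Categories, functors, colimits\<close>

record ('o, 'm) category =
  objects :: "'o set"
  arrows :: "'m set"
  source :: "'m \<Rightarrow> 'o"
  target :: "'m \<Rightarrow> 'o"
  idn :: "'o \<Rightarrow> 'm" ("\<i>\<index>")
  cmp :: "'m \<Rightarrow> 'm \<Rightarrow> 'm" (infixr "\<cdot>\<index>" 55)

definition Hom :: "('o, 'm, 'x) category_scheme \<Rightarrow> 'o \<Rightarrow> 'o \<Rightarrow> 'm set" where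
  "Hom C X Y = {f \<in> arrows C. source C f = X \<and> target C f = Y}"

locale category =
  fixes C :: "('o, 'm, 'x) category_scheme" (structure)
  assumes source_in: "f \<in> arrows C \<Longrightarrow> source C f \<in> objects C"
    and target_in: "f \<in> arrows C \<Longrightarrow> target C f \<in> objects C"
    and idn_in: "X \<in> objects C \<Longrightarrow> \<i> X \<in> Hom C X X"
    and cmp_in: "f \<in> Hom C X Y \<Longrightarrow> g \<in> Hom C Y Z \<Longrightarrow> g \<cdot> f \<in> Hom C X Z"
    and idn_left: "f \<in> Hom C X Y \<Longrightarrow> \<i> Y \<cdot> f = f"
    and idn_right: "f \<in> Hom C X Y \<Longrightarrow> f \<cdot> \<i> X = f"
    and cmp_assoc: "f \<in> Hom C W X \<Longrightarrow> g \<in> Hom C X Y \<Longrightarrow> h \<in> Hom C Y Z \<Longrightarrow>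
                      (h \<cdot> g) \<cdot> f = h \<cdot> (g \<cdot> f)"

context
  fixes C :: "('o, 'm, 'x) category_scheme" (structure)
begin

definition inverse_arrows :: "'m \<Rightarrow> 'm \<Rightarrow> bool" where
  "inverse_arrows f g \<longleftrightarrow>
     f \<in> arrows C \<and> g \<in> Hom C (target C f) (source C f) \<and>
     g \<cdot> f = \<i> (source C f) \<and> f \<cdot> g = \<i> (target C f)"

definition is_iso :: "'m \<Rightarrow> bool" where
  "is_iso f \<longleftrightarrow> (\<exists>g. inverse_arrows f g)"

definition inv_arrow :: "'m \<Rightarrow> 'm" where
  "inv_arrow f = (THE g. inverse_arrows f g)"

end

definition is_functor ::
  "('o, 'm, 'x) category_scheme \<Rightarrow> ('p, 'n, 'y) category_scheme \<Rightarrow>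
     ('o \<Rightarrow> 'p) \<Rightarrow> ('m \<Rightarrow> 'n) \<Rightarrow> bool" where
  "is_functor C D Fo Fa \<longleftrightarrow>
     (\<forall>X\<in>objects C. Fo X \<in> objects D) \<and>
     (\<forall>f\<in>arrows C. Fa f \<in> Hom D (Fo (source C f)) (Fo (target C f))) \<and>
     (\<forall>X\<in>objects C. Fa (idn C X) = idn D (Fo X)) \<and>
     (\<forall>f\<in>arrows C. \<forall>g\<in>arrows C. source C g = target C f \<longrightarrow>
        Fa (cmp C g f) = cmp D (Fa g) (Fa f))"

text \<open>Cocones and colimits of a diagram \<open>(Do, Da)\<close> of shape \<open>J\<close> in \<open>C\<close>.\<close>

definition is_cocone ::
  "('o, 'm, 'x) category_scheme \<Rightarrow> ('j, 'k) category \<Rightarrow> ('j \<Rightarrow> 'o) \<Rightarrow> ('k \<Rightarrow> 'm) \<Rightarrow>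
     'o \<Rightarrow> ('j \<Rightarrow> 'm) \<Rightarrow> bool" where
  "is_cocone C J Do Da L \<kappa> \<longleftrightarrow>
     L \<in> objects C \<and>
     (\<forall>j\<in>objects J. \<kappa> j \<in> Hom C (Do j) L) \<and>
     (\<forall>u\<in>arrows J. cmp C (\<kappa> (target J u)) (Da u) = \<kappa> (source J u))"

definition is_colimit ::
  "('o, 'm, 'x) category_scheme \<Rightarrow> ('j, 'k) category \<Rightarrow> ('j \<Rightarrow> 'o) \<Rightarrow> ('k \<Rightarrow> 'm) \<Rightarrow>
     'o \<Rightarrow> ('j \<Rightarrow> 'm) \<Rightarrow> bool" where
  "is_colimit C J Do Da L \<kappa> \<longleftrightarrow>
     is_cocone C J Do Da L \<kappa> \<and>
     (\<forall>M \<nu>. is_cocone C J Do Da M \<nu> \<longrightarrow>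
        (\<exists>!h. h \<in> Hom C L M \<and> (\<forall>j\<in>objects J. cmp C h (\<kappa> j) = \<nu> j)))"


section \<open>Smallness and local presentability\<close>

text \<open>
  HOL has no built-in distinction between sets and classes. Smallness is therefore relative to a
  type \<open>'u\<close> that plays the role of a Grothendieck universe: a set is small if its cardinality
  is strictly below that of \<open>'u\<close>. If the cardinality of \<open>'u\<close> is inaccessible, this is the usual
  notion, and every small category is isomorphic to one whose objects and arrows are elements
  of \<open>'u\<close>; so small diagram shapes are taken among the categories on \<open>'u\<close>.
\<close>

definition small :: "'u itself \<Rightarrow> 'a set \<Rightarrow> bool" where
  "small U S \<longleftrightarrow> |S| <o |UNIV :: 'u set|"

definition small_category :: "('u, 'u) category \<Rightarrow> bool" where
  "small_category J \<longleftrightarrow>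
     category J \<and> small TYPE('u) (objects J) \<and> small TYPE('u) (arrows J)"

definition cocomplete :: "'u itself \<Rightarrow> ('o, 'm, 'x) category_scheme \<Rightarrow> bool" where
  "cocomplete U C \<longleftrightarrow>
     (\<forall>(J :: ('u, 'u) category) Do Da. small_category J \<and> is_functor J C Do Da \<longrightarrow>
        (\<exists>L \<kappa>. is_colimit C J Do Da L \<kappa>))"

definition locally_small :: "'u itself \<Rightarrow> ('o, 'm, 'x) category_scheme \<Rightarrow> bool" where
  "locally_small U C \<longleftrightarrow> (\<forall>X\<in>objects C. \<forall>Y\<in>objects C. small U (Hom C X Y))"

text \<open>
  A category is \<open>\<lambda>\<close>-filtered if each diagram in it with fewer than \<open>\<lambda>\<close> arrows has a cocone;
  the shape \<open>K\<close> may be empty.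
\<close>

definition lambda_filtered :: "'c rel \<Rightarrow> ('u, 'u) category \<Rightarrow> bool" where
  "lambda_filtered lam J \<longleftrightarrow>
     (\<forall>(K :: ('u, 'u) category) Do Da.
        category K \<and> |arrows K| <o lam \<and> is_functor K J Do Da \<longrightarrow>
        (\<exists>L \<kappa>. is_cocone J K Do Da L \<kappa>))"

abbreviation filtered :: "('u, 'u) category \<Rightarrow> bool" where
  "filtered \<equiv> lambda_filtered natLeq"

text \<open>
  The category of all sets of elements of \<open>'a\<close> and functions between them. Covariant hom functors
  of a category with arrows in \<open>'m\<close> take values in \<open>Set_cat :: ('m set, _) category\<close>. A cocone of
  such sets is a colimit there if and only if it is one among all sets: that a cocone is jointly
  surjective and makes no unnecessary identifications is detected by maps to a two-element set.
\<close>

definition Set_cat :: "('a set, 'a set \<times> ('a \<Rightarrow> 'a) \<times> 'a set) category" where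
  "Set_cat = \<lparr>
     objects = UNIV,
     arrows = {(S, f, T). f \<in> S \<rightarrow>\<^sub>E T},
     source = (\<lambda>(S, f, T). S),
     target = (\<lambda>(S, f, T). T),
     idn = (\<lambda>S. (S, restrict (\<lambda>x. x) S, S)),
     cmp = (\<lambda>(T', g, U) (S, f, T). (S, FuncSet.compose S g f, U)) \<rparr>"

definition hom_on_arrow ::
  "('o, 'm, 'x) category_scheme \<Rightarrow> 'o \<Rightarrow> 'm \<Rightarrow> 'm set \<times> ('m \<Rightarrow> 'm) \<times> 'm set" where
  "hom_on_arrow C X f =
     (Hom C X (source C f), restrict (cmp C f) (Hom C X (source C f)), Hom C X (target C f))"

text \<open>\<open>X\<close> is \<open>\<lambda>\<close>-presentable if \<open>Hom(X, -)\<close> preserves (small) \<open>\<lambda>\<close>-filtered colimits.\<close>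

definition presentable :: "'u rel \<Rightarrow> ('o, 'm, 'x) category_scheme \<Rightarrow> 'o \<Rightarrow> bool" where
  "presentable lam C X \<longleftrightarrow>
     X \<in> objects C \<and>
     (\<forall>(J :: ('u, 'u) category) Do Da L \<kappa>.
        small_category J \<and> lambda_filtered lam J \<and> is_functor J C Do Da \<and>
        is_colimit C J Do Da L \<kappa> \<longrightarrow>
        is_colimit Set_cat J (\<lambda>j. Hom C X (Do j)) (\<lambda>u. hom_on_arrow C X (Da u))
          (Hom C X L) (\<lambda>j. hom_on_arrow C X (\<kappa> j)))"

definition locally_presentable :: "'u itself \<Rightarrow> ('o, 'm, 'x) category_scheme \<Rightarrow> bool" where
  "locally_presentable U C \<longleftrightarrow>
     category C \<and> locally_small U C \<and> cocomplete U C \<and>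
     (\<exists>(lam :: 'u rel) G.
        Cinfinite lam \<and> regularCard lam \<and> lam <o |UNIV :: 'u set| \<and>
        small U G \<and> (\<forall>X\<in>G. presentable lam C X) \<and>
        (\<forall>X\<in>objects C. \<exists>(J :: ('u, 'u) category) Do Da \<kappa>.
           small_category J \<and> lambda_filtered lam J \<and> is_functor J C Do Da \<and>
           (\<forall>j\<in>objects J. Do j \<in> G) \<and> is_colimit C J Do Da X \<kappa>))"


section \<open>Symmetric monoidal closed categories\<close>

text \<open>
  \<open>\<otimes>\<close> is the tensor product of objects, \<open>\<otimes>\<^sub>m\<close> that of arrows. The structure isomorphisms are
  \<open>\<a> X Y Z : (X \<otimes> Y) \<otimes> Z \<rightarrow> X \<otimes> (Y \<otimes> Z)\<close>, \<open>\<l> X : I \<otimes> X \<rightarrow> X\<close>, \<open>\<r> X : X \<otimes> I \<rightarrow> X\<close> and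
  \<open>\<s> X Y : X \<otimes> Y \<rightarrow> Y \<otimes> X\<close>, and \<open>\<e> X Y : [X, Y] \<otimes> X \<rightarrow> Y\<close> is the evaluation.
\<close>

record ('o, 'm) smcc = "('o, 'm) category" +
  tensor_ob :: "'o \<Rightarrow> 'o \<Rightarrow> 'o" (infixl "\<otimes>\<index>" 70)
  tensor_ar :: "'m \<Rightarrow> 'm \<Rightarrow> 'm" (infixl "\<otimes>\<^sub>m\<index>" 70)
  unit_ob :: 'o ("\<I>\<index>")
  associator :: "'o \<Rightarrow> 'o \<Rightarrow> 'o \<Rightarrow> 'm" ("\<a>\<index>")
  left_unitor :: "'o \<Rightarrow> 'm" ("\<l>\<index>")
  right_unitor :: "'o \<Rightarrow> 'm" ("\<r>\<index>")
  symm :: "'o \<Rightarrow> 'o \<Rightarrow> 'm" ("\<s>\<index>")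
  ihom :: "'o \<Rightarrow> 'o \<Rightarrow> 'o" ("\<lbrakk>_, _\<rbrakk>\<index>")
  ev :: "'o \<Rightarrow> 'o \<Rightarrow> 'm" ("\<e>\<index>")

locale symmetric_monoidal_closed_category = category V
  for V :: "('o, 'm) smcc" (structure) +
  assumes unit_in: "\<I> \<in> objects V"
    and tensor_ob_in: "X \<in> objects V \<Longrightarrow> Y \<in> objects V \<Longrightarrow> X \<otimes> Y \<in> objects V"
    and tensor_ar_in: "f \<in> Hom V X X' \<Longrightarrow> g \<in> Hom V Y Y' \<Longrightarrow>
          f \<otimes>\<^sub>m g \<in> Hom V (X \<otimes> Y) (X' \<otimes> Y')"
    and tensor_idn: "X \<in> objects V \<Longrightarrow> Y \<in> objects V \<Longrightarrow> \<i> X \<otimes>\<^sub>m \<i> Y = \<i> (X \<otimes> Y)"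
    and interchange: "f \<in> Hom V X X' \<Longrightarrow> f' \<in> Hom V X' X'' \<Longrightarrow>
          g \<in> Hom V Y Y' \<Longrightarrow> g' \<in> Hom V Y' Y'' \<Longrightarrow>
          (f' \<cdot> f) \<otimes>\<^sub>m (g' \<cdot> g) = (f' \<otimes>\<^sub>m g') \<cdot> (f \<otimes>\<^sub>m g)"
    and associator_in: "X \<in> objects V \<Longrightarrow> Y \<in> objects V \<Longrightarrow> Z \<in> objects V \<Longrightarrow>
          \<a> X Y Z \<in> Hom V ((X \<otimes> Y) \<otimes> Z) (X \<otimes> (Y \<otimes> Z)) \<and> is_iso V (\<a> X Y Z)"
    and associator_nat: "f \<in> Hom V X X' \<Longrightarrow> g \<in> Hom V Y Y' \<Longrightarrow> h \<in> Hom V Z Z' \<Longrightarrow>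
          \<a> X' Y' Z' \<cdot> ((f \<otimes>\<^sub>m g) \<otimes>\<^sub>m h) = (f \<otimes>\<^sub>m (g \<otimes>\<^sub>m h)) \<cdot> \<a> X Y Z"
    and left_unitor_in: "X \<in> objects V \<Longrightarrow> \<l> X \<in> Hom V (\<I> \<otimes> X) X \<and> is_iso V (\<l> X)"
    and left_unitor_nat: "f \<in> Hom V X X' \<Longrightarrow> \<l> X' \<cdot> (\<i> \<I> \<otimes>\<^sub>m f) = f \<cdot> \<l> X"
    and right_unitor_in: "X \<in> objects V \<Longrightarrow> \<r> X \<in> Hom V (X \<otimes> \<I>) X \<and> is_iso V (\<r> X)"
    and right_unitor_nat: "f \<in> Hom V X X' \<Longrightarrow> \<r> X' \<cdot> (f \<otimes>\<^sub>m \<i> \<I>) = f \<cdot> \<r> X"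
    and pentagon: "W \<in> objects V \<Longrightarrow> X \<in> objects V \<Longrightarrow> Y \<in> objects V \<Longrightarrow> Z \<in> objects V \<Longrightarrow>
          (\<i> W \<otimes>\<^sub>m \<a> X Y Z) \<cdot> \<a> W (X \<otimes> Y) Z \<cdot> (\<a> W X Y \<otimes>\<^sub>m \<i> Z)
          = \<a> W X (Y \<otimes> Z) \<cdot> \<a> (W \<otimes> X) Y Z"
    and triangle: "X \<in> objects V \<Longrightarrow> Y \<in> objects V \<Longrightarrow>
          (\<i> X \<otimes>\<^sub>m \<l> Y) \<cdot> \<a> X \<I> Y = \<r> X \<otimes>\<^sub>m \<i> Y"
    and symm_in: "X \<in> objects V \<Longrightarrow> Y \<in> objects V \<Longrightarrow> \<s> X Y \<in> Hom V (X \<otimes> Y) (Y \<otimes> X)"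
    and symm_nat: "f \<in> Hom V X X' \<Longrightarrow> g \<in> Hom V Y Y' \<Longrightarrow>
          \<s> X' Y' \<cdot> (f \<otimes>\<^sub>m g) = (g \<otimes>\<^sub>m f) \<cdot> \<s> X Y"
    and symm_symm: "X \<in> objects V \<Longrightarrow> Y \<in> objects V \<Longrightarrow> \<s> Y X \<cdot> \<s> X Y = \<i> (X \<otimes> Y)"
    and hexagon: "X \<in> objects V \<Longrightarrow> Y \<in> objects V \<Longrightarrow> Z \<in> objects V \<Longrightarrow>
          \<a> Y Z X \<cdot> \<s> X (Y \<otimes> Z) \<cdot> \<a> X Y Z
          = (\<i> Y \<otimes>\<^sub>m \<s> X Z) \<cdot> \<a> Y X Z \<cdot> (\<s> X Y \<otimes>\<^sub>m \<i> Z)"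
    and ihom_in: "X \<in> objects V \<Longrightarrow> Y \<in> objects V \<Longrightarrow> \<lbrakk>X, Y\<rbrakk> \<in> objects V"
    and ev_in: "X \<in> objects V \<Longrightarrow> Y \<in> objects V \<Longrightarrow> \<e> X Y \<in> Hom V (\<lbrakk>X, Y\<rbrakk> \<otimes> X) Y"
    and closed: "X \<in> objects V \<Longrightarrow> Y \<in> objects V \<Longrightarrow> Z \<in> objects V \<Longrightarrow>
          f \<in> Hom V (Z \<otimes> X) Y \<Longrightarrow>
          \<exists>!g. g \<in> Hom V Z \<lbrakk>X, Y\<rbrakk> \<and> \<e> X Y \<cdot> (g \<otimes>\<^sub>m \<i> X) = f"

context
  fixes V :: "('o, 'm) smcc" (structure)
begin

text \<open>The transpose \<open>Z \<rightarrow> [X, Y]\<close> of \<open>f : Z \<otimes> X \<rightarrow> Y\<close>.\<close>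

definition transpose :: "'o \<Rightarrow> 'o \<Rightarrow> 'o \<Rightarrow> 'm \<Rightarrow> 'm" where
  "transpose Z X Y f = (THE g. g \<in> Hom V Z \<lbrakk>X, Y\<rbrakk> \<and> \<e> X Y \<cdot> (g \<otimes>\<^sub>m \<i> X) = f)"

text \<open>\<open>[f, g] : [X, Y] \<rightarrow> [X', Y']\<close> for \<open>f : X' \<rightarrow> X\<close> and \<open>g : Y \<rightarrow> Y'\<close>.\<close>

definition ihom_map :: "'m \<Rightarrow> 'm \<Rightarrow> 'm" where
  "ihom_map f g =
     (let X' = source V f; X = target V f; Y = source V g; Y' = target V g
      in transpose \<lbrakk>X, Y\<rbrakk> X' Y' (g \<cdot> \<e> X Y \<cdot> (\<i> \<lbrakk>X, Y\<rbrakk> \<otimes>\<^sub>m f)))"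

text \<open>\<open>(W \<otimes> X) \<otimes> (Y \<otimes> Z) \<rightarrow> (W \<otimes> Y) \<otimes> (X \<otimes> Z)\<close>\<close>

definition middle_four :: "'o \<Rightarrow> 'o \<Rightarrow> 'o \<Rightarrow> 'o \<Rightarrow> 'm" where
  "middle_four W X Y Z =
     inv_arrow V (\<a> W Y (X \<otimes> Z)) \<cdot>
     (\<i> W \<otimes>\<^sub>m (\<a> Y X Z \<cdot> (\<s> X Y \<otimes>\<^sub>m \<i> Z) \<cdot> inv_arrow V (\<a> X Y Z))) \<cdot>
     \<a> W X (Y \<otimes> Z)"

text \<open>\<open>[X, Y] \<otimes> [X', Y'] \<rightarrow> [X \<otimes> X', Y \<otimes> Y']\<close>\<close>

definition ihom_tensor :: "'o \<Rightarrow> 'o \<Rightarrow> 'o \<Rightarrow> 'o \<Rightarrow> 'm" where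
  "ihom_tensor X Y X' Y' =
     transpose (\<lbrakk>X, Y\<rbrakk> \<otimes> \<lbrakk>X', Y'\<rbrakk>) (X \<otimes> X') (Y \<otimes> Y')
       ((\<e> X Y \<otimes>\<^sub>m \<e> X' Y') \<cdot> middle_four \<lbrakk>X, Y\<rbrakk> \<lbrakk>X', Y'\<rbrakk> X X')"


section \<open>Monoids, comonoids, Hopf monoids\<close>

definition is_monoid :: "'o \<Rightarrow> 'm \<Rightarrow> 'm \<Rightarrow> bool" where
  "is_monoid A m u \<longleftrightarrow>
     A \<in> objects V \<and> m \<in> Hom V (A \<otimes> A) A \<and> u \<in> Hom V \<I> A \<and>
     m \<cdot> (m \<otimes>\<^sub>m \<i> A) = m \<cdot> (\<i> A \<otimes>\<^sub>m m) \<cdot> \<a> A A A \<and>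
     m \<cdot> (u \<otimes>\<^sub>m \<i> A) = \<l> A \<and> m \<cdot> (\<i> A \<otimes>\<^sub>m u) = \<r> A"

definition is_commutative_monoid :: "'o \<Rightarrow> 'm \<Rightarrow> 'm \<Rightarrow> bool" where
  "is_commutative_monoid A m u \<longleftrightarrow> is_monoid A m u \<and> m \<cdot> \<s> A A = m"

definition is_comonoid :: "'o \<Rightarrow> 'm \<Rightarrow> 'm \<Rightarrow> bool" where
  "is_comonoid C d e \<longleftrightarrow>
     C \<in> objects V \<and> d \<in> Hom V C (C \<otimes> C) \<and> e \<in> Hom V C \<I> \<and>
     \<a> C C C \<cdot> (d \<otimes>\<^sub>m \<i> C) \<cdot> d = (\<i> C \<otimes>\<^sub>m d) \<cdot> d \<and>
     \<l> C \<cdot> (e \<otimes>\<^sub>m \<i> C) \<cdot> d = \<i> C \<and> \<r> C \<cdot> (\<i> C \<otimes>\<^sub>m e) \<cdot> d = \<i> C"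

definition monoid_homs :: "'o \<Rightarrow> 'm \<Rightarrow> 'm \<Rightarrow> 'o \<Rightarrow> 'm \<Rightarrow> 'm \<Rightarrow> 'm set" where
  "monoid_homs A m u A' m' u' =
     {f \<in> Hom V A A'. f \<cdot> m = m' \<cdot> (f \<otimes>\<^sub>m f) \<and> f \<cdot> u = u'}"

definition comonoid_homs :: "'o \<Rightarrow> 'm \<Rightarrow> 'm \<Rightarrow> 'o \<Rightarrow> 'm \<Rightarrow> 'm \<Rightarrow> 'm set" where
  "comonoid_homs C d e C' d' e' =
     {f \<in> Hom V C C'. d' \<cdot> f = (f \<otimes>\<^sub>m f) \<cdot> d \<and> e' \<cdot> f = e}"

text \<open>The comonoids \<open>C \<otimes> D\<close> and \<open>I\<close>.\<close>

definition tensor_comult :: "'o \<Rightarrow> 'm \<Rightarrow> 'o \<Rightarrow> 'm \<Rightarrow> 'm" where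
  "tensor_comult C d D d' = middle_four C C D D \<cdot> (d \<otimes>\<^sub>m d')"

definition tensor_counit :: "'m \<Rightarrow> 'm \<Rightarrow> 'm" where
  "tensor_counit e e' = \<l> \<I> \<cdot> (e \<otimes>\<^sub>m e')"

definition unit_comult :: 'm where
  "unit_comult = inv_arrow V (\<l> \<I>)"

definition unit_counit :: 'm where
  "unit_counit = \<i> \<I>"

text \<open>A bimonoid is a monoid in the monoidal category of comonoids.\<close>

definition is_bimonoid :: "'o \<Rightarrow> 'm \<Rightarrow> 'm \<Rightarrow> 'm \<Rightarrow> 'm \<Rightarrow> bool" where
  "is_bimonoid H m u d e \<longleftrightarrow>
     is_monoid H m u \<and> is_comonoid H d e \<and>
     m \<in> comonoid_homs (H \<otimes> H) (tensor_comult H d H d) (tensor_counit e e) H d e \<and>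
     u \<in> comonoid_homs \<I> unit_comult unit_counit H d e"

definition convolution :: "'m \<Rightarrow> 'm \<Rightarrow> 'm \<Rightarrow> 'm \<Rightarrow> 'm" where
  "convolution d m f g = m \<cdot> (f \<otimes>\<^sub>m g) \<cdot> d"

text \<open>
  \<open>f\<close> and \<open>g\<close> are mutually inverse in the convolution monoid \<open>V(C, A)\<close> of the comonoid
  \<open>(C, d, e)\<close> and the monoid \<open>(A, m, u)\<close>.
\<close>

definition convolution_inverse ::
  "'o \<Rightarrow> 'm \<Rightarrow> 'm \<Rightarrow> 'o \<Rightarrow> 'm \<Rightarrow> 'm \<Rightarrow> 'm \<Rightarrow> 'm \<Rightarrow> bool" where
  "convolution_inverse C d e A m u f g \<longleftrightarrow>
     f \<in> Hom V C A \<and> g \<in> Hom V C A \<and>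
     convolution d m f g = u \<cdot> e \<and> convolution d m g f = u \<cdot> e"

definition cop :: "'o \<Rightarrow> 'm \<Rightarrow> 'm" where
  "cop C d = inv_arrow V (\<s> C C) \<cdot> d"

definition is_hopf_monoid :: "'o \<Rightarrow> 'm \<Rightarrow> 'm \<Rightarrow> 'm \<Rightarrow> 'm \<Rightarrow> bool" where
  "is_hopf_monoid H m u d e \<longleftrightarrow>
     is_bimonoid H m u d e \<and> (\<exists>S. convolution_inverse H d e H m u (\<i> H) S)"

definition is_op_hopf_monoid :: "'o \<Rightarrow> 'm \<Rightarrow> 'm \<Rightarrow> 'm \<Rightarrow> 'm \<Rightarrow> bool" where
  "is_op_hopf_monoid H m u d e \<longleftrightarrow>
     is_bimonoid H m u d e \<and> (\<exists>S. convolution_inverse H (cop H d) e H m u (\<i> H) S)"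


section \<open>Comodules and the fundamental theorem\<close>

definition is_dual :: "'o \<Rightarrow> 'o \<Rightarrow> 'm \<Rightarrow> 'm \<Rightarrow> bool" where
  "is_dual X X' ep et \<longleftrightarrow>
     X \<in> objects V \<and> X' \<in> objects V \<and> ep \<in> Hom V (X' \<otimes> X) \<I> \<and> et \<in> Hom V \<I> (X \<otimes> X') \<and>
     \<r> X \<cdot> (\<i> X \<otimes>\<^sub>m ep) \<cdot> \<a> X X' X \<cdot> (et \<otimes>\<^sub>m \<i> X) \<cdot> inv_arrow V (\<l> X) = \<i> X \<and>
     \<l> X' \<cdot> (ep \<otimes>\<^sub>m \<i> X') \<cdot> inv_arrow V (\<a> X' X X') \<cdot> (\<i> X' \<otimes>\<^sub>m et) \<cdot> inv_arrow V (\<r> X') = \<i> X'"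

definition dualizable :: "'o \<Rightarrow> bool" where
  "dualizable X \<longleftrightarrow> (\<exists>X' ep et. is_dual X X' ep et)"

text \<open>
  Right comodules; left \<open>C\<close>-comodules are right comodules over the co-opposite of \<open>C\<close>, so the
  fundamental theorem below does not depend on the side.
\<close>

definition is_comodule :: "'o \<Rightarrow> 'm \<Rightarrow> 'm \<Rightarrow> 'o \<times> 'm \<Rightarrow> bool" where
  "is_comodule C d e = (\<lambda>(X, \<rho>).
     X \<in> objects V \<and> \<rho> \<in> Hom V X (X \<otimes> C) \<and>
     \<a> X C C \<cdot> (\<rho> \<otimes>\<^sub>m \<i> C) \<cdot> \<rho> = (\<i> X \<otimes>\<^sub>m d) \<cdot> \<rho> \<and>
     \<r> X \<cdot> (\<i> X \<otimes>\<^sub>m e) \<cdot> \<rho> = \<i> X)"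

definition Comod ::
  "'o \<Rightarrow> 'm \<Rightarrow> 'm \<Rightarrow> ('o \<times> 'm, ('o \<times> 'm) \<times> 'm \<times> ('o \<times> 'm)) category" where
  "Comod C d e = \<lparr>
     objects = {M. is_comodule C d e M},
     arrows = {(M, f, N). is_comodule C d e M \<and> is_comodule C d e N \<and>
                 f \<in> Hom V (fst M) (fst N) \<and> snd N \<cdot> f = (f \<otimes>\<^sub>m \<i> C) \<cdot> snd M},
     source = (\<lambda>(M, f, N). M),
     target = (\<lambda>(M, f, N). N),
     idn = (\<lambda>M. (M, \<i> (fst M), M)),
     cmp = (\<lambda>(N', g, P) (M, f, N). (M, g \<cdot> f, P)) \<rparr>"

definition fundamental_theorem_of_comodules :: "'u itself \<Rightarrow> bool" where
  "fundamental_theorem_of_comodules U \<longleftrightarrow>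
     (\<forall>C d e. is_comonoid C d e \<longrightarrow>
        (\<forall>M\<in>objects (Comod C d e). \<exists>(J :: ('u, 'u) category) Do Da \<kappa>.
           small_category J \<and> filtered J \<and> is_functor J (Comod C d e) Do Da \<and>
           (\<forall>j\<in>objects J. dualizable (fst (Do j))) \<and>
           is_colimit (Comod C d e) J Do Da M \<kappa>))"


section \<open>Universal measuring comonoids\<close>

text \<open>The convolution monoid structure on \<open>[C, B]\<close>.\<close>

definition ihom_mult :: "'o \<Rightarrow> 'm \<Rightarrow> 'o \<Rightarrow> 'm \<Rightarrow> 'm" where
  "ihom_mult C d B m = ihom_map d m \<cdot> ihom_tensor C B C B"

definition ihom_unit :: "'o \<Rightarrow> 'm \<Rightarrow> 'o \<Rightarrow> 'm \<Rightarrow> 'm" where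
  "ihom_unit C e B u = transpose \<I> C B (u \<cdot> e \<cdot> \<l> C)"

text \<open>The set \<open>Mon(V)(A, [C, B])\<close>.\<close>

definition measurings ::
  "'o \<Rightarrow> 'm \<Rightarrow> 'm \<Rightarrow> 'o \<Rightarrow> 'm \<Rightarrow> 'm \<Rightarrow> 'o \<Rightarrow> 'm \<Rightarrow> 'm \<Rightarrow> 'm set" where
  "measurings A mA uA B mB uB C d e =
     monoid_homs A mA uA \<lbrakk>C, B\<rbrakk> (ihom_mult C d B mB) (ihom_unit C e B uB)"

text \<open>
  \<open>(P, dP, eP)\<close> is a universal measuring comonoid \<open>P(A, B)\<close>, with the representing bijections
  \<open>\<phi> C d e : Mon(V)(A, [C, B]) \<rightarrow> Comon(V)(C, P)\<close>, natural in the comonoid \<open>(C, d, e)\<close>.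
\<close>

definition is_universal_measuring_comonoid ::
  "'o \<Rightarrow> 'm \<Rightarrow> 'm \<Rightarrow> 'o \<Rightarrow> 'm \<Rightarrow> 'm \<Rightarrow> 'o \<Rightarrow> 'm \<Rightarrow> 'm \<Rightarrow>
     ('o \<Rightarrow> 'm \<Rightarrow> 'm \<Rightarrow> 'm \<Rightarrow> 'm) \<Rightarrow> bool" where
  "is_universal_measuring_comonoid A mA uA B mB uB P dP eP \<phi> \<longleftrightarrow>
     is_comonoid P dP eP \<and>
     (\<forall>C d e. is_comonoid C d e \<longrightarrow>
        bij_betw (\<phi> C d e) (measurings A mA uA B mB uB C d e) (comonoid_homs C d e P dP eP)) \<and>
     (\<forall>C d e C' d' e' h f.
        is_comonoid C d e \<and> is_comonoid C' d' e' \<and> h \<in> comonoid_homs C' d' e' C d e \<and>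
        f \<in> measurings A mA uA B mB uB C d e \<longrightarrow>
        \<phi> C' d' e' (ihom_map h (\<i> B) \<cdot> f) = \<phi> C d e f \<cdot> h)"

text \<open>\<open>\<eta> : A \<rightarrow> [P(A, B), B]\<close> corresponds to the identity of \<open>P(A, B)\<close>.\<close>

definition universal_measuring ::
  "'o \<Rightarrow> 'm \<Rightarrow> 'm \<Rightarrow> 'o \<Rightarrow> 'm \<Rightarrow> 'm \<Rightarrow> 'o \<Rightarrow> 'm \<Rightarrow> 'm \<Rightarrow>
     ('o \<Rightarrow> 'm \<Rightarrow> 'm \<Rightarrow> 'm \<Rightarrow> 'm) \<Rightarrow> 'm" where
  "universal_measuring A mA uA B mB uB P dP eP \<phi> =
     the_inv_into (measurings A mA uA B mB uB P dP eP) (\<phi> P dP eP) (\<i> P)"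

text \<open>The multiplication and unit of \<open>P(A, B)\<close> for a bimonoid \<open>A\<close> and commutative \<open>B\<close>.\<close>

definition measuring_mult ::
  "'o \<Rightarrow> 'm \<Rightarrow> 'm \<Rightarrow> 'm \<Rightarrow> 'o \<Rightarrow> 'm \<Rightarrow> 'm \<Rightarrow> 'o \<Rightarrow> 'm \<Rightarrow> 'm \<Rightarrow>
     ('o \<Rightarrow> 'm \<Rightarrow> 'm \<Rightarrow> 'm \<Rightarrow> 'm) \<Rightarrow> 'm" where
  "measuring_mult A mA uA dA B mB uB P dP eP \<phi> =
     (let \<eta> = universal_measuring A mA uA B mB uB P dP eP \<phi>
      in \<phi> (P \<otimes> P) (tensor_comult P dP P dP) (tensor_counit eP eP)
           (ihom_map (\<i> (P \<otimes> P)) mB \<cdot> ihom_tensor P B P B \<cdot> (\<eta> \<otimes>\<^sub>m \<eta>) \<cdot> dA))"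

definition measuring_unit ::
  "'m \<Rightarrow> 'o \<Rightarrow> 'm \<Rightarrow> ('o \<Rightarrow> 'm \<Rightarrow> 'm \<Rightarrow> 'm \<Rightarrow> 'm) \<Rightarrow> 'm" where
  "measuring_unit eA B uB \<phi> =
     \<phi> \<I> unit_comult unit_counit (transpose B \<I> B (\<r> B) \<cdot> uB \<cdot> eA)"

end

unbundle no cardinal_syntax

end

theory Submission
  imports Defs
begin

text \<open>
  Comonoid morphisms \<open>C \<rightarrow> P = P(A, B)\<close> correspond to pairings \<open>A \<otimes> C \<rightarrow> B\<close>, the transposes of measurings;
  let \<open>\<epsilon>\<close> be the pairing of the identity. If \<open>\<sigma>\<close> is the antipode of \<open>A\<close>, then \<open>\<epsilon> (\<sigma> \<otimes> 1)\<close> is a pairing for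
  \<open>P\<^sup>c\<^sup>o\<^sup>p\<close>, because \<open>\<sigma>\<close> reverses products and \<open>B\<close> is commutative. It classifies a morphism
  \<open>\<Sigma> : P\<^sup>c\<^sup>o\<^sup>p \<rightarrow> P\<close>, the candidate antipode. The pairings of \<open>1 * \<Sigma>\<close> and of the convolution unit agree, but
  these maps are not comonoid morphisms, so the universal property does not apply to them directly.
  However, \<open>1 * \<Sigma>\<close> is the composite of \<open>\<Delta>\<close> with the comonoid morphism \<open>\<mu> (1 \<otimes> \<Sigma>) : P \<otimes> P\<^sup>c\<^sup>o\<^sup>p \<rightarrow> P\<close>,
  and the pushout \<open>Q\<close> in \<open>V\<close> of \<open>\<Delta> : P \<rightarrow> P \<otimes> P\<^sup>c\<^sup>o\<^sup>p\<close> and the counit \<open>P \<rightarrow> I\<close> is again a comonoid. As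
  \<open>A \<otimes> -\<close> preserves pushouts, the two pairings glue to a pairing for \<open>Q\<close>. The resulting morphism
  \<open>Q \<rightarrow> P\<close> restricts to \<open>\<mu> (1 \<otimes> \<Sigma>)\<close> and to the unit of \<open>P\<close>, so \<open>1 * \<Sigma>\<close> is the convolution unit. The other
  composite uses \<open>Q\<^sup>c\<^sup>o\<^sup>p\<close>, and the op-Hopf case replaces \<open>P\<close> by \<open>P\<^sup>c\<^sup>o\<^sup>p\<close> in the pushout.
\<close>

text \<open>The obstacle is that \<open>\<Delta> : P \<rightarrow> P \<otimes>
  P\<^sup>c\<^sup>o\<^sup>p\<close> is in general not a comonoid morphism. The pushout is therefore
  not one of comonoids, and its comonoid structure is built by hand. This works because the image of
  \<open>\<Delta>\<close> acts like a coideal once the counit is split off: the second factor of the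
  coproduct of \<open>x\<^sub>1 \<otimes> x\<^sub>2\<close> lies in the image again, becomes a
  scalar in \<open>Q\<close>, and the counit law restores
  \<open>x\<^sub>1 \<otimes> x\<^sub>2\<close> in the first factor. The co-opposite, forced by the
  antipode, is what makes this happen: it puts the neighbouring terms \<open>x\<^sub>2\<close>,
  \<open>x\<^sub>3\<close> together, whereas \<open>P \<otimes> P\<close> would pair
  \<open>x\<^sub>2\<close> with \<open>x\<^sub>4\<close>. Local presentability enters through the
  existence of this pushout, and closedness through its preservation by
  \<open>A \<otimes> -\<close>. Associators are kept throughout, so the coherence of the middle
  exchange is derived before any comonoid appears.\<close>

notation tensor_ar (infixl "\<odot>\<index>" 70)

context symmetric_monoidal_closed_category
begin

subsection \<open>Coherence\<close>

abbreviation arr :: "'m \<Rightarrow> bool" where "arr f \<equiv> f \<in> arrows V"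
abbreviation ob :: "'o \<Rightarrow> bool" where "ob X \<equiv> X \<in> objects V"
abbreviation dom :: "'m \<Rightarrow> 'o" where "dom \<equiv> source V"
abbreviation cod :: "'m \<Rightarrow> 'o" where "cod \<equiv> target V"
abbreviation inv_assoc :: "'o \<Rightarrow> 'o \<Rightarrow> 'o \<Rightarrow> 'm" ("\<a>\<^sup>-") where
  "\<a>\<^sup>- X Y Z \<equiv> inv_arrow V (\<a> X Y Z)"
abbreviation inv_left_unitor :: "'o \<Rightarrow> 'm" ("\<l>\<^sup>-") where "\<l>\<^sup>- X \<equiv> inv_arrow V (\<l> X)"
abbreviation inv_right_unitor :: "'o \<Rightarrow> 'm" ("\<r>\<^sup>-") where "\<r>\<^sup>- X \<equiv> inv_arrow V (\<r> X)"
abbreviation mid :: "'o \<Rightarrow> 'o \<Rightarrow> 'o \<Rightarrow> 'o \<Rightarrow> 'm" where "mid \<equiv> middle_four V"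

section \<open>Typing rules and normal forms of composites and tensor products\<close>

lemma Hom_iff [simp]: "f \<in> Hom V X Y \<longleftrightarrow> arr f \<and> dom f = X \<and> cod f = Y"
  by (auto simp: Hom_def)

lemma ob_dom [simp]: "arr f \<Longrightarrow> ob (dom f)" by (rule source_in)
lemma ob_cod [simp]: "arr f \<Longrightarrow> ob (cod f)" by (rule target_in)

lemma idn_typing [simp]:
  "ob X \<Longrightarrow> arr (\<i> X)" "ob X \<Longrightarrow> dom (\<i> X) = X" "ob X \<Longrightarrow> cod (\<i> X) = X"
  using idn_in by auto

lemma cmp_typing [simp]:
  assumes "arr f" "arr g" "dom g = cod f"
  shows "arr (g \<cdot> f)" "dom (g \<cdot> f) = dom f" "cod (g \<cdot> f) = cod g"
  using cmp_in[of f "dom f" "cod f" g "cod g"] assms by auto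

lemma cmp_idn [simp]:
  "arr f \<Longrightarrow> cod f = Y \<Longrightarrow> \<i> Y \<cdot> f = f" "arr f \<Longrightarrow> dom f = X \<Longrightarrow> f \<cdot> \<i> X = f"
  using idn_left[of f "dom f" "cod f"] idn_right[of f "dom f" "cod f"] by auto

lemma assoc [simp]:
  assumes "arr f" "arr g" "arr h" "dom g = cod f" "dom h = cod g"
  shows "(h \<cdot> g) \<cdot> f = h \<cdot> g \<cdot> f"
  using cmp_assoc[of f "dom f" "cod f" g "cod g" h "cod h"] assms by auto

lemma tensor_typing [simp]:
  assumes "arr f" "arr g"
  shows "arr (f \<odot> g)" "dom (f \<odot> g) = dom f \<otimes> dom g" "cod (f \<odot> g) = cod f \<otimes> cod g"
  using tensor_ar_in[of f "dom f" "cod f" g "dom g" "cod g"] assms by auto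

declare tensor_ob_in [simp] unit_in [simp] tensor_idn [simp]

text \<open>As a rewrite rule this merges neighbouring tensor products of arrows. A calculation that
  needs them split, so that a naturality square becomes visible, states the split form and has it
  confirmed by simplification.\<close>

lemma tensor_cmp [simp]:
  assumes "arr f" "arr f'" "arr g" "arr g'" "dom f' = cod f" "dom g' = cod g"
  shows "(f' \<odot> g') \<cdot> (f \<odot> g) = (f' \<cdot> f) \<odot> (g' \<cdot> g)"
  using interchange[of f "dom f" "cod f" f' "cod f'" g "dom g" "cod g" g' "cod g'"] assms by auto

text \<open>Simplification nests composites to the right, so an equation for
  \<open>g \<cdot> f\<close> does not match inside \<open>g \<cdot> f \<cdot> k\<close>. This adds
  the trailing \<open>k\<close>; the lemmas with suffix \<open>_tail\<close> are instances.\<close>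

lemma tail:
  assumes "g \<cdot> f = h" "arr f" "arr g" "dom g = cod f" "arr k" "cod k = dom f"
  shows "g \<cdot> f \<cdot> k = h \<cdot> k"
  using assoc[of k f g] assms by simp

lemma tensor_cmp_tail [simp]:
  assumes "arr f" "arr f'" "arr g" "arr g'" "dom f' = cod f" "dom g' = cod g"
    "arr k" "cod k = dom f \<otimes> dom g"
  shows "(f' \<odot> g') \<cdot> (f \<odot> g) \<cdot> k = ((f' \<cdot> f) \<odot> (g' \<cdot> g)) \<cdot> k"
  by (rule tail) (use assms in auto)

section \<open>Inverses and cancellation\<close>

lemma inverse_arrows_unique:
  assumes "inverse_arrows V f g" "inverse_arrows V f h"
  shows "h = g"
proof -
  have t: "arr f" "arr g" "arr h" "dom g = cod f" "cod g = dom f" "dom h = cod f" "cod h = dom f"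
    and e: "h \<cdot> f = \<i> (dom f)" "f \<cdot> g = \<i> (cod f)"
    using assms unfolding inverse_arrows_def by auto
  have "(h \<cdot> f) \<cdot> g = h \<cdot> f \<cdot> g" using t by (intro assoc) auto
  then show ?thesis using t unfolding e by simp
qed

lemma inverse_arrows_inv_arrow: "is_iso V f \<Longrightarrow> inverse_arrows V f (inv_arrow V f)"
  unfolding is_iso_def inv_arrow_def by (metis inverse_arrows_unique theI)

lemma inv_arrow_eqI:
  assumes "arr f" "arr g" "dom g = cod f" "cod g = dom f" "g \<cdot> f = \<i> (dom f)" "f \<cdot> g = \<i> (cod f)"
  shows "inv_arrow V f = g"
proof -
  have "inverse_arrows V f g" using assms by (simp add: inverse_arrows_def)
  then show ?thesis by (metis inverse_arrows_unique inverse_arrows_inv_arrow is_iso_def)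
qed

lemma iso_typing:
  assumes "is_iso V f" "f \<in> Hom V X Y"
  shows "inv_arrow V f \<in> Hom V Y X" "inv_arrow V f \<cdot> f = \<i> X" "f \<cdot> inv_arrow V f = \<i> Y"
    "\<And>k. arr k \<Longrightarrow> cod k = X \<Longrightarrow> inv_arrow V f \<cdot> f \<cdot> k = k"
    "\<And>k. arr k \<Longrightarrow> cod k = Y \<Longrightarrow> f \<cdot> inv_arrow V f \<cdot> k = k"
proof -
  have *: "inverse_arrows V f (inv_arrow V f)" using assms inverse_arrows_inv_arrow by simp
  then show 1: "inv_arrow V f \<in> Hom V Y X" "inv_arrow V f \<cdot> f = \<i> X" "f \<cdot> inv_arrow V f = \<i> Y"
    using assms unfolding inverse_arrows_def by auto
  show "inv_arrow V f \<cdot> f \<cdot> k = k" if "arr k" "cod k = X" for k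
    using tail[OF 1(2), where k=k] 1 assms that by simp
  show "f \<cdot> inv_arrow V f \<cdot> k = k" if "arr k" "cod k = Y" for k
    using tail[OF 1(3), where k=k] 1 assms that by simp
qed

lemma structure_typing [simp]:
  assumes "ob X"
  shows "arr (\<l> X)" "dom (\<l> X) = \<I> \<otimes> X" "cod (\<l> X) = X"
    "arr (\<r> X)" "dom (\<r> X) = X \<otimes> \<I>" "cod (\<r> X) = X"
    "arr (\<l>\<^sup>- X)" "cod (\<l>\<^sup>- X) = \<I> \<otimes> X" "dom (\<l>\<^sup>- X) = X"
    "arr (\<r>\<^sup>- X)" "cod (\<r>\<^sup>- X) = X \<otimes> \<I>" "dom (\<r>\<^sup>- X) = X"
    "\<l>\<^sup>- X \<cdot> \<l> X = \<i> (\<I> \<otimes> X)" "\<l> X \<cdot> \<l>\<^sup>- X = \<i> X"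
    "\<r>\<^sup>- X \<cdot> \<r> X = \<i> (X \<otimes> \<I>)" "\<r> X \<cdot> \<r>\<^sup>- X = \<i> X"
    "\<And>k. arr k \<Longrightarrow> cod k = \<I> \<otimes> X \<Longrightarrow> \<l>\<^sup>- X \<cdot> \<l> X \<cdot> k = k"
    "\<And>k. arr k \<Longrightarrow> cod k = X \<Longrightarrow> \<l> X \<cdot> \<l>\<^sup>- X \<cdot> k = k"
    "\<And>k. arr k \<Longrightarrow> cod k = X \<otimes> \<I> \<Longrightarrow> \<r>\<^sup>- X \<cdot> \<r> X \<cdot> k = k"
    "\<And>k. arr k \<Longrightarrow> cod k = X \<Longrightarrow> \<r> X \<cdot> \<r>\<^sup>- X \<cdot> k = k"
  using left_unitor_in[OF assms] right_unitor_in[OF assms]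
    iso_typing[of "\<l> X" "\<I> \<otimes> X" X] iso_typing[of "\<r> X" "X \<otimes> \<I>" X] by auto

lemma symm_typing [simp]:
  assumes "ob X" "ob Y"
  shows "arr (\<s> X Y)" "dom (\<s> X Y) = X \<otimes> Y" "cod (\<s> X Y) = Y \<otimes> X" "\<s> Y X \<cdot> \<s> X Y = \<i> (X \<otimes> Y)"
    "\<And>k. arr k \<Longrightarrow> cod k = X \<otimes> Y \<Longrightarrow> \<s> Y X \<cdot> \<s> X Y \<cdot> k = k"
proof -
  show 1: "arr (\<s> X Y)" "dom (\<s> X Y) = X \<otimes> Y" "cod (\<s> X Y) = Y \<otimes> X" "\<s> Y X \<cdot> \<s> X Y = \<i> (X \<otimes> Y)"
    using symm_in symm_symm assms by auto
  show "\<s> Y X \<cdot> \<s> X Y \<cdot> k = k" if "arr k" "cod k = X \<otimes> Y" for k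
    using tail[OF 1(4), where k=k] symm_in[of X Y] symm_in[of Y X] assms that by simp
qed

lemma assoc_typing [simp]:
  assumes "ob X" "ob Y" "ob Z"
  shows "arr (\<a> X Y Z)" "dom (\<a> X Y Z) = (X \<otimes> Y) \<otimes> Z" "cod (\<a> X Y Z) = X \<otimes> (Y \<otimes> Z)"
    "arr (\<a>\<^sup>- X Y Z)" "cod (\<a>\<^sup>- X Y Z) = (X \<otimes> Y) \<otimes> Z" "dom (\<a>\<^sup>- X Y Z) = X \<otimes> (Y \<otimes> Z)"
    "\<a>\<^sup>- X Y Z \<cdot> \<a> X Y Z = \<i> ((X \<otimes> Y) \<otimes> Z)" "\<a> X Y Z \<cdot> \<a>\<^sup>- X Y Z = \<i> (X \<otimes> (Y \<otimes> Z))"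
    "\<And>k. arr k \<Longrightarrow> cod k = (X \<otimes> Y) \<otimes> Z \<Longrightarrow> \<a>\<^sup>- X Y Z \<cdot> \<a> X Y Z \<cdot> k = k"
    "\<And>k. arr k \<Longrightarrow> cod k = X \<otimes> (Y \<otimes> Z) \<Longrightarrow> \<a> X Y Z \<cdot> \<a>\<^sup>- X Y Z \<cdot> k = k"
  using associator_in[OF assms] iso_typing[of "\<a> X Y Z" "(X \<otimes> Y) \<otimes> Z" "X \<otimes> (Y \<otimes> Z)"] by auto

text \<open>Cancellation takes an explicit one-sided inverse instead of \<open>is_iso\<close>, so
  that a composite of structure arrows is cancelled by writing down the reversed composite of their
  inverses.\<close>

lemma iso_mono:
  assumes "g \<cdot> f = g \<cdot> f'" "g' \<cdot> g = \<i> X" "arr g" "arr g'" "dom g = X" "dom g' = cod g"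
    "arr f" "arr f'" "cod f = X" "cod f' = X"
  shows "f = f'"
  using assms by (metis assoc cmp_idn(1))

lemma iso_epi:
  assumes "f \<cdot> g = f' \<cdot> g" "g \<cdot> g' = \<i> X" "arr g" "arr g'" "cod g = X" "cod g' = dom g"
    "arr f" "arr f'" "dom f = X" "dom f' = X"
  shows "f = f'"
  using assms by (metis assoc cmp_idn(2))

text \<open>The objects are variables tied to domains and codomains by premises, so the left-hand
  side unifies with whatever object expressions a goal contains and the equations are left to
  simplification. The later naturality lemmas have the same form.\<close>

lemma assoc_nat:
  assumes "arr f" "arr g" "arr h" "X = dom f" "X' = cod f" "Y = dom g" "Y' = cod g" "Z = dom h" "Z' = cod h"
  shows "\<a> X' Y' Z' \<cdot> ((f \<odot> g) \<odot> h) = (f \<odot> (g \<odot> h)) \<cdot> \<a> X Y Z"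
  using associator_nat[of f X X' g Y Y' h Z Z'] assms by auto

lemma assoc_nat_tail:
  assumes "arr f" "arr g" "arr h" "X = dom f" "X' = cod f" "Y = dom g" "Y' = cod g" "Z = dom h" "Z' = cod h"
    "arr k" "cod k = (X \<otimes> Y) \<otimes> Z"
  shows "\<a> X' Y' Z' \<cdot> ((f \<odot> g) \<odot> h) \<cdot> k = (f \<odot> (g \<odot> h)) \<cdot> \<a> X Y Z \<cdot> k"
  using tail[OF assoc_nat[of f g h], where k=k] assms by auto

lemma inv_assoc_nat:
  assumes "arr f" "arr g" "arr h" "X = dom f" "X' = cod f" "Y = dom g" "Y' = cod g" "Z = dom h" "Z' = cod h"
  shows "\<a>\<^sup>- X' Y' Z' \<cdot> (f \<odot> (g \<odot> h)) = ((f \<odot> g) \<odot> h) \<cdot> \<a>\<^sup>- X Y Z"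
proof -
  have "\<a>\<^sup>- X' Y' Z' \<cdot> (f \<odot> (g \<odot> h)) = \<a>\<^sup>- X' Y' Z' \<cdot> ((f \<odot> (g \<odot> h)) \<cdot> \<a> X Y Z) \<cdot> \<a>\<^sup>- X Y Z"
    using assms by simp
  also have "\<dots> = \<a>\<^sup>- X' Y' Z' \<cdot> (\<a> X' Y' Z' \<cdot> ((f \<odot> g) \<odot> h)) \<cdot> \<a>\<^sup>- X Y Z"
    using assoc_nat[OF assms] by simp
  also have "\<dots> = ((f \<odot> g) \<odot> h) \<cdot> \<a>\<^sup>- X Y Z" using assms by simp
  finally show ?thesis .
qed

lemma inv_assoc_nat_tail:
  assumes "arr f" "arr g" "arr h" "X = dom f" "X' = cod f" "Y = dom g" "Y' = cod g" "Z = dom h" "Z' = cod h"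
    "arr k" "cod k = X \<otimes> (Y \<otimes> Z)"
  shows "\<a>\<^sup>- X' Y' Z' \<cdot> (f \<odot> (g \<odot> h)) \<cdot> k = ((f \<odot> g) \<odot> h) \<cdot> \<a>\<^sup>- X Y Z \<cdot> k"
  using tail[OF inv_assoc_nat[of f g h], where k=k] assms by auto

lemma left_nat: "arr f \<Longrightarrow> X = dom f \<Longrightarrow> X' = cod f \<Longrightarrow> \<l> X' \<cdot> (\<i> \<I> \<odot> f) = f \<cdot> \<l> X"
  using left_unitor_nat[of f X X'] by simp

lemma right_nat: "arr f \<Longrightarrow> X = dom f \<Longrightarrow> X' = cod f \<Longrightarrow> \<r> X' \<cdot> (f \<odot> \<i> \<I>) = f \<cdot> \<r> X"
  using right_unitor_nat[of f X X'] by simp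

lemma left_nat_tail:
  "arr f \<Longrightarrow> X = dom f \<Longrightarrow> X' = cod f \<Longrightarrow> arr k \<Longrightarrow> cod k = \<I> \<otimes> X \<Longrightarrow>
    \<l> X' \<cdot> (\<i> \<I> \<odot> f) \<cdot> k = f \<cdot> \<l> X \<cdot> k"
  using tail[OF left_nat[of f X X'], where k=k] by simp

lemma right_nat_tail:
  "arr f \<Longrightarrow> X = dom f \<Longrightarrow> X' = cod f \<Longrightarrow> arr k \<Longrightarrow> cod k = X \<otimes> \<I> \<Longrightarrow>
    \<r> X' \<cdot> (f \<odot> \<i> \<I>) \<cdot> k = f \<cdot> \<r> X \<cdot> k"
  using tail[OF right_nat[of f X X'], where k=k] by simp

lemma inv_right_nat: 
  assumes "arr f" "X = dom f" "X' = cod f" shows "\<r>\<^sup>- X' \<cdot> f = (f \<odot> \<i> \<I>) \<cdot> \<r>\<^sup>- X"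
proof (rule iso_mono[of "\<r> X'" _ _ "\<r>\<^sup>- X'"])
  show "\<r> X' \<cdot> \<r>\<^sup>- X' \<cdot> f = \<r> X' \<cdot> (f \<odot> \<i> \<I>) \<cdot> \<r>\<^sup>- X"
    using right_nat_tail[OF assms, of "\<r>\<^sup>- X"] assms by simp
qed (use assms in auto)

lemma s_nat:
  "arr f \<Longrightarrow> arr g \<Longrightarrow> X = dom f \<Longrightarrow> X' = cod f \<Longrightarrow> Y = dom g \<Longrightarrow> Y' = cod g \<Longrightarrow>
    \<s> X' Y' \<cdot> (f \<odot> g) = (g \<odot> f) \<cdot> \<s> X Y"
  using symm_nat[of f X X' g Y Y'] by simp

lemma s_nat_tail:
  "arr f \<Longrightarrow> arr g \<Longrightarrow> X = dom f \<Longrightarrow> X' = cod f \<Longrightarrow> Y = dom g \<Longrightarrow> Y' = cod g \<Longrightarrow>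
    arr k \<Longrightarrow> cod k = X \<otimes> Y \<Longrightarrow> \<s> X' Y' \<cdot> (f \<odot> g) \<cdot> k = (g \<odot> f) \<cdot> \<s> X Y \<cdot> k"
  using tail[OF s_nat[of f g X X' Y Y'], where k=k] by simp

text \<open>The left unitor is a natural isomorphism from \<open>\<I> \<otimes> -\<close> to the
  identity functor. An equation may thus be proved after a unit factor has been added, where the
  pentagon and the triangle apply.\<close>

lemma unit_tensor_faithful:
  assumes "\<i> \<I> \<odot> f = \<i> \<I> \<odot> g" "arr f" "arr g" "dom f = dom g" "cod f = cod g"
  shows "f = g"
proof (rule iso_epi[of f "\<l> (dom f)" g "\<l>\<^sup>- (dom f)"])
  show "f \<cdot> \<l> (dom f) = g \<cdot> \<l> (dom f)"
    using left_nat[of f "dom f" "cod f"] left_nat[of g "dom f" "cod f"] assms by simp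
qed (use assms in auto)

lemma tensor_unit_faithful:
  assumes "f \<odot> \<i> \<I> = g \<odot> \<i> \<I>" "arr f" "arr g" "dom f = dom g" "cod f = cod g"
  shows "f = g"
proof (rule iso_epi[of f "\<r> (dom f)" g "\<r>\<^sup>- (dom f)"])
  show "f \<cdot> \<r> (dom f) = g \<cdot> \<r> (dom f)"
    using right_nat[of f "dom f" "cod f"] right_nat[of g "dom f" "cod f"] assms by simp
qed (use assms in auto)

section \<open>Unit coherence from the pentagon and the triangle\<close>

lemma pentagon_idn:
  assumes [simp]: "ob W" "ob X" "ob Y" "ob Z"
  shows "\<a> W X (Y \<otimes> Z) \<cdot> \<a> (W \<otimes> X) Y Z = (\<i> W \<odot> \<a> X Y Z) \<cdot> \<a> W (X \<otimes> Y) Z \<cdot> (\<a> W X Y \<odot> \<i> Z)"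
  using pentagon[OF assms] by simp

text \<open>Kelly's argument: after tensoring with \<open>\<I>\<close> and composing with the
  isomorphism \<open>?b\<close>, the pentagon at \<open>\<I>, \<I>, X, Y\<close> and two instances
  of the triangle axiom rewrite the left side into the right.\<close>

lemma triangle_left:
  assumes [simp]: "ob X" "ob Y"
  shows "\<l> (X \<otimes> Y) \<cdot> \<a> \<I> X Y = \<l> X \<odot> \<i> Y"
proof (rule unit_tensor_faithful)
  show "\<i> \<I> \<odot> (\<l> (X \<otimes> Y) \<cdot> \<a> \<I> X Y) = \<i> \<I> \<odot> (\<l> X \<odot> \<i> Y)"
  proof (rule iso_epi)
    let ?b = "\<a> \<I> (\<I> \<otimes> X) Y \<cdot> (\<a> \<I> \<I> X \<odot> \<i> Y)"
    have "(\<i> \<I> \<odot> (\<l> (X \<otimes> Y) \<cdot> \<a> \<I> X Y)) \<cdot> ?b =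
        (\<i> \<I> \<odot> \<l> (X \<otimes> Y)) \<cdot> ((\<i> \<I> \<odot> \<a> \<I> X Y) \<cdot> \<a> \<I> (\<I> \<otimes> X) Y \<cdot> (\<a> \<I> \<I> X \<odot> \<i> Y))"
      by simp
    also have "\<dots> = (\<i> \<I> \<odot> \<l> (X \<otimes> Y)) \<cdot> \<a> \<I> \<I> (X \<otimes> Y) \<cdot> \<a> (\<I> \<otimes> \<I>) X Y"
      by (simp add: pentagon_idn)
    also have "\<dots> = ((\<i> \<I> \<odot> \<l> (X \<otimes> Y)) \<cdot> \<a> \<I> \<I> (X \<otimes> Y)) \<cdot> \<a> (\<I> \<otimes> \<I>) X Y" by simp
    also have "\<dots> = (\<r> \<I> \<odot> (\<i> X \<odot> \<i> Y)) \<cdot> \<a> (\<I> \<otimes> \<I>) X Y" using triangle by simp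
    also have "\<dots> = \<a> \<I> X Y \<cdot> ((\<r> \<I> \<odot> \<i> X) \<odot> \<i> Y)" by (subst assoc_nat) auto
    also have "\<r> \<I> \<odot> \<i> X = (\<i> \<I> \<odot> \<l> X) \<cdot> \<a> \<I> \<I> X" using triangle by simp
    also have "\<a> \<I> X Y \<cdot> (((\<i> \<I> \<odot> \<l> X) \<cdot> \<a> \<I> \<I> X) \<odot> \<i> Y) =
        (\<a> \<I> X Y \<cdot> ((\<i> \<I> \<odot> \<l> X) \<odot> \<i> Y)) \<cdot> (\<a> \<I> \<I> X \<odot> \<i> Y)" by simp
    also have "\<dots> = ((\<i> \<I> \<odot> (\<l> X \<odot> \<i> Y)) \<cdot> \<a> \<I> (\<I> \<otimes> X) Y) \<cdot> (\<a> \<I> \<I> X \<odot> \<i> Y)"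
      by (subst assoc_nat) auto
    finally show "(\<i> \<I> \<odot> (\<l> (X \<otimes> Y) \<cdot> \<a> \<I> X Y)) \<cdot> ?b = (\<i> \<I> \<odot> (\<l> X \<odot> \<i> Y)) \<cdot> ?b" by simp
    show "?b \<cdot> ((\<a>\<^sup>- \<I> \<I> X \<odot> \<i> Y) \<cdot> \<a>\<^sup>- \<I> (\<I> \<otimes> X) Y) = \<i> (\<I> \<otimes> ((\<I> \<otimes> X) \<otimes> Y))" by simp
  qed auto
qed auto

text \<open>The mirror image of \<open>triangle_left\<close>: the unit factor is added on the right,
  and the pentagon is taken at \<open>X, Y, \<I>, \<I>\<close>.\<close>

lemma triangle_right:
  assumes [simp]: "ob X" "ob Y"
  shows "(\<i> X \<odot> \<r> Y) \<cdot> \<a> X Y \<I> = \<r> (X \<otimes> Y)"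
proof (rule tensor_unit_faithful)
  show "((\<i> X \<odot> \<r> Y) \<cdot> \<a> X Y \<I>) \<odot> \<i> \<I> = \<r> (X \<otimes> Y) \<odot> \<i> \<I>"
  proof (rule iso_mono[of "\<a> X Y \<I>"])
    have "\<a> X Y \<I> \<cdot> (\<r> (X \<otimes> Y) \<odot> \<i> \<I>) = \<a> X Y \<I> \<cdot> (\<i> (X \<otimes> Y) \<odot> \<l> \<I>) \<cdot> \<a> (X \<otimes> Y) \<I> \<I>"
      using triangle by simp
    also have "\<dots> = (\<a> X Y \<I> \<cdot> ((\<i> X \<odot> \<i> Y) \<odot> \<l> \<I>)) \<cdot> \<a> (X \<otimes> Y) \<I> \<I>" by simp
    also have "\<dots> = ((\<i> X \<odot> (\<i> Y \<odot> \<l> \<I>)) \<cdot> \<a> X Y (\<I> \<otimes> \<I>)) \<cdot> \<a> (X \<otimes> Y) \<I> \<I>"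
      by (subst assoc_nat) auto
    also have "\<dots> = (\<i> X \<odot> (\<i> Y \<odot> \<l> \<I>)) \<cdot> (\<a> X Y (\<I> \<otimes> \<I>) \<cdot> \<a> (X \<otimes> Y) \<I> \<I>)" by simp
    also have "\<dots> = (\<i> X \<odot> ((\<i> Y \<odot> \<l> \<I>) \<cdot> \<a> Y \<I> \<I>)) \<cdot> \<a> X (Y \<otimes> \<I>) \<I> \<cdot> (\<a> X Y \<I> \<odot> \<i> \<I>)"
      by (subst pentagon_idn) auto
    also have "\<dots> = ((\<i> X \<odot> (\<r> Y \<odot> \<i> \<I>)) \<cdot> \<a> X (Y \<otimes> \<I>) \<I>) \<cdot> (\<a> X Y \<I> \<odot> \<i> \<I>)"
      using triangle by simp
    also have "\<dots> = (\<a> X Y \<I> \<cdot> ((\<i> X \<odot> \<r> Y) \<odot> \<i> \<I>)) \<cdot> (\<a> X Y \<I> \<odot> \<i> \<I>)"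
      by (subst assoc_nat) auto
    finally show "\<a> X Y \<I> \<cdot> (((\<i> X \<odot> \<r> Y) \<cdot> \<a> X Y \<I>) \<odot> \<i> \<I>) = \<a> X Y \<I> \<cdot> (\<r> (X \<otimes> Y) \<odot> \<i> \<I>)"
      by simp
  qed (rule assoc_typing(7); auto | auto)+
qed auto

text \<open>Naturality of \<open>\<l>\<close> at \<open>\<l> \<I>\<close> identifies
  \<open>\<l> (\<I> \<otimes> \<I>)\<close> with \<open>\<i> \<I> \<odot> \<l> \<I>\<close>. The two
  triangles at \<open>\<I>, \<I>\<close> then have the same left-hand side.\<close>

lemma unitors_unit: "\<r> \<I> = \<l> \<I>"
proof (rule tensor_unit_faithful)
  have "\<l> (\<I> \<otimes> \<I>) = \<i> \<I> \<odot> \<l> \<I>"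
    by (rule iso_mono[of "\<l> \<I>" _ _ "\<l>\<^sup>- \<I>"]) (use left_nat[of "\<l> \<I>" "\<I> \<otimes> \<I>" \<I>] in auto)
  then have "(\<i> \<I> \<odot> \<l> \<I>) \<cdot> \<a> \<I> \<I> \<I> = \<l> \<I> \<odot> \<i> \<I>"
    using triangle_left[of \<I> \<I>] by simp
  then show "\<r> \<I> \<odot> \<i> \<I> = \<l> \<I> \<odot> \<i> \<I>" using triangle[of \<I> \<I>] by simp
qed auto

section \<open>The symmetry and the unit object\<close>

lemma hexagon_cmp:
  assumes [simp]: "ob X" "ob Y" "ob Z"
  shows "\<a> Y Z X \<cdot> \<s> X (Y \<otimes> Z) = (\<i> Y \<odot> \<s> X Z) \<cdot> \<a> Y X Z \<cdot> (\<s> X Y \<odot> \<i> Z) \<cdot> \<a>\<^sup>- X Y Z"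
proof -
  have "\<a> Y Z X \<cdot> \<s> X (Y \<otimes> Z) = (\<a> Y Z X \<cdot> \<s> X (Y \<otimes> Z) \<cdot> \<a> X Y Z) \<cdot> \<a>\<^sup>- X Y Z" by simp
  also have "\<dots> = ((\<i> Y \<odot> \<s> X Z) \<cdot> \<a> Y X Z \<cdot> (\<s> X Y \<odot> \<i> Z)) \<cdot> \<a>\<^sup>- X Y Z"
    by (simp only: hexagon assms)
  finally show ?thesis by simp
qed

text \<open>The hexagon at \<open>X, \<I>, \<I>\<close> expresses two passages of \<open>X\<close>
  past \<open>\<I>\<close> by one past \<open>\<I> \<otimes> \<I>\<close>, and naturality at
  \<open>\<l> \<I>\<close> turns the latter into a single passage, which cancels.\<close>

lemma left_unitor_symm:
  assumes [simp]: "ob X"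
  shows "\<l> X \<cdot> \<s> X \<I> = \<r> X"
proof (rule tensor_unit_faithful)
  let ?r = "(\<l> X \<cdot> \<s> X \<I>) \<odot> \<i> \<I>"
  have "\<s> X \<I> \<cdot> ?r = \<s> X \<I> \<cdot> (\<l> X \<odot> \<i> \<I>) \<cdot> (\<s> X \<I> \<odot> \<i> \<I>)" by simp
  also have "\<dots> = \<s> X \<I> \<cdot> (\<l> (X \<otimes> \<I>) \<cdot> \<a> \<I> X \<I>) \<cdot> (\<s> X \<I> \<odot> \<i> \<I>)"
    by (simp only: triangle_left assms unit_in)
  also have "\<dots> = (\<s> X \<I> \<cdot> \<l> (X \<otimes> \<I>)) \<cdot> \<a> \<I> X \<I> \<cdot> (\<s> X \<I> \<odot> \<i> \<I>)" by simp
  also have "\<s> X \<I> \<cdot> \<l> (X \<otimes> \<I>) = \<l> (\<I> \<otimes> X) \<cdot> (\<i> \<I> \<odot> \<s> X \<I>)" by (subst left_nat) auto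
  also have "\<dots> \<cdot> \<a> \<I> X \<I> \<cdot> (\<s> X \<I> \<odot> \<i> \<I>) =
      \<l> (\<I> \<otimes> X) \<cdot> ((\<i> \<I> \<odot> \<s> X \<I>) \<cdot> \<a> \<I> X \<I> \<cdot> (\<s> X \<I> \<odot> \<i> \<I>))" by simp
  also have "\<dots> = \<l> (\<I> \<otimes> X) \<cdot> \<a> \<I> \<I> X \<cdot> \<s> X (\<I> \<otimes> \<I>) \<cdot> \<a> X \<I> \<I>"
    using hexagon[of X \<I> \<I>] by simp
  also have "\<dots> = (\<l> (\<I> \<otimes> X) \<cdot> \<a> \<I> \<I> X) \<cdot> \<s> X (\<I> \<otimes> \<I>) \<cdot> \<a> X \<I> \<I>" by simp
  also have "\<dots> = (\<l> \<I> \<odot> \<i> X) \<cdot> \<s> X (\<I> \<otimes> \<I>) \<cdot> \<a> X \<I> \<I>"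
    by (simp only: triangle_left assms unit_in)
  also have "\<dots> = ((\<l> \<I> \<odot> \<i> X) \<cdot> \<s> X (\<I> \<otimes> \<I>)) \<cdot> \<a> X \<I> \<I>" by simp
  also have "\<dots> = (\<s> X \<I> \<cdot> (\<i> X \<odot> \<l> \<I>)) \<cdot> \<a> X \<I> \<I>" by (subst s_nat) auto
  also have "\<dots> = \<s> X \<I> \<cdot> (\<r> X \<odot> \<i> \<I>)" using triangle[of X \<I>] by simp
  finally have e: "\<s> X \<I> \<cdot> ?r = \<s> X \<I> \<cdot> (\<r> X \<odot> \<i> \<I>)" .
  show "?r = \<r> X \<odot> \<i> \<I>"
    by (rule iso_mono[OF e, of "\<s> \<I> X"]) auto
qed auto

lemma right_unitor_symm:
  assumes [simp]: "ob X"
  shows "\<r> X \<cdot> \<s> \<I> X = \<l> X"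
  by (simp add: left_unitor_symm[symmetric])

lemma symm_unit_unit: "\<s> \<I> \<I> = \<i> (\<I> \<otimes> \<I>)"
  by (rule iso_mono[of "\<l> \<I>" _ _ "\<l>\<^sup>- \<I>"]) (use left_unitor_symm[of \<I>] unitors_unit in auto)

section \<open>Exchanges of neighbouring factors and the middle exchange\<close>

definition sw :: "'o \<Rightarrow> 'o \<Rightarrow> 'o \<Rightarrow> 'm" where
  "sw X Y K = \<a> Y X K \<cdot> (\<s> X Y \<odot> \<i> K) \<cdot> \<a>\<^sup>- X Y K"

lemma sw_typing [simp]:
  assumes [simp]: "ob X" "ob Y" "ob K"
  shows "arr (sw X Y K)" "dom (sw X Y K) = X \<otimes> (Y \<otimes> K)" "cod (sw X Y K) = Y \<otimes> (X \<otimes> K)"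
    "sw Y X K \<cdot> sw X Y K = \<i> (X \<otimes> (Y \<otimes> K))"
    "\<And>k. arr k \<Longrightarrow> cod k = X \<otimes> (Y \<otimes> K) \<Longrightarrow> sw Y X K \<cdot> sw X Y K \<cdot> k = k"
proof -
  show 1: "arr (sw X Y K)" "dom (sw X Y K) = X \<otimes> (Y \<otimes> K)" "cod (sw X Y K) = Y \<otimes> (X \<otimes> K)"
    by (simp_all add: sw_def)
  show 2: "sw Y X K \<cdot> sw X Y K = \<i> (X \<otimes> (Y \<otimes> K))" by (simp add: sw_def)
  show "sw Y X K \<cdot> sw X Y K \<cdot> k = k" if "arr k" "cod k = X \<otimes> (Y \<otimes> K)" for k
    using that by (simp add: sw_def)
qed

lemma sw_assoc: "ob X \<Longrightarrow> ob Y \<Longrightarrow> ob K \<Longrightarrow> \<a> Y X K \<cdot> (\<s> X Y \<odot> \<i> K) = sw X Y K \<cdot> \<a> X Y K"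
  by (simp add: sw_def)

text \<open>Since \<open>sw\<close> carries the rest \<open>K\<close> of a right-nested product as a
  parameter, coherence for \<open>mid\<close> is reduced to hexagon identities for
  \<open>sw\<close>.\<close>

lemma mid_sw: "mid W X Y Z = \<a>\<^sup>- W Y (X \<otimes> Z) \<cdot> (\<i> W \<odot> sw X Y Z) \<cdot> \<a> W X (Y \<otimes> Z)"
  by (simp add: middle_four_def sw_def)

lemma mid_typing [simp]:
  assumes [simp]: "ob W" "ob X" "ob Y" "ob Z"
  shows "arr (mid W X Y Z)" "dom (mid W X Y Z) = (W \<otimes> X) \<otimes> (Y \<otimes> Z)"
    "cod (mid W X Y Z) = (W \<otimes> Y) \<otimes> (X \<otimes> Z)"
    "mid W Y X Z \<cdot> mid W X Y Z = \<i> ((W \<otimes> X) \<otimes> (Y \<otimes> Z))"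
    "\<And>k. arr k \<Longrightarrow> cod k = (W \<otimes> X) \<otimes> (Y \<otimes> Z) \<Longrightarrow> mid W Y X Z \<cdot> mid W X Y Z \<cdot> k = k"
  by (simp_all add: mid_sw)

lemma sw_nat:
  assumes "arr f" "arr g" "arr h" "X = dom f" "X' = cod f" "Y = dom g" "Y' = cod g" "Z = dom h" "Z' = cod h"
  shows "sw X' Y' Z' \<cdot> (f \<odot> (g \<odot> h)) = (g \<odot> (f \<odot> h)) \<cdot> sw X Y Z"
proof -
  have "sw X' Y' Z' \<cdot> (f \<odot> (g \<odot> h)) = \<a> Y' X' Z' \<cdot> ((\<s> X' Y' \<cdot> (f \<odot> g)) \<odot> h) \<cdot> \<a>\<^sup>- X Y Z"
    using assms inv_assoc_nat[of f g h] by (simp add: sw_def)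
  also have "\<dots> = \<a> Y' X' Z' \<cdot> (((g \<odot> f) \<cdot> \<s> X Y) \<odot> h) \<cdot> \<a>\<^sup>- X Y Z"
    using assms s_nat[of f g] by simp
  also have "\<dots> = \<a> Y' X' Z' \<cdot> ((g \<odot> f) \<odot> h) \<cdot> (\<s> X Y \<odot> \<i> Z) \<cdot> \<a>\<^sup>- X Y Z"
    using assms by simp
  also have "\<dots> = (g \<odot> (f \<odot> h)) \<cdot> sw X Y Z"
    unfolding sw_def by (rule assoc_nat_tail) (use assms in auto)
  finally show ?thesis .
qed

lemma mid_nat:
  assumes "arr f" "arr g" "arr h" "arr j" "W = dom f" "W' = cod f" "X = dom g" "X' = cod g"
    "Y = dom h" "Y' = cod h" "Z = dom j" "Z' = cod j"
  shows "mid W' X' Y' Z' \<cdot> ((f \<odot> g) \<odot> (h \<odot> j)) = ((f \<odot> h) \<odot> (g \<odot> j)) \<cdot> mid W X Y Z"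
proof -
  have "mid W' X' Y' Z' \<cdot> ((f \<odot> g) \<odot> (h \<odot> j)) =
      \<a>\<^sup>- W' Y' (X' \<otimes> Z') \<cdot> (f \<odot> (sw X' Y' Z' \<cdot> (g \<odot> (h \<odot> j)))) \<cdot> \<a> W X (Y \<otimes> Z)"
    using assms assoc_nat[of f g "h \<odot> j"] by (simp add: mid_sw)
  also have "\<dots> = \<a>\<^sup>- W' Y' (X' \<otimes> Z') \<cdot> (f \<odot> ((h \<odot> (g \<odot> j)) \<cdot> sw X Y Z)) \<cdot> \<a> W X (Y \<otimes> Z)"
    using assms sw_nat[of g h j] by simp
  also have "\<dots> = \<a>\<^sup>- W' Y' (X' \<otimes> Z') \<cdot> (f \<odot> (h \<odot> (g \<odot> j))) \<cdot> (\<i> W \<odot> sw X Y Z) \<cdot> \<a> W X (Y \<otimes> Z)"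
    using assms by simp
  also have "\<dots> = ((f \<odot> h) \<odot> (g \<odot> j)) \<cdot> mid W X Y Z"
    unfolding mid_sw by (rule inv_assoc_nat_tail) (use assms in auto)
  finally show ?thesis .
qed

lemma mid_nat_tail:
  assumes "arr f" "arr g" "arr h" "arr j" "W = dom f" "W' = cod f" "X = dom g" "X' = cod g"
    "Y = dom h" "Y' = cod h" "Z = dom j" "Z' = cod j" "arr k" "cod k = (W \<otimes> X) \<otimes> (Y \<otimes> Z)"
  shows "mid W' X' Y' Z' \<cdot> ((f \<odot> g) \<odot> (h \<odot> j)) \<cdot> k =
    ((f \<odot> h) \<odot> (g \<odot> j)) \<cdot> mid W X Y Z \<cdot> k"
  using tail[OF mid_nat[of f g h j W W' X X' Y Y' Z Z'], where k=k] assms by auto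

lemma pentagon_inv:
  assumes [simp]: "ob W" "ob X" "ob Y" "ob Z"
  shows "\<a> (W \<otimes> X) Y Z \<cdot> (\<a>\<^sup>- W X Y \<odot> \<i> Z) \<cdot> \<a>\<^sup>- W (X \<otimes> Y) Z
    = \<a>\<^sup>- W X (Y \<otimes> Z) \<cdot> (\<i> W \<odot> \<a> X Y Z)"
proof (rule iso_mono[of "\<a> W X (Y \<otimes> Z)"])
  have "\<a> W X (Y \<otimes> Z) \<cdot> \<a> (W \<otimes> X) Y Z \<cdot> (\<a>\<^sup>- W X Y \<odot> \<i> Z) \<cdot> \<a>\<^sup>- W (X \<otimes> Y) Z
      = (\<a> W X (Y \<otimes> Z) \<cdot> \<a> (W \<otimes> X) Y Z) \<cdot> (\<a>\<^sup>- W X Y \<odot> \<i> Z) \<cdot> \<a>\<^sup>- W (X \<otimes> Y) Z" by simp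
  also have "\<dots> = (\<i> W \<odot> \<a> X Y Z)" unfolding pentagon_idn[OF assms] by simp
  finally show "\<a> W X (Y \<otimes> Z) \<cdot> \<a> (W \<otimes> X) Y Z \<cdot> (\<a>\<^sup>- W X Y \<odot> \<i> Z) \<cdot> \<a>\<^sup>- W (X \<otimes> Y) Z
     = \<a> W X (Y \<otimes> Z) \<cdot> \<a>\<^sup>- W X (Y \<otimes> Z) \<cdot> (\<i> W \<odot> \<a> X Y Z)" by simp
qed (rule assoc_typing(7); auto | auto)+

lemma pentagon_half:
  assumes [simp]: "ob W" "ob X" "ob Y" "ob Z"
  shows "\<a> W (X \<otimes> Y) Z \<cdot> (\<a> W X Y \<odot> \<i> Z) =
    (\<i> W \<odot> \<a>\<^sup>- X Y Z) \<cdot> \<a> W X (Y \<otimes> Z) \<cdot> \<a> (W \<otimes> X) Y Z"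
  unfolding pentagon_idn[OF assms] by simp

text \<open>The hexagon with a spectator \<open>K\<close>: \<open>X\<close> passes
  \<open>Y \<otimes> Z\<close> by passing \<open>Y\<close> and then \<open>Z\<close>. The pentagons
  carry the associators that the spectator introduces across the braidings.\<close>

lemma sw_hexagon:
  assumes [simp]: "ob X" "ob Y" "ob Z" "ob K"
  shows "\<a> Y Z (X \<otimes> K) \<cdot> sw X (Y \<otimes> Z) K = (\<i> Y \<odot> sw X Z K) \<cdot> sw X Y (Z \<otimes> K) \<cdot> (\<i> X \<odot> \<a> Y Z K)"
proof -
  let ?t = "(\<a>\<^sup>- X Y Z \<odot> \<i> K) \<cdot> \<a>\<^sup>- X (Y \<otimes> Z) K"
  have "\<a> Y Z (X \<otimes> K) \<cdot> sw X (Y \<otimes> Z) K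
      = (\<a> Y Z (X \<otimes> K) \<cdot> \<a> (Y \<otimes> Z) X K) \<cdot> (\<s> X (Y \<otimes> Z) \<odot> \<i> K) \<cdot> \<a>\<^sup>- X (Y \<otimes> Z) K"
    by (simp add: sw_def)
  also have "\<dots> = (\<i> Y \<odot> \<a> Z X K) \<cdot> \<a> Y (Z \<otimes> X) K \<cdot>
      ((\<a> Y Z X \<cdot> \<s> X (Y \<otimes> Z)) \<odot> \<i> K) \<cdot> \<a>\<^sup>- X (Y \<otimes> Z) K"
    by (subst pentagon_idn) auto
  also have "\<a> Y Z X \<cdot> \<s> X (Y \<otimes> Z) = (\<i> Y \<odot> \<s> X Z) \<cdot> \<a> Y X Z \<cdot> (\<s> X Y \<odot> \<i> Z) \<cdot> \<a>\<^sup>- X Y Z"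
    by (rule hexagon_cmp) auto
  also have "(\<i> Y \<odot> \<a> Z X K) \<cdot> \<a> Y (Z \<otimes> X) K \<cdot> (\<dots> \<odot> \<i> K) \<cdot> \<a>\<^sup>- X (Y \<otimes> Z) K =
      (\<i> Y \<odot> \<a> Z X K) \<cdot> (\<a> Y (Z \<otimes> X) K \<cdot> ((\<i> Y \<odot> \<s> X Z) \<odot> \<i> K)) \<cdot>
      (\<a> Y X Z \<odot> \<i> K) \<cdot> ((\<s> X Y \<odot> \<i> Z) \<odot> \<i> K) \<cdot> ?t" by simp
  also have "\<a> Y (Z \<otimes> X) K \<cdot> ((\<i> Y \<odot> \<s> X Z) \<odot> \<i> K) = (\<i> Y \<odot> (\<s> X Z \<odot> \<i> K)) \<cdot> \<a> Y (X \<otimes> Z) K"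
    by (rule assoc_nat) auto
  also have "(\<i> Y \<odot> \<a> Z X K) \<cdot> \<dots> \<cdot> (\<a> Y X Z \<odot> \<i> K) \<cdot> ((\<s> X Y \<odot> \<i> Z) \<odot> \<i> K) \<cdot> ?t =
      (\<i> Y \<odot> (\<a> Z X K \<cdot> (\<s> X Z \<odot> \<i> K))) \<cdot> (\<a> Y (X \<otimes> Z) K \<cdot> (\<a> Y X Z \<odot> \<i> K)) \<cdot>
      ((\<s> X Y \<odot> \<i> Z) \<odot> \<i> K) \<cdot> ?t" by simp
  also have "\<a> Y (X \<otimes> Z) K \<cdot> (\<a> Y X Z \<odot> \<i> K) = (\<i> Y \<odot> \<a>\<^sup>- X Z K) \<cdot> \<a> Y X (Z \<otimes> K) \<cdot> \<a> (Y \<otimes> X) Z K"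
    by (rule pentagon_half) auto
  also have "(\<i> Y \<odot> (\<a> Z X K \<cdot> (\<s> X Z \<odot> \<i> K))) \<cdot> \<dots> \<cdot> ((\<s> X Y \<odot> \<i> Z) \<odot> \<i> K) \<cdot> ?t =
      (\<i> Y \<odot> sw X Z K) \<cdot> \<a> Y X (Z \<otimes> K) \<cdot> (\<a> (Y \<otimes> X) Z K \<cdot> ((\<s> X Y \<odot> \<i> Z) \<odot> \<i> K)) \<cdot> ?t"
    by (simp add: sw_def)
  also have "\<a> (Y \<otimes> X) Z K \<cdot> ((\<s> X Y \<odot> \<i> Z) \<odot> \<i> K) = (\<s> X Y \<odot> (\<i> Z \<odot> \<i> K)) \<cdot> \<a> (X \<otimes> Y) Z K"
    by (rule assoc_nat) auto
  also have "(\<i> Y \<odot> sw X Z K) \<cdot> \<a> Y X (Z \<otimes> K) \<cdot> \<dots> \<cdot> ?t =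
      (\<i> Y \<odot> sw X Z K) \<cdot> \<a> Y X (Z \<otimes> K) \<cdot> (\<s> X Y \<odot> \<i> (Z \<otimes> K)) \<cdot> (\<a> (X \<otimes> Y) Z K \<cdot> ?t)" by simp
  also have "\<a> (X \<otimes> Y) Z K \<cdot> ?t = \<a>\<^sup>- X Y (Z \<otimes> K) \<cdot> (\<i> X \<odot> \<a> Y Z K)"
    by (rule pentagon_inv) auto
  finally show ?thesis by (simp add: sw_def)
qed

text \<open>This is \<open>sw_hexagon\<close> inverted, because \<open>sw X Z K\<close> and
  \<open>sw Z X K\<close> are inverse to each other.\<close>

lemma sw_hexagon':
  assumes [simp]: "ob X" "ob Y" "ob Z" "ob K"
  shows "(\<i> Z \<odot> \<a> X Y K) \<cdot> sw (X \<otimes> Y) Z K = sw X Z (Y \<otimes> K) \<cdot> (\<i> X \<odot> sw Y Z K) \<cdot> \<a> X Y (Z \<otimes> K)"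
proof -
  have "sw X Z (Y \<otimes> K) \<cdot> (\<i> X \<odot> sw Y Z K) \<cdot> \<a> X Y (Z \<otimes> K) =
      sw X Z (Y \<otimes> K) \<cdot> (\<i> X \<odot> sw Y Z K) \<cdot> (\<a> X Y (Z \<otimes> K) \<cdot> sw Z (X \<otimes> Y) K) \<cdot> sw (X \<otimes> Y) Z K" by simp
  also have "\<dots> = (\<i> Z \<odot> \<a> X Y K) \<cdot> sw (X \<otimes> Y) Z K" by (subst sw_hexagon) auto
  finally show ?thesis by simp
qed

text \<open>The spectator may absorb a further factor. It is what lets \<open>nested_mid\<close>
  turn an exchange tensored with \<open>\<i> K\<close> into one whose spectator contains
  \<open>K\<close>.\<close>

lemma sw_tensor:
  assumes [simp]: "ob X" "ob Y" "ob Z" "ob K"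
  shows "(\<i> Y \<odot> \<a> X Z K) \<cdot> \<a> Y (X \<otimes> Z) K \<cdot> (sw X Y Z \<odot> \<i> K) =
    sw X Y (Z \<otimes> K) \<cdot> (\<i> X \<odot> \<a> Y Z K) \<cdot> \<a> X (Y \<otimes> Z) K"
proof -
  let ?t = "((\<s> X Y \<odot> \<i> Z) \<odot> \<i> K) \<cdot> (\<a>\<^sup>- X Y Z \<odot> \<i> K)"
  have "(\<i> Y \<odot> \<a> X Z K) \<cdot> \<a> Y (X \<otimes> Z) K \<cdot> (sw X Y Z \<odot> \<i> K) =
     ((\<i> Y \<odot> \<a> X Z K) \<cdot> \<a> Y (X \<otimes> Z) K \<cdot> (\<a> Y X Z \<odot> \<i> K)) \<cdot> ?t" by (simp add: sw_def)
  also have "\<dots> = (\<a> Y X (Z \<otimes> K) \<cdot> \<a> (Y \<otimes> X) Z K) \<cdot> ?t" by (subst pentagon_idn) auto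
  also have "\<dots> = \<a> Y X (Z \<otimes> K) \<cdot> (\<a> (Y \<otimes> X) Z K \<cdot> ((\<s> X Y \<odot> \<i> Z) \<odot> \<i> K)) \<cdot> (\<a>\<^sup>- X Y Z \<odot> \<i> K)" by simp
  also have "\<a> (Y \<otimes> X) Z K \<cdot> ((\<s> X Y \<odot> \<i> Z) \<odot> \<i> K) = (\<s> X Y \<odot> (\<i> Z \<odot> \<i> K)) \<cdot> \<a> (X \<otimes> Y) Z K"
    by (rule assoc_nat) auto
  also have "\<a> Y X (Z \<otimes> K) \<cdot> \<dots> \<cdot> (\<a>\<^sup>- X Y Z \<odot> \<i> K) =
      \<a> Y X (Z \<otimes> K) \<cdot> (\<s> X Y \<odot> \<i> (Z \<otimes> K)) \<cdot>
        (\<a> (X \<otimes> Y) Z K \<cdot> (\<a>\<^sup>- X Y Z \<odot> \<i> K) \<cdot> \<a>\<^sup>- X (Y \<otimes> Z) K) \<cdot> \<a> X (Y \<otimes> Z) K" by simp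
  also have "\<dots> = sw X Y (Z \<otimes> K) \<cdot> (\<i> X \<odot> \<a> Y Z K) \<cdot> \<a> X (Y \<otimes> Z) K"
    by (subst pentagon_inv) (auto simp: sw_def)
  finally show ?thesis .
qed

text \<open>Four factors are put in right-nested form with an object \<open>K\<close> at the end, where a middle
  exchange and a symmetry both become instances of \<^const>\<open>sw\<close>.\<close>

definition nested :: "'o \<Rightarrow> 'o \<Rightarrow> 'o \<Rightarrow> 'o \<Rightarrow> 'o \<Rightarrow> 'm" where
  "nested W X Y Z K = \<a> W X (Y \<otimes> (Z \<otimes> K)) \<cdot> (\<i> (W \<otimes> X) \<odot> \<a> Y Z K) \<cdot> \<a> (W \<otimes> X) (Y \<otimes> Z) K"

lemma nested_typing [simp]:
  assumes [simp]: "ob W" "ob X" "ob Y" "ob Z" "ob K"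
  shows "arr (nested W X Y Z K)" "dom (nested W X Y Z K) = ((W \<otimes> X) \<otimes> (Y \<otimes> Z)) \<otimes> K"
    "cod (nested W X Y Z K) = W \<otimes> (X \<otimes> (Y \<otimes> (Z \<otimes> K)))"
  by (auto simp: nested_def)

lemma nested_alt:
  assumes [simp]: "ob W" "ob X" "ob Y" "ob Z" "ob K"
  shows "nested W X Y Z K = (\<i> W \<odot> (\<i> X \<odot> \<a> Y Z K)) \<cdot> \<a> W X ((Y \<otimes> Z) \<otimes> K) \<cdot> \<a> (W \<otimes> X) (Y \<otimes> Z) K"
proof -
  have "nested W X Y Z K = (\<a> W X (Y \<otimes> (Z \<otimes> K)) \<cdot> ((\<i> W \<odot> \<i> X) \<odot> \<a> Y Z K)) \<cdot> \<a> (W \<otimes> X) (Y \<otimes> Z) K"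
    by (simp add: nested_def)
  also have "\<dots> = ((\<i> W \<odot> (\<i> X \<odot> \<a> Y Z K)) \<cdot> \<a> W X ((Y \<otimes> Z) \<otimes> K)) \<cdot> \<a> (W \<otimes> X) (Y \<otimes> Z) K"
    by (subst assoc_nat) auto
  finally show ?thesis by simp
qed

lemma nested_mono:
  assumes "nested W X Y Z K \<cdot> f = nested W X Y Z K \<cdot> g" "ob W" "ob X" "ob Y" "ob Z" "ob K"
    "arr f" "arr g" "cod f = ((W \<otimes> X) \<otimes> (Y \<otimes> Z)) \<otimes> K" "cod g = cod f"
  shows "f = g"
  by (rule iso_mono[OF assms(1), of "\<a>\<^sup>- (W \<otimes> X) (Y \<otimes> Z) K \<cdot> (\<i> (W \<otimes> X) \<odot> \<a>\<^sup>- Y Z K) \<cdot> \<a>\<^sup>- W X (Y \<otimes> (Z \<otimes> K))"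
        "((W \<otimes> X) \<otimes> (Y \<otimes> Z)) \<otimes> K"])
    (use assms(2-) in \<open>auto simp: nested_def\<close>)

lemma nested_mid:
  assumes [simp]: "ob W" "ob X" "ob Y" "ob Z" "ob K"
  shows "nested W Y X Z K \<cdot> (mid W X Y Z \<odot> \<i> K) = (\<i> W \<odot> sw X Y (Z \<otimes> K)) \<cdot> nested W X Y Z K"
proof -
  have 1: "nested W X Y Z K =
      (\<i> W \<odot> ((\<i> X \<odot> \<a> Y Z K) \<cdot> \<a> X (Y \<otimes> Z) K)) \<cdot> \<a> W (X \<otimes> (Y \<otimes> Z)) K \<cdot> (\<a> W X (Y \<otimes> Z) \<odot> \<i> K)"
    if [simp]: "ob X" "ob Y" for X Y
    by (simp add: nested_alt pentagon_idn)
  have "nested W Y X Z K \<cdot> (mid W X Y Z \<odot> \<i> K) =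
      (\<i> W \<odot> ((\<i> Y \<odot> \<a> X Z K) \<cdot> \<a> Y (X \<otimes> Z) K)) \<cdot>
      (\<a> W (Y \<otimes> (X \<otimes> Z)) K \<cdot> ((\<i> W \<odot> sw X Y Z) \<odot> \<i> K)) \<cdot> (\<a> W X (Y \<otimes> Z) \<odot> \<i> K)"
    by (simp add: 1 mid_sw)
  also have "\<a> W (Y \<otimes> (X \<otimes> Z)) K \<cdot> ((\<i> W \<odot> sw X Y Z) \<odot> \<i> K) =
      (\<i> W \<odot> (sw X Y Z \<odot> \<i> K)) \<cdot> \<a> W (X \<otimes> (Y \<otimes> Z)) K" by (rule assoc_nat) auto
  also have "(\<i> W \<odot> ((\<i> Y \<odot> \<a> X Z K) \<cdot> \<a> Y (X \<otimes> Z) K)) \<cdot> \<dots> \<cdot> (\<a> W X (Y \<otimes> Z) \<odot> \<i> K) =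
     (\<i> W \<odot> ((\<i> Y \<odot> \<a> X Z K) \<cdot> \<a> Y (X \<otimes> Z) K \<cdot> (sw X Y Z \<odot> \<i> K))) \<cdot>
     \<a> W (X \<otimes> (Y \<otimes> Z)) K \<cdot> (\<a> W X (Y \<otimes> Z) \<odot> \<i> K)" by simp
  also have "\<dots> = (\<i> W \<odot> sw X Y (Z \<otimes> K)) \<cdot> nested W X Y Z K"
    by (subst sw_tensor) (auto simp: 1)
  finally show ?thesis .
qed

text \<open>The associativity axiom for \<open>\<otimes>\<close> as a monoidal functor.
  \<open>?N\<close> nests the six factors to the right; both sides then become \<open>?S\<close>,
  the exchanges of \<open>X\<close> with \<open>Y\<close>, of \<open>Z\<close> with \<open>T\<close>
  and of \<open>X\<close> with \<open>T\<close>.\<close>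

lemma mid_hexagon:
  assumes [simp]: "ob W" "ob X" "ob Y" "ob Z" "ob T" "ob U"
  shows "(\<a> W Y T \<odot> \<a> X Z U) \<cdot> mid (W \<otimes> Y) (X \<otimes> Z) T U \<cdot> (mid W X Y Z \<odot> \<i> (T \<otimes> U)) =
    mid W X (Y \<otimes> T) (Z \<otimes> U) \<cdot> (\<i> (W \<otimes> X) \<odot> mid Y Z T U) \<cdot> \<a> (W \<otimes> X) (Y \<otimes> Z) (T \<otimes> U)" (is "?L = ?R")
proof (rule iso_mono)
  let ?N = "(\<i> W \<odot> \<a> Y T (X \<otimes> (Z \<otimes> U))) \<cdot> \<a> W (Y \<otimes> T) (X \<otimes> (Z \<otimes> U))"
  let ?n = "\<a> W Y (T \<otimes> (X \<otimes> (Z \<otimes> U)))"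
  let ?S = "(\<i> W \<odot> ((\<i> Y \<odot> (sw X T (Z \<otimes> U) \<cdot> (\<i> X \<odot> sw Z T U))) \<cdot> sw X Y (Z \<otimes> (T \<otimes> U)))) \<cdot> nested W X Y Z (T \<otimes> U)"
  show "?N \<cdot> ?L = ?N \<cdot> ?R"
  proof -
    have "?N \<cdot> ?L = ((\<i> W \<odot> \<a> Y T (X \<otimes> (Z \<otimes> U))) \<cdot> \<a> W (Y \<otimes> T) (X \<otimes> (Z \<otimes> U)) \<cdot> (\<a> W Y T \<odot> \<i> (X \<otimes> (Z \<otimes> U)))) \<cdot>
       (\<i> ((W \<otimes> Y) \<otimes> T) \<odot> \<a> X Z U) \<cdot> mid (W \<otimes> Y) (X \<otimes> Z) T U \<cdot> (mid W X Y Z \<odot> \<i> (T \<otimes> U))" by simp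
    also have "\<dots> = ?n \<cdot> (\<a> (W \<otimes> Y) T (X \<otimes> (Z \<otimes> U)) \<cdot> ((\<i> (W \<otimes> Y) \<odot> \<i> T) \<odot> \<a> X Z U)) \<cdot>
         mid (W \<otimes> Y) (X \<otimes> Z) T U \<cdot> (mid W X Y Z \<odot> \<i> (T \<otimes> U))"
      by (subst pentagon_idn[symmetric]) auto
    also have "\<a> (W \<otimes> Y) T (X \<otimes> (Z \<otimes> U)) \<cdot> ((\<i> (W \<otimes> Y) \<odot> \<i> T) \<odot> \<a> X Z U) =
        (\<i> (W \<otimes> Y) \<odot> (\<i> T \<odot> \<a> X Z U)) \<cdot> \<a> (W \<otimes> Y) T ((X \<otimes> Z) \<otimes> U)" by (rule assoc_nat) auto
    also have "?n \<cdot> \<dots> \<cdot> mid (W \<otimes> Y) (X \<otimes> Z) T U \<cdot> (mid W X Y Z \<odot> \<i> (T \<otimes> U)) =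
        ?n \<cdot> (\<i> (W \<otimes> Y) \<odot> ((\<i> T \<odot> \<a> X Z U) \<cdot> sw (X \<otimes> Z) T U)) \<cdot> \<a> (W \<otimes> Y) (X \<otimes> Z) (T \<otimes> U) \<cdot> (mid W X Y Z \<odot> \<i> (T \<otimes> U))"
      by (simp add: mid_sw[of "W \<otimes> Y"])
    also have "(\<i> T \<odot> \<a> X Z U) \<cdot> sw (X \<otimes> Z) T U = sw X T (Z \<otimes> U) \<cdot> (\<i> X \<odot> sw Z T U) \<cdot> \<a> X Z (T \<otimes> U)"
      by (rule sw_hexagon') auto
    also have "?n \<cdot> (\<i> (W \<otimes> Y) \<odot> \<dots>) \<cdot> \<a> (W \<otimes> Y) (X \<otimes> Z) (T \<otimes> U) \<cdot> (mid W X Y Z \<odot> \<i> (T \<otimes> U)) =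
        (?n \<cdot> ((\<i> W \<odot> \<i> Y) \<odot> (sw X T (Z \<otimes> U) \<cdot> (\<i> X \<odot> sw Z T U)))) \<cdot>
        (\<i> (W \<otimes> Y) \<odot> \<a> X Z (T \<otimes> U)) \<cdot> \<a> (W \<otimes> Y) (X \<otimes> Z) (T \<otimes> U) \<cdot> (mid W X Y Z \<odot> \<i> (T \<otimes> U))" by simp
    also have "\<dots> = ((\<i> W \<odot> (\<i> Y \<odot> (sw X T (Z \<otimes> U) \<cdot> (\<i> X \<odot> sw Z T U)))) \<cdot> \<a> W Y (X \<otimes> (Z \<otimes> (T \<otimes> U)))) \<cdot>
        (\<i> (W \<otimes> Y) \<odot> \<a> X Z (T \<otimes> U)) \<cdot> \<a> (W \<otimes> Y) (X \<otimes> Z) (T \<otimes> U) \<cdot> (mid W X Y Z \<odot> \<i> (T \<otimes> U))"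
      by (subst assoc_nat) auto
    also have "\<dots> = (\<i> W \<odot> (\<i> Y \<odot> (sw X T (Z \<otimes> U) \<cdot> (\<i> X \<odot> sw Z T U)))) \<cdot>
        (nested W Y X Z (T \<otimes> U) \<cdot> (mid W X Y Z \<odot> \<i> (T \<otimes> U)))" by (simp add: nested_def)
    also have "\<dots> = ?S" by (subst nested_mid) auto
    finally have L: "?N \<cdot> ?L = ?S" .
    have "?N \<cdot> ?R = (\<i> W \<odot> (\<a> Y T (X \<otimes> (Z \<otimes> U)) \<cdot> sw X (Y \<otimes> T) (Z \<otimes> U))) \<cdot>
        (\<a> W X ((Y \<otimes> T) \<otimes> (Z \<otimes> U)) \<cdot> ((\<i> W \<odot> \<i> X) \<odot> mid Y Z T U)) \<cdot> \<a> (W \<otimes> X) (Y \<otimes> Z) (T \<otimes> U)"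
      by (simp add: mid_sw[of W])
    also have "\<a> Y T (X \<otimes> (Z \<otimes> U)) \<cdot> sw X (Y \<otimes> T) (Z \<otimes> U) =
        (\<i> Y \<odot> sw X T (Z \<otimes> U)) \<cdot> sw X Y (T \<otimes> (Z \<otimes> U)) \<cdot> (\<i> X \<odot> \<a> Y T (Z \<otimes> U))" by (rule sw_hexagon) auto
    also have "\<a> W X ((Y \<otimes> T) \<otimes> (Z \<otimes> U)) \<cdot> ((\<i> W \<odot> \<i> X) \<odot> mid Y Z T U) =
        (\<i> W \<odot> (\<i> X \<odot> mid Y Z T U)) \<cdot> \<a> W X ((Y \<otimes> Z) \<otimes> (T \<otimes> U))" by (rule assoc_nat) auto
    also have "(\<i> W \<odot> ((\<i> Y \<odot> sw X T (Z \<otimes> U)) \<cdot> sw X Y (T \<otimes> (Z \<otimes> U)) \<cdot> (\<i> X \<odot> \<a> Y T (Z \<otimes> U)))) \<cdot>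
        \<dots> \<cdot> \<a> (W \<otimes> X) (Y \<otimes> Z) (T \<otimes> U) =
      (\<i> W \<odot> ((\<i> Y \<odot> sw X T (Z \<otimes> U)) \<cdot> (sw X Y (T \<otimes> (Z \<otimes> U)) \<cdot> (\<i> X \<odot> (\<i> Y \<odot> sw Z T U))))) \<cdot>
       (\<i> W \<odot> (\<i> X \<odot> \<a> Y Z (T \<otimes> U))) \<cdot> \<a> W X ((Y \<otimes> Z) \<otimes> (T \<otimes> U)) \<cdot> \<a> (W \<otimes> X) (Y \<otimes> Z) (T \<otimes> U)"
      by (simp add: mid_sw)
    also have "sw X Y (T \<otimes> (Z \<otimes> U)) \<cdot> (\<i> X \<odot> (\<i> Y \<odot> sw Z T U)) = (\<i> Y \<odot> (\<i> X \<odot> sw Z T U)) \<cdot> sw X Y (Z \<otimes> (T \<otimes> U))"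
      by (rule sw_nat) auto
    also have "(\<i> W \<odot> ((\<i> Y \<odot> sw X T (Z \<otimes> U)) \<cdot> \<dots>)) \<cdot>
       (\<i> W \<odot> (\<i> X \<odot> \<a> Y Z (T \<otimes> U))) \<cdot> \<a> W X ((Y \<otimes> Z) \<otimes> (T \<otimes> U)) \<cdot> \<a> (W \<otimes> X) (Y \<otimes> Z) (T \<otimes> U) = ?S"
      by (simp add: nested_alt)
    finally show ?thesis using L by simp
  qed
  show "(\<a>\<^sup>- W (Y \<otimes> T) (X \<otimes> (Z \<otimes> U)) \<cdot> (\<i> W \<odot> \<a>\<^sup>- Y T (X \<otimes> (Z \<otimes> U)))) \<cdot> ?N = \<i> ((W \<otimes> (Y \<otimes> T)) \<otimes> (X \<otimes> (Z \<otimes> U)))"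
    by simp
qed auto

text \<open>Compatibility of \<open>\<otimes>\<close> with the symmetry, used whenever commutativity
  of \<open>B\<close> reverses a product of two pairings. A unit factor is added to serve as the
  spectator of \<open>nested\<close>. On the left, the exchange of \<open>Y\<close> with
  \<open>X\<close> cancels the one inside \<open>mid\<close>; what is left on both sides is
  \<open>?S\<close>.\<close>

lemma symm_mid:
  assumes [simp]: "ob W" "ob X" "ob Y" "ob Z"
  shows "\<s> (W \<otimes> Y) (X \<otimes> Z) \<cdot> mid W X Y Z = mid X W Z Y \<cdot> (\<s> W X \<odot> \<s> Y Z)"
proof (rule tensor_unit_faithful, rule nested_mono[of X Z W Y \<I>])
  let ?K = \<I>
  have "nested X Z W Y ?K \<cdot> (\<s> (W \<otimes> Y) (X \<otimes> Z) \<odot> \<i> ?K) =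
      \<a> X Z (W \<otimes> (Y \<otimes> ?K)) \<cdot> (\<i> (X \<otimes> Z) \<odot> \<a> W Y ?K) \<cdot> (\<a> (X \<otimes> Z) (W \<otimes> Y) ?K \<cdot> (\<s> (W \<otimes> Y) (X \<otimes> Z) \<odot> \<i> ?K))"
    by (simp add: nested_def)
  also have "\<dots> = \<a> X Z (W \<otimes> (Y \<otimes> ?K)) \<cdot> ((\<i> (X \<otimes> Z) \<odot> \<a> W Y ?K) \<cdot> sw (W \<otimes> Y) (X \<otimes> Z) ?K) \<cdot> \<a> (W \<otimes> Y) (X \<otimes> Z) ?K"
    by (subst sw_assoc) auto
  also have "(\<i> (X \<otimes> Z) \<odot> \<a> W Y ?K) \<cdot> sw (W \<otimes> Y) (X \<otimes> Z) ?K =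
      sw W (X \<otimes> Z) (Y \<otimes> ?K) \<cdot> (\<i> W \<odot> sw Y (X \<otimes> Z) ?K) \<cdot> \<a> W Y ((X \<otimes> Z) \<otimes> ?K)" by (rule sw_hexagon') auto
  also have "\<a> X Z (W \<otimes> (Y \<otimes> ?K)) \<cdot> \<dots> \<cdot> \<a> (W \<otimes> Y) (X \<otimes> Z) ?K =
      (\<a> X Z (W \<otimes> (Y \<otimes> ?K)) \<cdot> sw W (X \<otimes> Z) (Y \<otimes> ?K)) \<cdot> (\<i> W \<odot> sw Y (X \<otimes> Z) ?K) \<cdot> \<a> W Y ((X \<otimes> Z) \<otimes> ?K) \<cdot> \<a> (W \<otimes> Y) (X \<otimes> Z) ?K"
    by simp
  also have "\<a> X Z (W \<otimes> (Y \<otimes> ?K)) \<cdot> sw W (X \<otimes> Z) (Y \<otimes> ?K) =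
      (\<i> X \<odot> sw W Z (Y \<otimes> ?K)) \<cdot> sw W X (Z \<otimes> (Y \<otimes> ?K)) \<cdot> (\<i> W \<odot> \<a> X Z (Y \<otimes> ?K))" by (rule sw_hexagon) auto
  also have "\<dots> \<cdot> (\<i> W \<odot> sw Y (X \<otimes> Z) ?K) \<cdot> \<a> W Y ((X \<otimes> Z) \<otimes> ?K) \<cdot> \<a> (W \<otimes> Y) (X \<otimes> Z) ?K =
      (\<i> X \<odot> sw W Z (Y \<otimes> ?K)) \<cdot> sw W X (Z \<otimes> (Y \<otimes> ?K)) \<cdot> (\<i> W \<odot> (\<a> X Z (Y \<otimes> ?K) \<cdot> sw Y (X \<otimes> Z) ?K)) \<cdot>
      \<a> W Y ((X \<otimes> Z) \<otimes> ?K) \<cdot> \<a> (W \<otimes> Y) (X \<otimes> Z) ?K" by simp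
  also have "\<a> X Z (Y \<otimes> ?K) \<cdot> sw Y (X \<otimes> Z) ?K = (\<i> X \<odot> sw Y Z ?K) \<cdot> sw Y X (Z \<otimes> ?K) \<cdot> (\<i> Y \<odot> \<a> X Z ?K)"
    by (rule sw_hexagon) auto
  finally have 1: "nested X Z W Y ?K \<cdot> (\<s> (W \<otimes> Y) (X \<otimes> Z) \<odot> \<i> ?K) =
      (\<i> X \<odot> sw W Z (Y \<otimes> ?K)) \<cdot> sw W X (Z \<otimes> (Y \<otimes> ?K)) \<cdot>
      (\<i> W \<odot> ((\<i> X \<odot> sw Y Z ?K) \<cdot> sw Y X (Z \<otimes> ?K))) \<cdot> nested W Y X Z ?K" by (simp add: nested_alt)
  let ?S = "(\<i> X \<odot> sw W Z (Y \<otimes> ?K)) \<cdot> sw W X (Z \<otimes> (Y \<otimes> ?K)) \<cdot> (\<i> W \<odot> (\<i> X \<odot> sw Y Z ?K)) \<cdot> nested W X Y Z ?K"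
  have "nested X Z W Y ?K \<cdot> ((\<s> (W \<otimes> Y) (X \<otimes> Z) \<cdot> mid W X Y Z) \<odot> \<i> ?K) =
      (nested X Z W Y ?K \<cdot> (\<s> (W \<otimes> Y) (X \<otimes> Z) \<odot> \<i> ?K)) \<cdot> (mid W X Y Z \<odot> \<i> ?K)" by simp
  also have "\<dots> = (\<i> X \<odot> sw W Z (Y \<otimes> ?K)) \<cdot> sw W X (Z \<otimes> (Y \<otimes> ?K)) \<cdot>
      (\<i> W \<odot> ((\<i> X \<odot> sw Y Z ?K) \<cdot> sw Y X (Z \<otimes> ?K))) \<cdot> (nested W Y X Z ?K \<cdot> (mid W X Y Z \<odot> \<i> ?K))"
    unfolding 1 by simp
  also have "\<dots> = ?S" by (subst nested_mid) auto
  finally have L: "nested X Z W Y ?K \<cdot> ((\<s> (W \<otimes> Y) (X \<otimes> Z) \<cdot> mid W X Y Z) \<odot> \<i> ?K) = ?S" .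
  have "nested X W Z Y ?K \<cdot> ((\<s> W X \<odot> \<s> Y Z) \<odot> \<i> ?K) =
      \<a> X W (Z \<otimes> (Y \<otimes> ?K)) \<cdot> (\<i> (X \<otimes> W) \<odot> \<a> Z Y ?K) \<cdot> (\<a> (X \<otimes> W) (Z \<otimes> Y) ?K \<cdot> ((\<s> W X \<odot> \<s> Y Z) \<odot> \<i> ?K))"
    by (simp add: nested_def)
  also have "\<a> (X \<otimes> W) (Z \<otimes> Y) ?K \<cdot> ((\<s> W X \<odot> \<s> Y Z) \<odot> \<i> ?K) =
      (\<s> W X \<odot> (\<s> Y Z \<odot> \<i> ?K)) \<cdot> \<a> (W \<otimes> X) (Y \<otimes> Z) ?K" by (rule assoc_nat) auto
  also have "\<a> X W (Z \<otimes> (Y \<otimes> ?K)) \<cdot> (\<i> (X \<otimes> W) \<odot> \<a> Z Y ?K) \<cdot> \<dots> =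
      \<a> X W (Z \<otimes> (Y \<otimes> ?K)) \<cdot> (\<s> W X \<odot> (\<a> Z Y ?K \<cdot> (\<s> Y Z \<odot> \<i> ?K))) \<cdot> \<a> (W \<otimes> X) (Y \<otimes> Z) ?K" by simp
  also have "\<a> Z Y ?K \<cdot> (\<s> Y Z \<odot> \<i> ?K) = sw Y Z ?K \<cdot> \<a> Y Z ?K" by (rule sw_assoc) auto
  also have "\<a> X W (Z \<otimes> (Y \<otimes> ?K)) \<cdot> (\<s> W X \<odot> \<dots>) \<cdot> \<a> (W \<otimes> X) (Y \<otimes> Z) ?K =
      (\<a> X W (Z \<otimes> (Y \<otimes> ?K)) \<cdot> (\<s> W X \<odot> \<i> (Z \<otimes> (Y \<otimes> ?K)))) \<cdot> ((\<i> W \<odot> \<i> X) \<odot> sw Y Z ?K) \<cdot>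
      (\<i> (W \<otimes> X) \<odot> \<a> Y Z ?K) \<cdot> \<a> (W \<otimes> X) (Y \<otimes> Z) ?K" by simp
  also have "\<dots> = sw W X (Z \<otimes> (Y \<otimes> ?K)) \<cdot> (\<a> W X (Z \<otimes> (Y \<otimes> ?K)) \<cdot> ((\<i> W \<odot> \<i> X) \<odot> sw Y Z ?K)) \<cdot>
      (\<i> (W \<otimes> X) \<odot> \<a> Y Z ?K) \<cdot> \<a> (W \<otimes> X) (Y \<otimes> Z) ?K" by (subst sw_assoc) auto
  also have "\<a> W X (Z \<otimes> (Y \<otimes> ?K)) \<cdot> ((\<i> W \<odot> \<i> X) \<odot> sw Y Z ?K) =
      (\<i> W \<odot> (\<i> X \<odot> sw Y Z ?K)) \<cdot> \<a> W X (Y \<otimes> (Z \<otimes> ?K))" by (rule assoc_nat) auto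
  finally have 2: "nested X W Z Y ?K \<cdot> ((\<s> W X \<odot> \<s> Y Z) \<odot> \<i> ?K) =
      sw W X (Z \<otimes> (Y \<otimes> ?K)) \<cdot> (\<i> W \<odot> (\<i> X \<odot> sw Y Z ?K)) \<cdot> nested W X Y Z ?K" by (simp add: nested_def)
  have "nested X Z W Y ?K \<cdot> ((mid X W Z Y \<cdot> (\<s> W X \<odot> \<s> Y Z)) \<odot> \<i> ?K) =
      (nested X Z W Y ?K \<cdot> (mid X W Z Y \<odot> \<i> ?K)) \<cdot> ((\<s> W X \<odot> \<s> Y Z) \<odot> \<i> ?K)" by simp
  also have "\<dots> = (\<i> X \<odot> sw W Z (Y \<otimes> ?K)) \<cdot> (nested X W Z Y ?K \<cdot> ((\<s> W X \<odot> \<s> Y Z) \<odot> \<i> ?K))"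
    by (subst nested_mid) auto
  also have "\<dots> = ?S" unfolding 2 by simp
  finally have R: "nested X Z W Y ?K \<cdot> ((mid X W Z Y \<cdot> (\<s> W X \<odot> \<s> Y Z)) \<odot> \<i> ?K) = ?S" .
  show "nested X Z W Y ?K \<cdot> ((\<s> (W \<otimes> Y) (X \<otimes> Z) \<cdot> mid W X Y Z) \<odot> \<i> ?K) =
     nested X Z W Y ?K \<cdot> ((mid X W Z Y \<cdot> (\<s> W X \<odot> \<s> Y Z)) \<odot> \<i> ?K)" using L R by simp
qed auto

section \<open>The middle exchange with unit factors\<close>

lemma right_unitor_inv_assoc:
  assumes [simp]: "arr g" "ob W" "dom g = X"
  shows "(\<r> W \<odot> g) \<cdot> \<a>\<^sup>- W \<I> X = \<i> W \<odot> (g \<cdot> \<l> X)"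
proof -
  have [simp]: "ob X" using assms(1,3) ob_dom by blast
  have "(\<r> W \<odot> g) \<cdot> \<a>\<^sup>- W \<I> X = (\<i> W \<odot> g) \<cdot> (\<r> W \<odot> \<i> X) \<cdot> \<a>\<^sup>- W \<I> X" by simp
  also have "\<dots> = \<i> W \<odot> (g \<cdot> \<l> X)" by (simp flip: triangle)
  finally show ?thesis .
qed

lemma left_unitor_inv_assoc:
  assumes [simp]: "arr g" "ob W" "dom g = X"
  shows "(\<l> W \<odot> g) \<cdot> \<a>\<^sup>- \<I> W X = (\<i> W \<odot> g) \<cdot> \<l> (W \<otimes> X)"
proof -
  have [simp]: "ob X" using assms(1,3) ob_dom by blast
  have "(\<l> W \<odot> g) \<cdot> \<a>\<^sup>- \<I> W X = (\<i> W \<odot> g) \<cdot> (\<l> W \<odot> \<i> X) \<cdot> \<a>\<^sup>- \<I> W X" by simp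
  also have "\<dots> = (\<i> W \<odot> g) \<cdot> \<l> (W \<otimes> X)" by (simp flip: triangle_left)
  finally show ?thesis .
qed

lemma mid_unit_right:
  assumes [simp]: "ob W" "ob X"
  shows "(\<r> W \<odot> \<r> X) \<cdot> mid W X \<I> \<I> = \<r> (W \<otimes> X) \<cdot> (\<i> (W \<otimes> X) \<odot> \<l> \<I>)"
proof -
  have sw: "\<l> (X \<otimes> \<I>) \<cdot> sw X \<I> \<I> = \<i> X \<odot> \<l> \<I>"
  proof -
    have "\<l> (X \<otimes> \<I>) \<cdot> sw X \<I> \<I> = (\<l> (X \<otimes> \<I>) \<cdot> \<a> \<I> X \<I>) \<cdot> (\<s> X \<I> \<odot> \<i> \<I>) \<cdot> \<a>\<^sup>- X \<I> \<I>" by (simp add: sw_def)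
    also have "\<dots> = (\<r> X \<odot> \<i> \<I>) \<cdot> \<a>\<^sup>- X \<I> \<I>"
      unfolding triangle_left[OF assms(2) unit_in] by (simp add: left_unitor_symm)
    also have "\<dots> = \<i> X \<odot> \<l> \<I>" by (simp add: right_unitor_inv_assoc)
    finally show ?thesis .
  qed
  have "(\<r> W \<odot> \<r> X) \<cdot> mid W X \<I> \<I> =
      ((\<r> W \<odot> \<r> X) \<cdot> \<a>\<^sup>- W \<I> (X \<otimes> \<I>)) \<cdot> (\<i> W \<odot> sw X \<I> \<I>) \<cdot> \<a> W X (\<I> \<otimes> \<I>)"
    by (simp add: mid_sw)
  also have "\<dots> = (\<i> W \<odot> (\<r> X \<cdot> \<l> (X \<otimes> \<I>) \<cdot> sw X \<I> \<I>)) \<cdot> \<a> W X (\<I> \<otimes> \<I>)"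
    by (subst right_unitor_inv_assoc) auto
  also have "\<dots> = (\<i> W \<odot> \<r> X) \<cdot> (\<i> W \<odot> (\<i> X \<odot> \<l> \<I>)) \<cdot> \<a> W X (\<I> \<otimes> \<I>)" by (simp add: sw)
  also have "(\<i> W \<odot> (\<i> X \<odot> \<l> \<I>)) \<cdot> \<a> W X (\<I> \<otimes> \<I>) = \<a> W X \<I> \<cdot> ((\<i> W \<odot> \<i> X) \<odot> \<l> \<I>)"
    by (rule assoc_nat[symmetric]) auto
  also have "(\<i> W \<odot> \<r> X) \<cdot> \<dots> = ((\<i> W \<odot> \<r> X) \<cdot> \<a> W X \<I>) \<cdot> (\<i> (W \<otimes> X) \<odot> \<l> \<I>)" by simp
  finally show ?thesis by (simp only: triangle_right assms)
qed

lemma mid_unit_left: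
  assumes [simp]: "ob Y" "ob Z"
  shows "(\<l> Y \<odot> \<l> Z) \<cdot> mid \<I> \<I> Y Z = \<l> (Y \<otimes> Z) \<cdot> (\<l> \<I> \<odot> \<i> (Y \<otimes> Z))"
proof -
  have sw: "(\<i> Y \<odot> \<l> Z) \<cdot> sw \<I> Y Z = \<l> (Y \<otimes> Z)"
  proof -
    have "(\<i> Y \<odot> \<l> Z) \<cdot> sw \<I> Y Z = ((\<i> Y \<odot> \<l> Z) \<cdot> \<a> Y \<I> Z) \<cdot> (\<s> \<I> Y \<odot> \<i> Z) \<cdot> \<a>\<^sup>- \<I> Y Z" by (simp add: sw_def)
    also have "\<dots> = (\<l> Y \<odot> \<i> Z) \<cdot> \<a>\<^sup>- \<I> Y Z"
      unfolding triangle[OF assms] by (simp add: right_unitor_symm)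
    also have "\<dots> = \<l> (Y \<otimes> Z)" by (simp add: left_unitor_inv_assoc)
    finally show ?thesis .
  qed
  have "(\<l> Y \<odot> \<l> Z) \<cdot> mid \<I> \<I> Y Z =
      ((\<l> Y \<odot> \<l> Z) \<cdot> \<a>\<^sup>- \<I> Y (\<I> \<otimes> Z)) \<cdot> (\<i> \<I> \<odot> sw \<I> Y Z) \<cdot> \<a> \<I> \<I> (Y \<otimes> Z)"
    by (simp add: mid_sw)
  also have "\<dots> = (\<i> Y \<odot> \<l> Z) \<cdot> (\<l> (Y \<otimes> (\<I> \<otimes> Z)) \<cdot> (\<i> \<I> \<odot> sw \<I> Y Z)) \<cdot> \<a> \<I> \<I> (Y \<otimes> Z)"
    by (subst left_unitor_inv_assoc) auto
  also have "\<l> (Y \<otimes> (\<I> \<otimes> Z)) \<cdot> (\<i> \<I> \<odot> sw \<I> Y Z) = sw \<I> Y Z \<cdot> \<l> (\<I> \<otimes> (Y \<otimes> Z))"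
    by (rule left_nat) auto
  also have "(\<i> Y \<odot> \<l> Z) \<cdot> \<dots> \<cdot> \<a> \<I> \<I> (Y \<otimes> Z) =
      ((\<i> Y \<odot> \<l> Z) \<cdot> sw \<I> Y Z) \<cdot> (\<l> (\<I> \<otimes> (Y \<otimes> Z)) \<cdot> \<a> \<I> \<I> (Y \<otimes> Z))" by simp
  finally show ?thesis by (simp only: sw triangle_left assms unit_in tensor_ob_in)
qed

lemma mid_unit_inner:
  "ob C \<Longrightarrow> ob D \<Longrightarrow> mid C \<I> \<I> D = \<i> ((C \<otimes> \<I>) \<otimes> (\<I> \<otimes> D))"
  by (simp add: mid_sw sw_def symm_unit_unit)

text \<open>With units outside, only the braiding of the inner factors remains. This is the source
  of the symmetry in the second half of \<open>proj_comult\<close>.\<close>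

lemma mid_unit_outer:
  assumes [simp]: "ob C" "ob D"
  shows "(\<l> D \<odot> \<r> C) \<cdot> mid \<I> C D \<I> = \<s> C D \<cdot> (\<l> C \<odot> \<r> D)"
proof -
  have sw: "(\<i> D \<odot> \<r> C) \<cdot> sw C D \<I> = \<s> C D \<cdot> (\<i> C \<odot> \<r> D)"
  proof -
    have "(\<i> D \<odot> \<r> C) \<cdot> sw C D \<I> = ((\<i> D \<odot> \<r> C) \<cdot> \<a> D C \<I>) \<cdot> (\<s> C D \<odot> \<i> \<I>) \<cdot> \<a>\<^sup>- C D \<I>" by (simp add: sw_def)
    also have "\<dots> = (\<r> (D \<otimes> C) \<cdot> (\<s> C D \<odot> \<i> \<I>)) \<cdot> \<a>\<^sup>- C D \<I>"
      unfolding triangle_right[OF assms(2,1)] by simp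
    also have "\<dots> = (\<s> C D \<cdot> \<r> (C \<otimes> D)) \<cdot> \<a>\<^sup>- C D \<I>" by (subst right_nat) auto
    also have "\<dots> = \<s> C D \<cdot> (\<i> C \<odot> \<r> D)" by (simp flip: triangle_right)
    finally show ?thesis .
  qed
  have "(\<l> D \<odot> \<r> C) \<cdot> mid \<I> C D \<I> =
      ((\<l> D \<odot> \<r> C) \<cdot> \<a>\<^sup>- \<I> D (C \<otimes> \<I>)) \<cdot> (\<i> \<I> \<odot> sw C D \<I>) \<cdot> \<a> \<I> C (D \<otimes> \<I>)"
    by (simp add: mid_sw)
  also have "\<dots> = (\<i> D \<odot> \<r> C) \<cdot> (\<l> (D \<otimes> (C \<otimes> \<I>)) \<cdot> (\<i> \<I> \<odot> sw C D \<I>)) \<cdot> \<a> \<I> C (D \<otimes> \<I>)"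
    by (subst left_unitor_inv_assoc) auto
  also have "\<l> (D \<otimes> (C \<otimes> \<I>)) \<cdot> (\<i> \<I> \<odot> sw C D \<I>) = sw C D \<I> \<cdot> \<l> (C \<otimes> (D \<otimes> \<I>))"
    by (rule left_nat) auto
  also have "(\<i> D \<odot> \<r> C) \<cdot> \<dots> \<cdot> \<a> \<I> C (D \<otimes> \<I>) =
      ((\<i> D \<odot> \<r> C) \<cdot> sw C D \<I>) \<cdot> (\<l> (C \<otimes> (D \<otimes> \<I>)) \<cdot> \<a> \<I> C (D \<otimes> \<I>))" by simp
  also have "\<dots> = (\<s> C D \<cdot> (\<i> C \<odot> \<r> D)) \<cdot> (\<l> C \<odot> \<i> (D \<otimes> \<I>))"
    by (simp only: sw triangle_left assms unit_in tensor_ob_in)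
  finally show ?thesis by simp
qed

section \<open>Reversal of three factors and inverse coherence forms\<close>

lemma hexagon_inv:
  assumes [simp]: "ob X" "ob Y" "ob Z"
  shows "\<s> (X \<otimes> Y) Z \<cdot> \<a>\<^sup>- X Y Z = sw X Z Y \<cdot> (\<i> X \<odot> \<s> Y Z)"
proof -
  have h: "\<a> X Y Z \<cdot> \<s> Z (X \<otimes> Y) = (\<i> X \<odot> \<s> Z Y) \<cdot> sw Z X Y"
    unfolding sw_def by (rule hexagon_cmp) auto
  have "sw X Z Y \<cdot> (\<i> X \<odot> \<s> Y Z) =
      sw X Z Y \<cdot> (\<i> X \<odot> \<s> Y Z) \<cdot> (\<a> X Y Z \<cdot> \<s> Z (X \<otimes> Y)) \<cdot> \<s> (X \<otimes> Y) Z \<cdot> \<a>\<^sup>- X Y Z" by simp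
  also have "\<dots> = \<s> (X \<otimes> Y) Z \<cdot> \<a>\<^sup>- X Y Z" unfolding h by simp
  finally show ?thesis by simp
qed

text \<open>Naturality of the symmetry at \<open>\<s> Y Z\<close>, followed by two hexagons, relates
  the two ways of reversing three factors. Coassociativity of a co-opposite comonoid rests on
  it.\<close>

lemma yang_baxter:
  assumes [simp]: "ob X" "ob Y" "ob Z"
  shows "\<a> Z Y X \<cdot> (\<s> Y Z \<odot> \<i> X) \<cdot> \<s> X (Y \<otimes> Z) \<cdot> \<a> X Y Z = (\<i> Z \<odot> \<s> X Y) \<cdot> \<s> (X \<otimes> Y) Z"
proof -
  have "\<a> Z Y X \<cdot> (\<s> Y Z \<odot> \<i> X) \<cdot> \<s> X (Y \<otimes> Z) \<cdot> \<a> X Y Z =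
      \<a> Z Y X \<cdot> (\<s> X (Z \<otimes> Y) \<cdot> (\<i> X \<odot> \<s> Y Z)) \<cdot> \<a> X Y Z"
    by (subst s_nat[of "\<i> X" "\<s> Y Z"]) auto
  also have "\<dots> = (\<a> Z Y X \<cdot> \<s> X (Z \<otimes> Y)) \<cdot> (\<i> X \<odot> \<s> Y Z) \<cdot> \<a> X Y Z" by simp
  also have "\<a> Z Y X \<cdot> \<s> X (Z \<otimes> Y) = (\<i> Z \<odot> \<s> X Y) \<cdot> sw X Z Y"
    unfolding sw_def by (rule hexagon_cmp) auto
  also have "\<dots> \<cdot> (\<i> X \<odot> \<s> Y Z) \<cdot> \<a> X Y Z = (\<i> Z \<odot> \<s> X Y) \<cdot> (sw X Z Y \<cdot> (\<i> X \<odot> \<s> Y Z)) \<cdot> \<a> X Y Z" by simp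
  also have "\<dots> = (\<i> Z \<odot> \<s> X Y) \<cdot> \<s> (X \<otimes> Y) Z" by (simp flip: hexagon_inv)
  finally show ?thesis .
qed

lemma mid_hexagon_inv:
  assumes [simp]: "ob W" "ob X" "ob Y" "ob Z" "ob T" "ob U"
  shows "\<a> (W \<otimes> X) (Y \<otimes> Z) (T \<otimes> U) \<cdot> (mid W Y X Z \<odot> \<i> (T \<otimes> U)) \<cdot> mid (W \<otimes> Y) T (X \<otimes> Z) U =
    (\<i> (W \<otimes> X) \<odot> mid Y T Z U) \<cdot> mid W (Y \<otimes> T) X (Z \<otimes> U) \<cdot> (\<a> W Y T \<odot> \<a> X Z U)" (is "?L = ?R")
proof -
  let ?M = "(mid W Y X Z \<odot> \<i> (T \<otimes> U)) \<cdot> mid (W \<otimes> Y) T (X \<otimes> Z) U"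
  have "?R = (\<i> (W \<otimes> X) \<odot> mid Y T Z U) \<cdot> mid W (Y \<otimes> T) X (Z \<otimes> U) \<cdot>
      ((\<a> W Y T \<odot> \<a> X Z U) \<cdot> mid (W \<otimes> Y) (X \<otimes> Z) T U \<cdot> (mid W X Y Z \<odot> \<i> (T \<otimes> U))) \<cdot> ?M" by simp
  also have "\<dots> = ?L" unfolding mid_hexagon[OF assms] by simp
  finally show ?thesis by simp
qed

subsection \<open>Comonoids\<close>

abbreviation tcomult :: "'o \<Rightarrow> 'm \<Rightarrow> 'o \<Rightarrow> 'm \<Rightarrow> 'm" where "tcomult \<equiv> tensor_comult V"
abbreviation tcounit :: "'m \<Rightarrow> 'm \<Rightarrow> 'm" where "tcounit \<equiv> tensor_counit V"
text \<open>The official \<open>cop\<close> uses the inverse of the symmetry, which is again the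
  symmetry by \<open>symm_symm\<close>. \<open>cop_eq\<close> makes the translation, and the proof
  works with this form.\<close>

abbreviation op :: "'o \<Rightarrow> 'm \<Rightarrow> 'm" where "op C d \<equiv> \<s> C C \<cdot> d"

lemma comonoidD:
  assumes "is_comonoid V C d e"
  shows "ob C" "arr d" "dom d = C" "cod d = C \<otimes> C" "arr e" "dom e = C" "cod e = \<I>"
    "\<a> C C C \<cdot> (d \<odot> \<i> C) \<cdot> d = (\<i> C \<odot> d) \<cdot> d"
    "\<l> C \<cdot> (e \<odot> \<i> C) \<cdot> d = \<i> C" "\<r> C \<cdot> (\<i> C \<odot> e) \<cdot> d = \<i> C"
  using assms unfolding is_comonoid_def by auto

lemma cop_eq: "ob C \<Longrightarrow> cop V C d = op C d"
  unfolding cop_def by (subst inv_arrow_eqI[of "\<s> C C" "\<s> C C"]) auto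

lemma tcomult_typing [simp]:
  assumes "arr d" "arr d'" "dom d = C" "cod d = C \<otimes> C" "dom d' = D" "cod d' = D \<otimes> D" "ob C" "ob D"
  shows "arr (tcomult C d D d')" "dom (tcomult C d D d') = C \<otimes> D"
    "cod (tcomult C d D d') = (C \<otimes> D) \<otimes> (C \<otimes> D)"
  using assms by (auto simp: tensor_comult_def)

lemma tcounit_typing [simp]:
  assumes "arr e" "arr e'" "cod e = \<I>" "cod e' = \<I>"
  shows "arr (tcounit e e')" "dom (tcounit e e') = dom e \<otimes> dom e'" "cod (tcounit e e') = \<I>"
  using assms by (auto simp: tensor_counit_def)

text \<open>After sliding comultiplications and counits past the exchange,
  \<open>mid_hexagon_inv\<close> and the two unit lemmas decompose each axiom into the tensor
  product of the axioms for \<open>C\<close> and \<open>D\<close>.\<close>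

lemma comonoid_tensor:
  assumes C: "is_comonoid V C d e" and D: "is_comonoid V D d' e'"
  shows "is_comonoid V (C \<otimes> D) (tcomult C d D d') (tcounit e e')"
proof -
  note [simp] = comonoidD(1-7)[OF C] comonoidD(1-7)[OF D]
  let ?d = "tcomult C d D d'"
  have n: "(mid C C D D \<odot> \<i> (C \<otimes> D)) \<cdot> (((d \<odot> d') \<odot> (\<i> C \<odot> \<i> D)) \<cdot> mid C C D D) \<cdot> (d \<odot> d') =
     (mid C C D D \<odot> \<i> (C \<otimes> D)) \<cdot> mid (C \<otimes> C) C (D \<otimes> D) D \<cdot> (((d \<odot> \<i> C) \<cdot> d) \<odot> ((d' \<odot> \<i> D) \<cdot> d'))"
    by (subst mid_nat[symmetric]) auto
  have "\<a> (C \<otimes> D) (C \<otimes> D) (C \<otimes> D) \<cdot> (?d \<odot> \<i> (C \<otimes> D)) \<cdot> ?d =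
      \<a> (C \<otimes> D) (C \<otimes> D) (C \<otimes> D) \<cdot>
      (mid C C D D \<odot> \<i> (C \<otimes> D)) \<cdot> (((d \<odot> d') \<odot> (\<i> C \<odot> \<i> D)) \<cdot> mid C C D D) \<cdot> (d \<odot> d')"
    by (simp add: tensor_comult_def)
  also have "\<dots> = (\<a> (C \<otimes> D) (C \<otimes> D) (C \<otimes> D) \<cdot> (mid C C D D \<odot> \<i> (C \<otimes> D)) \<cdot> mid (C \<otimes> C) C (D \<otimes> D) D) \<cdot>
      (((d \<odot> \<i> C) \<cdot> d) \<odot> ((d' \<odot> \<i> D) \<cdot> d'))"
    unfolding n by simp
  also have "\<dots> = (\<i> (C \<otimes> D) \<odot> mid C C D D) \<cdot> mid C (C \<otimes> C) D (D \<otimes> D) \<cdot>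
     ((\<a> C C C \<cdot> (d \<odot> \<i> C) \<cdot> d) \<odot> (\<a> D D D \<cdot> (d' \<odot> \<i> D) \<cdot> d'))"
    by (subst mid_hexagon_inv) auto
  also have "\<dots> = (\<i> (C \<otimes> D) \<odot> mid C C D D) \<cdot> (mid C (C \<otimes> C) D (D \<otimes> D) \<cdot>
     ((\<i> C \<odot> d) \<odot> (\<i> D \<odot> d'))) \<cdot> (d \<odot> d')"
    unfolding comonoidD(8)[OF C] comonoidD(8)[OF D] by simp
  also have "\<dots> = (\<i> (C \<otimes> D) \<odot> mid C C D D) \<cdot>
     (((\<i> C \<odot> \<i> D) \<odot> (d \<odot> d')) \<cdot> mid C C D D) \<cdot> (d \<odot> d')"
    by (subst mid_nat) auto
  also have "\<dots> = (\<i> (C \<otimes> D) \<odot> ?d) \<cdot> ?d" by (simp add: tensor_comult_def)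
  finally have 1: "\<a> (C \<otimes> D) (C \<otimes> D) (C \<otimes> D) \<cdot> (?d \<odot> \<i> (C \<otimes> D)) \<cdot> ?d = (\<i> (C \<otimes> D) \<odot> ?d) \<cdot> ?d" .
  have "\<l> (C \<otimes> D) \<cdot> (tcounit e e' \<odot> \<i> (C \<otimes> D)) \<cdot> ?d =
      \<l> (C \<otimes> D) \<cdot> (\<l> \<I> \<odot> \<i> (C \<otimes> D)) \<cdot> (((e \<odot> e') \<odot> (\<i> C \<odot> \<i> D)) \<cdot> mid C C D D) \<cdot> (d \<odot> d')"
    by (simp add: tensor_comult_def tensor_counit_def)
  also have "\<dots> = (\<l> (C \<otimes> D) \<cdot> (\<l> \<I> \<odot> \<i> (C \<otimes> D))) \<cdot> mid \<I> C \<I> D \<cdot> (((e \<odot> \<i> C) \<cdot> d) \<odot> ((e' \<odot> \<i> D) \<cdot> d'))"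
    by (subst mid_nat[symmetric]) auto
  also have "\<dots> = (\<l> C \<cdot> (e \<odot> \<i> C) \<cdot> d) \<odot> (\<l> D \<cdot> (e' \<odot> \<i> D) \<cdot> d')"
    by (subst mid_unit_left[symmetric]) auto
  also have "\<dots> = \<i> (C \<otimes> D)" unfolding comonoidD(9)[OF C] comonoidD(9)[OF D] by simp
  finally have 2: "\<l> (C \<otimes> D) \<cdot> (tcounit e e' \<odot> \<i> (C \<otimes> D)) \<cdot> ?d = \<i> (C \<otimes> D)" .
  have "\<r> (C \<otimes> D) \<cdot> (\<i> (C \<otimes> D) \<odot> tcounit e e') \<cdot> ?d =
      \<r> (C \<otimes> D) \<cdot> (\<i> (C \<otimes> D) \<odot> \<l> \<I>) \<cdot> (((\<i> C \<odot> \<i> D) \<odot> (e \<odot> e')) \<cdot> mid C C D D) \<cdot> (d \<odot> d')"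
    by (simp add: tensor_comult_def tensor_counit_def)
  also have "\<dots> = (\<r> (C \<otimes> D) \<cdot> (\<i> (C \<otimes> D) \<odot> \<l> \<I>)) \<cdot> mid C \<I> D \<I> \<cdot> (((\<i> C \<odot> e) \<cdot> d) \<odot> ((\<i> D \<odot> e') \<cdot> d'))"
    by (subst mid_nat[symmetric]) auto
  also have "\<dots> = (\<r> C \<cdot> (\<i> C \<odot> e) \<cdot> d) \<odot> (\<r> D \<cdot> (\<i> D \<odot> e') \<cdot> d')"
    by (subst mid_unit_right[symmetric]) auto
  also have "\<dots> = \<i> (C \<otimes> D)" unfolding comonoidD(10)[OF C] comonoidD(10)[OF D] by simp
  finally have 3: "\<r> (C \<otimes> D) \<cdot> (\<i> (C \<otimes> D) \<odot> tcounit e e') \<cdot> ?d = \<i> (C \<otimes> D)" .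
  show ?thesis using 1 2 3 unfolding is_comonoid_def by simp
qed

section \<open>Comonoid morphisms and the monoidal structure on comonoids\<close>

lemma comonoid_hom_iff:
  "f \<in> comonoid_homs V C d e C' d' e' \<longleftrightarrow> arr f \<and> dom f = C \<and> cod f = C' \<and> d' \<cdot> f = (f \<odot> f) \<cdot> d \<and> e' \<cdot> f = e"
  unfolding comonoid_homs_def by auto

lemma comonoid_hom_id: "is_comonoid V C d e \<Longrightarrow> \<i> C \<in> comonoid_homs V C d e C d e"
  by (simp add: comonoid_hom_iff comonoidD)

lemma comonoid_hom_cmp:
  assumes f: "f \<in> comonoid_homs V C d e C' d' e'" and g: "g \<in> comonoid_homs V C' d' e' C'' d'' e''"
    and C: "is_comonoid V C d e" "is_comonoid V C' d' e'" "is_comonoid V C'' d'' e''"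
  shows "g \<cdot> f \<in> comonoid_homs V C d e C'' d'' e''"
proof -
  note [simp] = comonoidD(1-7)[OF C(1)] comonoidD(1-7)[OF C(2)] comonoidD(1-7)[OF C(3)]
  have [simp]: "arr f" "dom f = C" "cod f = C'" "arr g" "dom g = C'" "cod g = C''"
    using f g by (auto simp: comonoid_hom_iff)
  have "d'' \<cdot> g \<cdot> f = (d'' \<cdot> g) \<cdot> f" by simp
  also have "\<dots> = (g \<odot> g) \<cdot> (d' \<cdot> f)" using g by (simp add: comonoid_hom_iff)
  also have "\<dots> = ((g \<cdot> f) \<odot> (g \<cdot> f)) \<cdot> d" using f by (simp add: comonoid_hom_iff)
  finally have 1: "d'' \<cdot> g \<cdot> f = ((g \<cdot> f) \<odot> (g \<cdot> f)) \<cdot> d" .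
  have "e'' \<cdot> g \<cdot> f = (e'' \<cdot> g) \<cdot> f" by simp
  also have "\<dots> = e" using f g by (simp add: comonoid_hom_iff)
  finally show ?thesis using 1 by (simp add: comonoid_hom_iff)
qed

lemma comonoid_hom_tensor:
  assumes f: "f \<in> comonoid_homs V C d e C' d' e'" and g: "g \<in> comonoid_homs V D k p D' k' p'"
    and C: "is_comonoid V C d e" "is_comonoid V C' d' e'" "is_comonoid V D k p" "is_comonoid V D' k' p'"
  shows "f \<odot> g \<in> comonoid_homs V (C \<otimes> D) (tcomult C d D k) (tcounit e p)
     (C' \<otimes> D') (tcomult C' d' D' k') (tcounit e' p')"
proof -
  note [simp] = comonoidD(1-7)[OF C(1)] comonoidD(1-7)[OF C(2)]
    comonoidD(1-7)[OF C(3)] comonoidD(1-7)[OF C(4)]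
  have [simp]: "arr f" "dom f = C" "cod f = C'" "arr g" "dom g = D" "cod g = D'"
    using f g by (auto simp: comonoid_hom_iff)
  have "tcomult C' d' D' k' \<cdot> (f \<odot> g) = mid C' C' D' D' \<cdot> ((d' \<cdot> f) \<odot> (k' \<cdot> g))"
    by (simp add: tensor_comult_def)
  also have "\<dots> = mid C' C' D' D' \<cdot> ((f \<odot> f) \<odot> (g \<odot> g)) \<cdot> (d \<odot> k)"
    using f g by (simp add: comonoid_hom_iff)
  also have "\<dots> = ((f \<odot> g) \<odot> (f \<odot> g)) \<cdot> tcomult C d D k"
    unfolding tensor_comult_def by (rule mid_nat_tail) auto
  finally show ?thesis using f g by (simp add: comonoid_hom_iff tensor_counit_def)
qed

lemma comonoid_unit: "is_comonoid V \<I> (unit_comult V) (unit_counit V)"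
proof -
  have "\<a> \<I> \<I> \<I> \<cdot> (\<l>\<^sup>- \<I> \<odot> \<i> \<I>) = \<i> \<I> \<odot> \<l>\<^sup>- \<I>"
  proof (rule iso_mono[of "\<i> \<I> \<odot> \<l> \<I>"])
    have "(\<i> \<I> \<odot> \<l> \<I>) \<cdot> \<a> \<I> \<I> \<I> \<cdot> (\<l>\<^sup>- \<I> \<odot> \<i> \<I>) = ((\<i> \<I> \<odot> \<l> \<I>) \<cdot> \<a> \<I> \<I> \<I>) \<cdot> (\<l>\<^sup>- \<I> \<odot> \<i> \<I>)" by simp
    also have "\<dots> = (\<r> \<I> \<odot> \<i> \<I>) \<cdot> (\<l>\<^sup>- \<I> \<odot> \<i> \<I>)" by (simp only: triangle unit_in)
    finally show "(\<i> \<I> \<odot> \<l> \<I>) \<cdot> \<a> \<I> \<I> \<I> \<cdot> (\<l>\<^sup>- \<I> \<odot> \<i> \<I>) = (\<i> \<I> \<odot> \<l> \<I>) \<cdot> (\<i> \<I> \<odot> \<l>\<^sup>- \<I>)"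
      by (simp add: unitors_unit)
    show "(\<i> \<I> \<odot> \<l>\<^sup>- \<I>) \<cdot> (\<i> \<I> \<odot> \<l> \<I>) = \<i> (\<I> \<otimes> (\<I> \<otimes> \<I>))" by simp
  qed auto
  then have "\<a> \<I> \<I> \<I> \<cdot> (\<l>\<^sup>- \<I> \<odot> \<i> \<I>) \<cdot> \<l>\<^sup>- \<I> = (\<i> \<I> \<odot> \<l>\<^sup>- \<I>) \<cdot> \<l>\<^sup>- \<I>"
    by (rule tail) auto
  then show ?thesis unfolding is_comonoid_def unit_comult_def unit_counit_def by (simp add: unitors_unit)
qed

lemma comonoid_hom_counit:
  assumes C: "is_comonoid V C d e"
  shows "e \<in> comonoid_homs V C d e \<I> (unit_comult V) (unit_counit V)"
proof -
  note [simp] = comonoidD(1-7)[OF C]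
  have "\<l> \<I> \<cdot> (e \<odot> e) \<cdot> d = (\<l> \<I> \<cdot> (\<i> \<I> \<odot> e)) \<cdot> (e \<odot> \<i> C) \<cdot> d" by simp
  also have "\<dots> = e \<cdot> (\<l> C \<cdot> (e \<odot> \<i> C) \<cdot> d)" by (subst left_nat) auto
  also have "\<dots> = e" unfolding comonoidD(9)[OF C] by simp
  finally have "\<l> \<I> \<cdot> \<l>\<^sup>- \<I> \<cdot> e = \<l> \<I> \<cdot> (e \<odot> e) \<cdot> d" by simp
  then have "\<l>\<^sup>- \<I> \<cdot> e = (e \<odot> e) \<cdot> d" by (rule iso_mono[of _ _ _ "\<l>\<^sup>- \<I>"]) auto
  then show ?thesis by (simp add: comonoid_hom_iff unit_comult_def unit_counit_def)
qed

lemma comonoid_hom_right_unitor: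
  assumes C: "is_comonoid V C d e"
  shows "\<r> C \<in> comonoid_homs V (C \<otimes> \<I>) (tcomult C d \<I> (unit_comult V)) (tcounit e (unit_counit V)) C d e"
proof -
  note [simp] = comonoidD(1-7)[OF C]
  have "(\<r> C \<odot> \<r> C) \<cdot> mid C C \<I> \<I> \<cdot> (d \<odot> \<l>\<^sup>- \<I>) = ((\<r> C \<odot> \<r> C) \<cdot> mid C C \<I> \<I>) \<cdot> (d \<odot> \<l>\<^sup>- \<I>)" by simp
  also have "\<dots> = \<r> (C \<otimes> C) \<cdot> (d \<odot> \<i> \<I>)" by (subst mid_unit_right) auto
  also have "\<dots> = d \<cdot> \<r> C" by (rule right_nat) auto
  finally show ?thesis
    using right_nat[of e C \<I>] by (simp add: comonoid_hom_iff tensor_comult_def tensor_counit_def unit_comult_def unit_counit_def unitors_unit)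
qed

lemma comonoid_hom_left_unitor:
  assumes C: "is_comonoid V C d e"
  shows "\<l> C \<in> comonoid_homs V (\<I> \<otimes> C) (tcomult \<I> (unit_comult V) C d) (tcounit (unit_counit V) e) C d e"
proof -
  note [simp] = comonoidD(1-7)[OF C]
  have "(\<l> C \<odot> \<l> C) \<cdot> mid \<I> \<I> C C \<cdot> (\<l>\<^sup>- \<I> \<odot> d) = ((\<l> C \<odot> \<l> C) \<cdot> mid \<I> \<I> C C) \<cdot> (\<l>\<^sup>- \<I> \<odot> d)" by simp
  also have "\<dots> = \<l> (C \<otimes> C) \<cdot> (\<i> \<I> \<odot> d)" by (subst mid_unit_left) auto
  also have "\<dots> = d \<cdot> \<l> C" by (rule left_nat) auto
  finally show ?thesis
    using left_nat[of e C \<I>] by (simp add: comonoid_hom_iff tensor_comult_def tensor_counit_def unit_comult_def unit_counit_def)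
qed

text \<open>The comultiplications are compared by \<open>mid_hexagon\<close> and the counits by the
  triangle. In \<open>mult_assoc\<close> this gives both threefold products the same comonoid as
  domain.\<close>

lemma comonoid_hom_associator:
  assumes C: "is_comonoid V C d e" "is_comonoid V C' d' e'" "is_comonoid V C'' d'' e''"
  shows "\<a> C C' C'' \<in> comonoid_homs V
    ((C \<otimes> C') \<otimes> C'') (tcomult (C \<otimes> C') (tcomult C d C' d') C'' d'') (tcounit (tcounit e e') e'')
    (C \<otimes> (C' \<otimes> C'')) (tcomult C d (C' \<otimes> C'') (tcomult C' d' C'' d'')) (tcounit e (tcounit e' e''))"
proof -
  note [simp] = comonoidD(1-7)[OF C(1)] comonoidD(1-7)[OF C(2)] comonoidD(1-7)[OF C(3)]
  have "tcomult C d (C' \<otimes> C'') (tcomult C' d' C'' d'') \<cdot> \<a> C C' C'' =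
     mid C C (C' \<otimes> C'') (C' \<otimes> C'') \<cdot> (\<i> (C \<otimes> C) \<odot> mid C' C' C'' C'') \<cdot> ((d \<odot> (d' \<odot> d'')) \<cdot> \<a> C C' C'')"
    by (simp add: tensor_comult_def)
  also have "(d \<odot> (d' \<odot> d'')) \<cdot> \<a> C C' C'' = \<a> (C \<otimes> C) (C' \<otimes> C') (C'' \<otimes> C'') \<cdot> ((d \<odot> d') \<odot> d'')"
    by (rule assoc_nat[symmetric]) auto
  also have "mid C C (C' \<otimes> C'') (C' \<otimes> C'') \<cdot> (\<i> (C \<otimes> C) \<odot> mid C' C' C'' C'') \<cdot> \<dots> =
    (mid C C (C' \<otimes> C'') (C' \<otimes> C'') \<cdot> (\<i> (C \<otimes> C) \<odot> mid C' C' C'' C'') \<cdot> \<a> (C \<otimes> C) (C' \<otimes> C') (C'' \<otimes> C'')) \<cdot>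
      ((d \<odot> d') \<odot> d'')" by simp
  also have "\<dots> = (\<a> C C' C'' \<odot> \<a> C C' C'') \<cdot> tcomult (C \<otimes> C') (tcomult C d C' d') C'' d''"
    by (subst mid_hexagon[symmetric]) (auto simp: tensor_comult_def)
  finally have 1: "tcomult C d (C' \<otimes> C'') (tcomult C' d' C'' d'') \<cdot> \<a> C C' C'' =
    (\<a> C C' C'' \<odot> \<a> C C' C'') \<cdot> tcomult (C \<otimes> C') (tcomult C d C' d') C'' d''" .
  have "tcounit e (tcounit e' e'') \<cdot> \<a> C C' C'' =
      \<l> \<I> \<cdot> (\<i> \<I> \<odot> \<l> \<I>) \<cdot> ((e \<odot> (e' \<odot> e'')) \<cdot> \<a> C C' C'')"
    by (simp add: tensor_counit_def)
  also have "(e \<odot> (e' \<odot> e'')) \<cdot> \<a> C C' C'' = \<a> \<I> \<I> \<I> \<cdot> ((e \<odot> e') \<odot> e'')"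
    by (rule assoc_nat[symmetric]) auto
  also have "\<l> \<I> \<cdot> (\<i> \<I> \<odot> \<l> \<I>) \<cdot> \<dots> = \<l> \<I> \<cdot> ((\<i> \<I> \<odot> \<l> \<I>) \<cdot> \<a> \<I> \<I> \<I>) \<cdot> ((e \<odot> e') \<odot> e'')" by simp
  also have "\<dots> = \<l> \<I> \<cdot> (\<r> \<I> \<odot> \<i> \<I>) \<cdot> ((e \<odot> e') \<odot> e'')" by (simp only: triangle unit_in)
  also have "\<dots> = tcounit (tcounit e e') e''" by (simp add: tensor_counit_def unitors_unit)
  finally show ?thesis using 1 by (simp add: comonoid_hom_iff)
qed

text \<open>The projections of \<open>C \<otimes> D\<close>, obtained by applying the counit of the
  other factor. They are comonoid morphisms, and convolving along them replaces expressions with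
  \<open>mid\<close> by products in a convolution monoid.\<close>

definition proj1 :: "'o \<Rightarrow> 'm \<Rightarrow> 'm" where "proj1 C e' = \<r> C \<cdot> (\<i> C \<odot> e')"
definition proj2 :: "'m \<Rightarrow> 'o \<Rightarrow> 'm" where "proj2 e D = \<l> D \<cdot> (e \<odot> \<i> D)"

lemma proj_typing [simp]:
  "ob C \<Longrightarrow> arr e \<Longrightarrow> cod e = \<I> \<Longrightarrow> arr (proj1 C e)"
  "ob C \<Longrightarrow> arr e \<Longrightarrow> cod e = \<I> \<Longrightarrow> dom (proj1 C e) = C \<otimes> dom e"
  "ob C \<Longrightarrow> arr e \<Longrightarrow> cod e = \<I> \<Longrightarrow> cod (proj1 C e) = C"
  "ob C \<Longrightarrow> arr e \<Longrightarrow> cod e = \<I> \<Longrightarrow> arr (proj2 e C)"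
  "ob C \<Longrightarrow> arr e \<Longrightarrow> cod e = \<I> \<Longrightarrow> dom (proj2 e C) = dom e \<otimes> C"
  "ob C \<Longrightarrow> arr e \<Longrightarrow> cod e = \<I> \<Longrightarrow> cod (proj2 e C) = C"
  by (auto simp: proj1_def proj2_def)

lemma comonoid_hom_proj1:
  assumes C: "is_comonoid V C d e" and D: "is_comonoid V D d' e'"
  shows "proj1 C e' \<in> comonoid_homs V (C \<otimes> D) (tcomult C d D d') (tcounit e e') C d e"
  unfolding proj1_def
  by (rule comonoid_hom_cmp[OF comonoid_hom_tensor[OF comonoid_hom_id comonoid_hom_counit] comonoid_hom_right_unitor])
    (use C D in \<open>auto intro: comonoid_tensor comonoid_unit\<close>)

lemma comonoid_hom_proj2:
  assumes C: "is_comonoid V C d e" and D: "is_comonoid V D d' e'"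
  shows "proj2 e D \<in> comonoid_homs V (C \<otimes> D) (tcomult C d D d') (tcounit e e') D d' e'"
  unfolding proj2_def
  by (rule comonoid_hom_cmp[OF comonoid_hom_tensor[OF comonoid_hom_counit comonoid_hom_id] comonoid_hom_left_unitor])
    (use C D in \<open>auto intro: comonoid_tensor comonoid_unit\<close>)

text \<open>Each projection discards one half of every coproduct, and the counit laws collapse what
  is left. In the reversed order the two surviving halves have changed places.\<close>

lemma proj_comult:
  assumes C: "is_comonoid V C d e" and D: "is_comonoid V D d' e'"
  shows "(proj1 C e' \<odot> proj2 e D) \<cdot> tcomult C d D d' = \<i> (C \<otimes> D)"
    and "(proj2 e D \<odot> proj1 C e') \<cdot> tcomult C d D d' = \<s> C D"
proof -
  note [simp] = comonoidD(1-7)[OF C] comonoidD(1-7)[OF D]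
  have "(proj1 C e' \<odot> proj2 e D) \<cdot> tcomult C d D d' =
     (\<r> C \<odot> \<l> D) \<cdot> (((\<i> C \<odot> e') \<odot> (e \<odot> \<i> D)) \<cdot> mid C C D D) \<cdot> (d \<odot> d')"
    by (simp add: proj1_def proj2_def tensor_comult_def)
  also have "\<dots> = (\<r> C \<odot> \<l> D) \<cdot> (mid C \<I> \<I> D \<cdot> ((\<i> C \<odot> e) \<odot> (e' \<odot> \<i> D))) \<cdot> (d \<odot> d')"
    by (subst mid_nat) auto
  also have "\<dots> = (\<r> C \<cdot> (\<i> C \<odot> e) \<cdot> d) \<odot> (\<l> D \<cdot> (e' \<odot> \<i> D) \<cdot> d')"
    by (simp add: mid_unit_inner)
  finally show "(proj1 C e' \<odot> proj2 e D) \<cdot> tcomult C d D d' = \<i> (C \<otimes> D)"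
    unfolding comonoidD(9,10)[OF C] comonoidD(9,10)[OF D] by simp
  have "(proj2 e D \<odot> proj1 C e') \<cdot> tcomult C d D d' =
     (\<l> D \<odot> \<r> C) \<cdot> (((e \<odot> \<i> D) \<odot> (\<i> C \<odot> e')) \<cdot> mid C C D D) \<cdot> (d \<odot> d')"
    by (simp add: proj1_def proj2_def tensor_comult_def)
  also have "\<dots> = (\<l> D \<odot> \<r> C) \<cdot> (mid \<I> C D \<I> \<cdot> ((e \<odot> \<i> C) \<odot> (\<i> D \<odot> e'))) \<cdot> (d \<odot> d')"
    by (subst mid_nat) auto
  also have "\<dots> = ((\<l> D \<odot> \<r> C) \<cdot> mid \<I> C D \<I>) \<cdot> (((e \<odot> \<i> C) \<cdot> d) \<odot> ((\<i> D \<odot> e') \<cdot> d'))" by simp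
  also have "\<dots> = \<s> C D \<cdot> ((\<l> C \<cdot> (e \<odot> \<i> C) \<cdot> d) \<odot> (\<r> D \<cdot> (\<i> D \<odot> e') \<cdot> d'))"
    by (subst mid_unit_outer) auto
  finally show "(proj2 e D \<odot> proj1 C e') \<cdot> tcomult C d D d' = \<s> C D"
    unfolding comonoidD(9,10)[OF C] comonoidD(9,10)[OF D] by simp
qed

section \<open>Co-opposite comonoids\<close>

lemma comonoid_cop:
  assumes C: "is_comonoid V C d e"
  shows "is_comonoid V C (op C d) e"
proof -
  note [simp] = comonoidD(1-7)[OF C]
  have "\<a> C C C \<cdot> (op C d \<odot> \<i> C) \<cdot> op C d = \<a> C C C \<cdot> (\<s> C C \<odot> \<i> C) \<cdot> ((d \<odot> \<i> C) \<cdot> \<s> C C) \<cdot> d" by simp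
  also have "(d \<odot> \<i> C) \<cdot> \<s> C C = \<s> C (C \<otimes> C) \<cdot> (\<i> C \<odot> d)" by (rule s_nat[symmetric]) auto
  also have "\<a> C C C \<cdot> (\<s> C C \<odot> \<i> C) \<cdot> \<dots> \<cdot> d = \<a> C C C \<cdot> (\<s> C C \<odot> \<i> C) \<cdot> \<s> C (C \<otimes> C) \<cdot> ((\<i> C \<odot> d) \<cdot> d)" by simp
  also have "\<dots> = \<a> C C C \<cdot> (\<s> C C \<odot> \<i> C) \<cdot> \<s> C (C \<otimes> C) \<cdot> (\<a> C C C \<cdot> (d \<odot> \<i> C) \<cdot> d)"
    by (simp only: comonoidD(8)[OF C])
  also have "\<dots> = (\<a> C C C \<cdot> (\<s> C C \<odot> \<i> C) \<cdot> \<s> C (C \<otimes> C) \<cdot> \<a> C C C) \<cdot> (d \<odot> \<i> C) \<cdot> d" by simp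
  also have "\<dots> = (\<i> C \<odot> \<s> C C) \<cdot> (\<s> (C \<otimes> C) C \<cdot> (d \<odot> \<i> C)) \<cdot> d" by (subst yang_baxter) auto
  also have "\<s> (C \<otimes> C) C \<cdot> (d \<odot> \<i> C) = (\<i> C \<odot> d) \<cdot> \<s> C C" by (rule s_nat) auto
  also have "(\<i> C \<odot> \<s> C C) \<cdot> \<dots> \<cdot> d = (\<i> C \<odot> op C d) \<cdot> op C d" by simp
  finally have 1: "\<a> C C C \<cdot> (op C d \<odot> \<i> C) \<cdot> op C d = (\<i> C \<odot> op C d) \<cdot> op C d" .
  have "\<l> C \<cdot> (e \<odot> \<i> C) \<cdot> op C d = \<l> C \<cdot> ((e \<odot> \<i> C) \<cdot> \<s> C C) \<cdot> d" by simp
  also have "(e \<odot> \<i> C) \<cdot> \<s> C C = \<s> C \<I> \<cdot> (\<i> C \<odot> e)" by (rule s_nat[symmetric]) auto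
  also have "\<l> C \<cdot> \<dots> \<cdot> d = (\<l> C \<cdot> \<s> C \<I>) \<cdot> (\<i> C \<odot> e) \<cdot> d" by simp
  finally have 2: "\<l> C \<cdot> (e \<odot> \<i> C) \<cdot> op C d = \<i> C"
    by (simp only: left_unitor_symm comonoidD(1)[OF C] comonoidD(10)[OF C])
  have "\<r> C \<cdot> (\<i> C \<odot> e) \<cdot> op C d = \<r> C \<cdot> ((\<i> C \<odot> e) \<cdot> \<s> C C) \<cdot> d" by simp
  also have "(\<i> C \<odot> e) \<cdot> \<s> C C = \<s> \<I> C \<cdot> (e \<odot> \<i> C)" by (rule s_nat[symmetric]) auto
  also have "\<r> C \<cdot> \<dots> \<cdot> d = (\<r> C \<cdot> \<s> \<I> C) \<cdot> (e \<odot> \<i> C) \<cdot> d" by simp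
  finally have 3: "\<r> C \<cdot> (\<i> C \<odot> e) \<cdot> op C d = \<i> C"
    by (simp only: right_unitor_symm comonoidD(1)[OF C] comonoidD(9)[OF C])
  show ?thesis unfolding is_comonoid_def using 1 2 3 by simp
qed

lemma comonoid_hom_cop:
  assumes f: "f \<in> comonoid_homs V C d e D d' e'" and C: "is_comonoid V C d e" and D: "is_comonoid V D d' e'"
  shows "f \<in> comonoid_homs V C (op C d) e D (op D d') e'"
proof -
  note [simp] = comonoidD(1-7)[OF C] comonoidD(1-7)[OF D]
  have [simp]: "arr f" "dom f = C" "cod f = D" using f by (auto simp: comonoid_hom_iff)
  have "op D d' \<cdot> f = \<s> D D \<cdot> (f \<odot> f) \<cdot> d" using f by (simp add: comonoid_hom_iff)
  also have "\<dots> = (f \<odot> f) \<cdot> \<s> C C \<cdot> d" by (rule s_nat_tail) auto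
  finally show ?thesis using f by (simp add: comonoid_hom_iff)
qed

lemma cop_tensor:
  assumes C: "is_comonoid V C d e" and D: "is_comonoid V D d' e'"
  shows "op (C \<otimes> D) (tcomult C d D d') = tcomult C (op C d) D (op D d')"
proof -
  note [simp] = comonoidD(1-7)[OF C] comonoidD(1-7)[OF D]
  have "op (C \<otimes> D) (tcomult C d D d') = (\<s> (C \<otimes> D) (C \<otimes> D) \<cdot> mid C C D D) \<cdot> (d \<odot> d')"
    by (simp add: tensor_comult_def)
  also have "\<dots> = tcomult C (op C d) D (op D d')"
    by (subst symm_mid) (auto simp: tensor_comult_def)
  finally show ?thesis .
qed

lemma cop_unit: "op \<I> (unit_comult V) = unit_comult V"
  by (simp add: unit_comult_def symm_unit_unit)

subsection \<open>Convolution and antipodes\<close>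

abbreviation conv :: "'m \<Rightarrow> 'm \<Rightarrow> 'm \<Rightarrow> 'm \<Rightarrow> 'm" where "conv \<equiv> convolution V"

lemma monoidD:
  assumes "is_monoid V A m u"
  shows "ob A" "arr m" "dom m = A \<otimes> A" "cod m = A" "arr u" "dom u = \<I>" "cod u = A"
    "m \<cdot> (m \<odot> \<i> A) = m \<cdot> (\<i> A \<odot> m) \<cdot> \<a> A A A"
    "m \<cdot> (u \<odot> \<i> A) = \<l> A" "m \<cdot> (\<i> A \<odot> u) = \<r> A"
  using assms unfolding is_monoid_def by auto

lemma conv_typing [simp]:
  assumes "arr d" "arr m" "arr f" "arr g" "cod d = dom f \<otimes> dom g" "dom m = cod f \<otimes> cod g"
  shows "arr (conv d m f g)" "dom (conv d m f g) = dom d" "cod (conv d m f g) = cod m"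
  using assms by (auto simp: convolution_def)

lemma conv_assoc:
  assumes C: "is_comonoid V C d e" and A: "is_monoid V A m u"
    and [simp]: "arr f" "dom f = C" "cod f = A" "arr g" "dom g = C" "cod g = A" "arr h" "dom h = C" "cod h = A"
  shows "conv d m (conv d m f g) h = conv d m f (conv d m g h)"
proof -
  note [simp] = comonoidD(1-7)[OF C] monoidD(1-7)[OF A]
  have "conv d m (conv d m f g) h = (m \<cdot> (m \<odot> \<i> A)) \<cdot> ((f \<odot> g) \<odot> h) \<cdot> (d \<odot> \<i> C) \<cdot> d"
    by (simp add: convolution_def)
  also have "\<dots> = (m \<cdot> (\<i> A \<odot> m)) \<cdot> (\<a> A A A \<cdot> ((f \<odot> g) \<odot> h)) \<cdot> (d \<odot> \<i> C) \<cdot> d"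
    unfolding monoidD(8)[OF A] by simp
  also have "\<a> A A A \<cdot> ((f \<odot> g) \<odot> h) = (f \<odot> (g \<odot> h)) \<cdot> \<a> C C C" by (rule assoc_nat) auto
  also have "(m \<cdot> (\<i> A \<odot> m)) \<cdot> \<dots> \<cdot> (d \<odot> \<i> C) \<cdot> d =
      (m \<cdot> (\<i> A \<odot> m)) \<cdot> (f \<odot> (g \<odot> h)) \<cdot> (\<a> C C C \<cdot> (d \<odot> \<i> C) \<cdot> d)" by simp
  also have "\<dots> = conv d m f (conv d m g h)"
    unfolding comonoidD(8)[OF C] by (simp add: convolution_def)
  finally show ?thesis .
qed

lemma conv_unit:
  assumes C: "is_comonoid V C d e" and A: "is_monoid V A m u"
    and [simp]: "arr f" "dom f = C" "cod f = A"
  shows "conv d m (u \<cdot> e) f = f" "conv d m f (u \<cdot> e) = f"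
proof -
  note [simp] = comonoidD(1-7)[OF C] monoidD(1-7)[OF A]
  have "conv d m (u \<cdot> e) f = (m \<cdot> (u \<odot> \<i> A)) \<cdot> (\<i> \<I> \<odot> f) \<cdot> (e \<odot> \<i> C) \<cdot> d" by (simp add: convolution_def)
  also have "\<dots> = \<l> A \<cdot> (\<i> \<I> \<odot> f) \<cdot> (e \<odot> \<i> C) \<cdot> d" unfolding monoidD(9)[OF A] ..
  also have "\<dots> = f \<cdot> \<l> C \<cdot> (e \<odot> \<i> C) \<cdot> d" by (rule left_nat_tail) auto
  finally show "conv d m (u \<cdot> e) f = f" unfolding comonoidD(9)[OF C] by simp
  have "conv d m f (u \<cdot> e) = (m \<cdot> (\<i> A \<odot> u)) \<cdot> (f \<odot> \<i> \<I>) \<cdot> (\<i> C \<odot> e) \<cdot> d" by (simp add: convolution_def)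
  also have "\<dots> = \<r> A \<cdot> (f \<odot> \<i> \<I>) \<cdot> (\<i> C \<odot> e) \<cdot> d" unfolding monoidD(10)[OF A] ..
  also have "\<dots> = f \<cdot> \<r> C \<cdot> (\<i> C \<odot> e) \<cdot> d" by (rule right_nat_tail) auto
  finally show "conv d m f (u \<cdot> e) = f" unfolding comonoidD(10)[OF C] by simp
qed

lemma conv_comonoid_hom:
  assumes h: "h \<in> comonoid_homs V C' d' e' C d e" and C: "is_comonoid V C d e" and C': "is_comonoid V C' d' e'"
    and [simp]: "arr m" "arr f" "dom f = C" "arr g" "dom g = C" "dom m = cod f \<otimes> cod g"
  shows "conv d m f g \<cdot> h = conv d' m (f \<cdot> h) (g \<cdot> h)"
proof -
  note [simp] = comonoidD(1-7)[OF C] comonoidD(1-7)[OF C']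
  have [simp]: "arr h" "dom h = C'" "cod h = C" and d: "d \<cdot> h = (h \<odot> h) \<cdot> d'"
    using h by (auto simp: comonoid_hom_iff)
  have "conv d m f g \<cdot> h = m \<cdot> (f \<odot> g) \<cdot> (d \<cdot> h)" by (simp add: convolution_def)
  then show ?thesis unfolding d by (simp add: convolution_def)
qed

text \<open>An opantipode of \<open>A\<close> is an antipode of this bimonoid, so
  \<open>antipode_antihom\<close> serves both cases of the theorem.\<close>

lemma bimonoid_cop:
  assumes A: "is_bimonoid V A m u d e"
  shows "is_bimonoid V A m u (op A d) e"
proof -
  have C: "is_comonoid V A d e" using A by (simp add: is_bimonoid_def)
  have "m \<in> comonoid_homs V (A \<otimes> A) (op (A \<otimes> A) (tcomult A d A d)) (tcounit e e) A (op A d) e"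
    by (rule comonoid_hom_cop) (use A C in \<open>auto simp: is_bimonoid_def intro: comonoid_tensor\<close>)
  moreover have "u \<in> comonoid_homs V \<I> (op \<I> (unit_comult V)) (unit_counit V) A (op A d) e"
    by (rule comonoid_hom_cop) (use A C in \<open>auto simp: is_bimonoid_def intro: comonoid_unit\<close>)
  ultimately show ?thesis
    using A comonoid_cop[OF C] unfolding cop_tensor[OF C C] cop_unit by (simp add: is_bimonoid_def)
qed

text \<open>In the convolution monoid of maps \<open>A \<otimes> A \<rightarrow> A\<close> the multiplication is the product of the two
  projections, so its inverse is the product of their inverses in the opposite order.\<close>

lemma antipode_antihom:
  assumes A: "is_bimonoid V A m u d e" and S: "convolution_inverse V A d e A m u (\<i> A) S"
  shows "S \<cdot> m = m \<cdot> (S \<odot> S) \<cdot> \<s> A A" "S \<cdot> u = u"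
proof -
  have C: "is_comonoid V A d e" and M: "is_monoid V A m u"
    and mh: "m \<in> comonoid_homs V (A \<otimes> A) (tcomult A d A d) (tcounit e e) A d e"
    and uh: "u \<in> comonoid_homs V \<I> (unit_comult V) (unit_counit V) A d e"
    using A by (auto simp: is_bimonoid_def)
  note [simp] = comonoidD(1-7)[OF C] monoidD(1-7)[OF M]
  have [simp]: "arr S" "dom S = A" "cod S = A" and S1: "conv d m (\<i> A) S = u \<cdot> e" and S2: "conv d m S (\<i> A) = u \<cdot> e"
    using S by (auto simp: convolution_inverse_def)
  let ?D = "A \<otimes> A" and ?d = "tcomult A d A d" and ?e = "tcounit e e"
  let ?p = "proj1 A e" and ?q = "proj2 e A"
  have D: "is_comonoid V ?D ?d ?e" by (rule comonoid_tensor[OF C C])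
  \<comment> \<open>Composition with a comonoid morphism \<open>h\<close> preserves convolution, so
    \<open>S \<cdot> h\<close> is the convolution inverse of \<open>h\<close>.\<close>
  have inv1: "conv ?d m h (S \<cdot> h) = u \<cdot> ?e" and inv2: "conv ?d m (S \<cdot> h) h = u \<cdot> ?e"
    if "h \<in> comonoid_homs V ?D ?d ?e A d e" for h
  proof -
    have "arr h" "dom h = ?D" "cod h = A" "e \<cdot> h = ?e" using that by (auto simp: comonoid_hom_iff)
    then show "conv ?d m h (S \<cdot> h) = u \<cdot> ?e" "conv ?d m (S \<cdot> h) h = u \<cdot> ?e"
      using conv_comonoid_hom[OF that C D, of m "\<i> A" S] conv_comonoid_hom[OF that C D, of m S "\<i> A"]
      by (auto simp: S1 S2)
  qed
  have m: "m = conv ?d m ?p ?q" by (simp add: convolution_def proj_comult[OF C C])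
  have y: "conv ?d m (S \<cdot> ?q) (S \<cdot> ?p) = m \<cdot> (S \<odot> S) \<cdot> \<s> A A"
  proof -
    have "conv ?d m (S \<cdot> ?q) (S \<cdot> ?p) = m \<cdot> (S \<odot> S) \<cdot> ((?q \<odot> ?p) \<cdot> ?d)" by (simp add: convolution_def)
    then show ?thesis by (simp only: proj_comult[OF C C])
  qed
  let ?y = "conv ?d m (S \<cdot> ?q) (S \<cdot> ?p)"
  have "conv ?d m m ?y = conv ?d m (conv ?d m ?p ?q) ?y" by (simp flip: m)
  also have "\<dots> = conv ?d m ?p (conv ?d m (conv ?d m ?q (S \<cdot> ?q)) (S \<cdot> ?p))"
    by (simp add: conv_assoc[OF D M])
  also have "\<dots> = u \<cdot> ?e"
    by (simp add: inv1[OF comonoid_hom_proj1[OF C C]] inv1[OF comonoid_hom_proj2[OF C C]] conv_unit[OF D M])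
  finally have my: "conv ?d m m ?y = u \<cdot> ?e" .
  \<comment> \<open>A left inverse \<open>S \<cdot> m\<close> and a right inverse \<open>?y\<close>
    of the same element \<open>m\<close> coincide.\<close>
  have "S \<cdot> m = conv ?d m (S \<cdot> m) (conv ?d m m ?y)" unfolding my by (simp add: conv_unit[OF D M])
  also have "\<dots> = conv ?d m (conv ?d m (S \<cdot> m) m) ?y" by (simp add: conv_assoc[OF D M])
  also have "\<dots> = ?y" unfolding inv2[OF mh] by (simp add: conv_unit[OF D M])
  finally show "S \<cdot> m = m \<cdot> (S \<odot> S) \<cdot> \<s> A A" unfolding y .
  have eu: "e \<cdot> u = \<i> \<I>" using uh by (simp add: comonoid_hom_iff unit_counit_def)
  \<comment> \<open>The antipode equation is composed with \<open>u\<close>. On the right,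
    \<open>u\<close> is the unit of the convolution monoid of arrows
    \<open>\<I> \<rightarrow> A\<close>, which leaves \<open>S \<cdot> u\<close>.\<close>
  have "u = conv d m (\<i> A) S \<cdot> u" by (simp add: S1 eu)
  also have "\<dots> = conv (unit_comult V) m (\<i> A \<cdot> u) (S \<cdot> u)"
    by (rule conv_comonoid_hom[OF uh C comonoid_unit]) auto
  also have "\<dots> = S \<cdot> u"
    using conv_unit(1)[OF comonoid_unit M, of "S \<cdot> u"] by (simp add: unit_counit_def)
  finally show "S \<cdot> u = u" by simp
qed

subsection \<open>Measurings and their transposes\<close>

lemma ev_typing [simp]:
  assumes "ob X" "ob Y"
  shows "ob \<lbrakk>X, Y\<rbrakk>" "arr (\<e> X Y)" "dom (\<e> X Y) = \<lbrakk>X, Y\<rbrakk> \<otimes> X" "cod (\<e> X Y) = Y"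
  using assms ihom_in ev_in by auto

lemma transpose_props:
  assumes "arr f" "dom f = Z \<otimes> X" "cod f = Y" "ob X" "ob Z"
  shows "arr (transpose V Z X Y f)" "dom (transpose V Z X Y f) = Z" "cod (transpose V Z X Y f) = \<lbrakk>X, Y\<rbrakk>"
    "\<e> X Y \<cdot> (transpose V Z X Y f \<odot> \<i> X) = f"
proof -
  have "ob Y" using assms by auto
  then have "\<exists>!g. g \<in> Hom V Z \<lbrakk>X, Y\<rbrakk> \<and> \<e> X Y \<cdot> (g \<odot> \<i> X) = f"
    using closed[of X Y Z f] assms by auto
  from theI'[OF this] show "arr (transpose V Z X Y f)" "dom (transpose V Z X Y f) = Z"
    "cod (transpose V Z X Y f) = \<lbrakk>X, Y\<rbrakk>" "\<e> X Y \<cdot> (transpose V Z X Y f \<odot> \<i> X) = f"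
    unfolding transpose_def by auto
qed

lemma ev_inject:
  assumes "\<e> X Y \<cdot> (g \<odot> \<i> X) = \<e> X Y \<cdot> (h \<odot> \<i> X)" "arr g" "arr h" "dom g = dom h"
    "cod g = \<lbrakk>X, Y\<rbrakk>" "cod h = \<lbrakk>X, Y\<rbrakk>" "ob X" "ob Y"
  shows "g = h"
  using closed[of X Y "dom g" "\<e> X Y \<cdot> (g \<odot> \<i> X)"] assms by auto

lemma ev_eq_iff:
  assumes "arr g" "arr h" "dom g = dom h" "cod g = \<lbrakk>X, Y\<rbrakk>" "cod h = \<lbrakk>X, Y\<rbrakk>" "ob X" "ob Y"
  shows "g = h \<longleftrightarrow> \<e> X Y \<cdot> (g \<odot> \<i> X) = \<e> X Y \<cdot> (h \<odot> \<i> X)"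
  using ev_inject[of X Y g h] assms by auto

lemma ihom_map_props:
  assumes [simp]: "arr h" "arr g"
  shows "arr (ihom_map V h g)" "dom (ihom_map V h g) = \<lbrakk>cod h, dom g\<rbrakk>" "cod (ihom_map V h g) = \<lbrakk>dom h, cod g\<rbrakk>"
    "\<e> (dom h) (cod g) \<cdot> (ihom_map V h g \<odot> \<i> (dom h)) = g \<cdot> \<e> (cod h) (dom g) \<cdot> (\<i> \<lbrakk>cod h, dom g\<rbrakk> \<odot> h)"
  unfolding ihom_map_def Let_def by (rule transpose_props; simp)+

lemma ihom_tensor_props:
  assumes [simp]: "ob X" "ob Y" "ob X'" "ob Y'"
  shows "arr (ihom_tensor V X Y X' Y')" "dom (ihom_tensor V X Y X' Y') = \<lbrakk>X, Y\<rbrakk> \<otimes> \<lbrakk>X', Y'\<rbrakk>"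
    "cod (ihom_tensor V X Y X' Y') = \<lbrakk>X \<otimes> X', Y \<otimes> Y'\<rbrakk>"
    "\<e> (X \<otimes> X') (Y \<otimes> Y') \<cdot> (ihom_tensor V X Y X' Y' \<odot> \<i> (X \<otimes> X')) =
      (\<e> X Y \<odot> \<e> X' Y') \<cdot> mid \<lbrakk>X, Y\<rbrakk> \<lbrakk>X', Y'\<rbrakk> X X'"
  unfolding ihom_tensor_def by (rule transpose_props; simp)+

text \<open>The multiplication of \<open>[C, B]\<close> and that of \<open>P(A, B)\<close> are both built from such a composite.\<close>

lemma ev_ihom_map_tensor:
  assumes [simp]: "arr g" "cod g = \<lbrakk>C, B\<rbrakk>" "arr g'" "cod g' = \<lbrakk>C', B'\<rbrakk>" "arr h" "cod h = C \<otimes> C'"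
    "arr m" "dom m = B \<otimes> B'" "ob C" "ob C'" "ob B" "ob B'"
  shows "\<e> (dom h) (cod m) \<cdot> ((ihom_map V h m \<cdot> ihom_tensor V C B C' B' \<cdot> (g \<odot> g')) \<odot> \<i> (dom h)) =
    m \<cdot> ((\<e> C B \<cdot> (g \<odot> \<i> C)) \<odot> (\<e> C' B' \<cdot> (g' \<odot> \<i> C'))) \<cdot> mid (dom g) (dom g') C C' \<cdot> (\<i> (dom g \<otimes> dom g') \<odot> h)"
proof -
  note [simp] = ihom_map_props(1-3) ihom_tensor_props(1-3)
  let ?t = "ihom_tensor V C B C' B'"
  have "\<e> (dom h) (cod m) \<cdot> ((ihom_map V h m \<cdot> ?t \<cdot> (g \<odot> g')) \<odot> \<i> (dom h)) =
      (\<e> (dom h) (cod m) \<cdot> (ihom_map V h m \<odot> \<i> (dom h))) \<cdot> ((?t \<cdot> (g \<odot> g')) \<odot> \<i> (dom h))" by simp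
  also have "\<dots> = (m \<cdot> \<e> (cod h) (dom m) \<cdot> (\<i> \<lbrakk>cod h, dom m\<rbrakk> \<odot> h)) \<cdot> ((?t \<cdot> (g \<odot> g')) \<odot> \<i> (dom h))"
    by (subst ihom_map_props(4)) auto
  also have "\<dots> = m \<cdot> (\<e> (C \<otimes> C') (B \<otimes> B') \<cdot> (?t \<odot> \<i> (C \<otimes> C'))) \<cdot> ((g \<odot> g') \<odot> h)" by simp
  also have "\<e> (C \<otimes> C') (B \<otimes> B') \<cdot> (?t \<odot> \<i> (C \<otimes> C')) = (\<e> C B \<odot> \<e> C' B') \<cdot> mid \<lbrakk>C, B\<rbrakk> \<lbrakk>C', B'\<rbrakk> C C'"
    by (rule ihom_tensor_props) auto
  also have "m \<cdot> \<dots> \<cdot> ((g \<odot> g') \<odot> h) = m \<cdot> (\<e> C B \<odot> \<e> C' B') \<cdot>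
      (mid \<lbrakk>C, B\<rbrakk> \<lbrakk>C', B'\<rbrakk> C C' \<cdot> ((g \<odot> g') \<odot> (\<i> C \<odot> \<i> C'))) \<cdot> (\<i> (dom g \<otimes> dom g') \<odot> h)" by simp
  also have "mid \<lbrakk>C, B\<rbrakk> \<lbrakk>C', B'\<rbrakk> C C' \<cdot> ((g \<odot> g') \<odot> (\<i> C \<odot> \<i> C')) =
      ((g \<odot> \<i> C) \<odot> (g' \<odot> \<i> C')) \<cdot> mid (dom g) (dom g') C C'" by (rule mid_nat) auto
  finally show ?thesis by simp
qed

text \<open>The measurings \<open>A \<rightarrow> [C, B]\<close> in transposed form \<open>A \<otimes> C \<rightarrow> B\<close>.\<close>

definition pairing :: "'o \<Rightarrow> 'm \<Rightarrow> 'm \<Rightarrow> 'o \<Rightarrow> 'm \<Rightarrow> 'm \<Rightarrow> 'o \<Rightarrow> 'm \<Rightarrow> 'm \<Rightarrow> 'm \<Rightarrow> bool" where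
  "pairing A mA uA B mB uB C d e f \<longleftrightarrow> f \<in> Hom V (A \<otimes> C) B \<and>
     f \<cdot> (mA \<odot> \<i> C) = mB \<cdot> (f \<odot> f) \<cdot> mid A A C C \<cdot> (\<i> (A \<otimes> A) \<odot> d) \<and>
     f \<cdot> (uA \<odot> \<i> C) = uB \<cdot> e \<cdot> \<l> C"

text \<open>Arrows into \<open>\<lbrakk>C, B\<rbrakk>\<close> agree when their evaluations do, and
  evaluating the multiplication and unit of \<open>\<lbrakk>C, B\<rbrakk>\<close> produces the two
  equations of \<open>pairing\<close>. The internal hom thereby disappears from the later
  calculations.\<close>

lemma measuring_iff_pairing:
  assumes A: "is_monoid V A mA uA" and B: "is_monoid V B mB uB" and C: "is_comonoid V C d e"
    and [simp]: "arr g" "dom g = A" "cod g = \<lbrakk>C, B\<rbrakk>"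
  shows "g \<in> measurings V A mA uA B mB uB C d e \<longleftrightarrow>
    pairing A mA uA B mB uB C d e (\<e> C B \<cdot> (g \<odot> \<i> C))" (is "_ \<longleftrightarrow> pairing _ _ _ _ _ _ _ _ _ ?f")
proof -
  note [simp] = monoidD(1-7)[OF A] monoidD(1-7)[OF B] comonoidD(1-7)[OF C]
    ihom_map_props(1-3) ihom_tensor_props(1-3)
  have u: "arr (ihom_unit V C e B uB)" "dom (ihom_unit V C e B uB) = \<I>" "cod (ihom_unit V C e B uB) = \<lbrakk>C, B\<rbrakk>"
    "\<e> C B \<cdot> (ihom_unit V C e B uB \<odot> \<i> C) = uB \<cdot> e \<cdot> \<l> C"
    unfolding ihom_unit_def by (rule transpose_props; simp)+
  have "g \<cdot> uA = ihom_unit V C e B uB \<longleftrightarrow>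
      \<e> C B \<cdot> ((g \<cdot> uA) \<odot> \<i> C) = \<e> C B \<cdot> (ihom_unit V C e B uB \<odot> \<i> C)"
    by (rule ev_eq_iff) (auto simp: u(1-3))
  also have "\<dots> \<longleftrightarrow> ?f \<cdot> (uA \<odot> \<i> C) = uB \<cdot> e \<cdot> \<l> C" unfolding u(4) by simp
  finally have 1: "g \<cdot> uA = ihom_unit V C e B uB \<longleftrightarrow> ?f \<cdot> (uA \<odot> \<i> C) = uB \<cdot> e \<cdot> \<l> C" .
  let ?k = "ihom_map V d mB \<cdot> ihom_tensor V C B C B \<cdot> (g \<odot> g)"
  have "g \<cdot> mA = ?k \<longleftrightarrow> \<e> C B \<cdot> ((g \<cdot> mA) \<odot> \<i> C) = \<e> C B \<cdot> (?k \<odot> \<i> C)"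
    by (rule ev_eq_iff) auto
  also have "\<e> C B \<cdot> (?k \<odot> \<i> C) = mB \<cdot> (?f \<odot> ?f) \<cdot> mid A A C C \<cdot> (\<i> (A \<otimes> A) \<odot> d)"
    using ev_ihom_map_tensor[of g C B g C B d mB] by simp
  finally have 2: "g \<cdot> mA = ?k \<longleftrightarrow> ?f \<cdot> (mA \<odot> \<i> C) = mB \<cdot> (?f \<odot> ?f) \<cdot> mid A A C C \<cdot> (\<i> (A \<otimes> A) \<odot> d)"
    by simp
  have "ihom_mult V C d B mB \<cdot> (g \<odot> g) = ?k" by (simp add: ihom_mult_def)
  then show ?thesis using 1 2 unfolding measurings_def monoid_homs_def pairing_def by simp
qed

lemma transpose_measuring:
  assumes A: "is_monoid V A mA uA" and B: "is_monoid V B mB uB" and C: "is_comonoid V C d e"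
    and f: "pairing A mA uA B mB uB C d e f"
  shows "transpose V A C B f \<in> measurings V A mA uA B mB uB C d e"
proof -
  have "arr f" "dom f = A \<otimes> C" "cod f = B" using f by (auto simp: pairing_def)
  from transpose_props[OF this comonoidD(1)[OF C] monoidD(1)[OF A]]
  show ?thesis using measuring_iff_pairing[OF A B C] f by metis
qed

lemma pairing_comonoid_hom:
  assumes A: "is_monoid V A mA uA" and B: "is_monoid V B mB uB" and C: "is_comonoid V C d e" and C': "is_comonoid V C' d' e'"
    and f: "pairing A mA uA B mB uB C d e f" and h: "h \<in> comonoid_homs V C' d' e' C d e"
  shows "pairing A mA uA B mB uB C' d' e' (f \<cdot> (\<i> A \<odot> h))"
proof -
  note [simp] = monoidD(1-7)[OF A] monoidD(1-7)[OF B] comonoidD(1-7)[OF C] comonoidD(1-7)[OF C']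
  have [simp]: "arr f" "dom f = A \<otimes> C" "cod f = B" using f by (auto simp: pairing_def)
  have [simp]: "arr h" "dom h = C'" "cod h = C" using h by (auto simp: comonoid_hom_iff)
  have "(f \<cdot> (\<i> A \<odot> h)) \<cdot> (mA \<odot> \<i> C') = (f \<cdot> (mA \<odot> \<i> C)) \<cdot> (\<i> (A \<otimes> A) \<odot> h)" by simp
  also have "\<dots> = mB \<cdot> (f \<odot> f) \<cdot> mid A A C C \<cdot> (\<i> (A \<otimes> A) \<odot> (d \<cdot> h))"
    using f by (simp add: pairing_def)
  also have "d \<cdot> h = (h \<odot> h) \<cdot> d'" using h by (simp add: comonoid_hom_iff)
  also have "mB \<cdot> (f \<odot> f) \<cdot> mid A A C C \<cdot> (\<i> (A \<otimes> A) \<odot> \<dots>) =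
     mB \<cdot> (f \<odot> f) \<cdot> (mid A A C C \<cdot> ((\<i> A \<odot> \<i> A) \<odot> (h \<odot> h))) \<cdot> (\<i> (A \<otimes> A) \<odot> d')" by simp
  also have "mid A A C C \<cdot> ((\<i> A \<odot> \<i> A) \<odot> (h \<odot> h)) = ((\<i> A \<odot> h) \<odot> (\<i> A \<odot> h)) \<cdot> mid A A C' C'"
    by (rule mid_nat) auto
  finally have 1: "(f \<cdot> (\<i> A \<odot> h)) \<cdot> (mA \<odot> \<i> C') =
     mB \<cdot> ((f \<cdot> (\<i> A \<odot> h)) \<odot> (f \<cdot> (\<i> A \<odot> h))) \<cdot> mid A A C' C' \<cdot> (\<i> (A \<otimes> A) \<odot> d')" by simp
  have "(f \<cdot> (\<i> A \<odot> h)) \<cdot> (uA \<odot> \<i> C') = (f \<cdot> (uA \<odot> \<i> C)) \<cdot> (\<i> \<I> \<odot> h)" by simp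
  also have "\<dots> = uB \<cdot> e \<cdot> (\<l> C \<cdot> (\<i> \<I> \<odot> h))" using f by (simp add: pairing_def)
  also have "\<l> C \<cdot> (\<i> \<I> \<odot> h) = h \<cdot> \<l> C'" by (rule left_nat) auto
  also have "uB \<cdot> e \<cdot> h \<cdot> \<l> C' = uB \<cdot> (e \<cdot> h) \<cdot> \<l> C'" by simp
  also have "e \<cdot> h = e'" using h by (simp add: comonoid_hom_iff)
  finally show ?thesis using 1 by (simp add: pairing_def)
qed

text \<open>Writing this product as a convolution over \<open>A \<otimes> (C \<otimes> C')\<close>
  makes associativity and units of convolution available in place of coherence calculations. The
  projections cancel the comultiplications of \<open>C\<close> and \<open>C'\<close>.\<close>

lemma conv_proj_right:
  assumes A: "is_comonoid V A dA eA" and C: "is_comonoid V C d e" and C': "is_comonoid V C' d' e'"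
    and [simp]: "arr x" "dom x = A \<otimes> C" "arr y" "dom y = A \<otimes> C'" "arr m" "dom m = cod x \<otimes> cod y"
  shows "conv (tcomult A dA (C \<otimes> C') (tcomult C d C' d')) m
      (x \<cdot> (\<i> A \<odot> proj1 C e')) (y \<cdot> (\<i> A \<odot> proj2 e C')) =
    m \<cdot> (x \<odot> y) \<cdot> mid A A C C' \<cdot> (dA \<odot> \<i> (C \<otimes> C'))"
proof -
  note [simp] = comonoidD(1-7)[OF A] comonoidD(1-7)[OF C] comonoidD(1-7)[OF C']
  let ?d = "tcomult C d C' d'" and ?p = "proj1 C e'" and ?q = "proj2 e C'"
  have "((\<i> A \<odot> ?p) \<odot> (\<i> A \<odot> ?q)) \<cdot> mid A A (C \<otimes> C') (C \<otimes> C') = mid A A C C' \<cdot> ((\<i> A \<odot> \<i> A) \<odot> (?p \<odot> ?q))"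
    by (rule mid_nat[symmetric]) auto
  then have "((\<i> A \<odot> ?p) \<odot> (\<i> A \<odot> ?q)) \<cdot> mid A A (C \<otimes> C') (C \<otimes> C') \<cdot> (dA \<odot> ?d) =
     (mid A A C C' \<cdot> ((\<i> A \<odot> \<i> A) \<odot> (?p \<odot> ?q))) \<cdot> (dA \<odot> ?d)" by (rule tail) auto
  also have "\<dots> = mid A A C C' \<cdot> (dA \<odot> \<i> (C \<otimes> C'))" by (simp add: proj_comult[OF C C'])
  finally have 1: "((\<i> A \<odot> ?p) \<odot> (\<i> A \<odot> ?q)) \<cdot> mid A A (C \<otimes> C') (C \<otimes> C') \<cdot> (dA \<odot> ?d) =
     mid A A C C' \<cdot> (dA \<odot> \<i> (C \<otimes> C'))" .
  have "conv (tcomult A dA (C \<otimes> C') ?d) m (x \<cdot> (\<i> A \<odot> ?p)) (y \<cdot> (\<i> A \<odot> ?q)) =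
     m \<cdot> (x \<odot> y) \<cdot> (((\<i> A \<odot> ?p) \<odot> (\<i> A \<odot> ?q)) \<cdot> mid A A (C \<otimes> C') (C \<otimes> C') \<cdot> (dA \<odot> ?d))"
    by (simp add: convolution_def tensor_comult_def[of V A])
  then show ?thesis unfolding 1 .
qed

text \<open>The counterpart in the first variable. For \<open>A' = A\<close> and
  \<open>x = y\<close> the right-hand side is that of the multiplication law in
  \<open>pairing\<close>, which so becomes a statement about convolution.\<close>

lemma conv_proj_left:
  assumes A: "is_comonoid V A dA eA" and A': "is_comonoid V A' dA' eA'" and C: "is_comonoid V C d e"
    and [simp]: "arr x" "dom x = A \<otimes> C" "arr y" "dom y = A' \<otimes> C" "arr m" "dom m = cod x \<otimes> cod y"
  shows "conv (tcomult (A \<otimes> A') (tcomult A dA A' dA') C d) m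
      (x \<cdot> (proj1 A eA' \<odot> \<i> C)) (y \<cdot> (proj2 eA A' \<odot> \<i> C)) =
    m \<cdot> (x \<odot> y) \<cdot> mid A A' C C \<cdot> (\<i> (A \<otimes> A') \<odot> d)"
proof -
  note [simp] = comonoidD(1-7)[OF A] comonoidD(1-7)[OF C] comonoidD(1-7)[OF A']
  let ?d = "tcomult A dA A' dA'" and ?p = "proj1 A eA'" and ?q = "proj2 eA A'"
  have "((?p \<odot> \<i> C) \<odot> (?q \<odot> \<i> C)) \<cdot> mid (A \<otimes> A') (A \<otimes> A') C C = mid A A' C C \<cdot> ((?p \<odot> ?q) \<odot> (\<i> C \<odot> \<i> C))"
    by (rule mid_nat[symmetric]) auto
  then have "((?p \<odot> \<i> C) \<odot> (?q \<odot> \<i> C)) \<cdot> mid (A \<otimes> A') (A \<otimes> A') C C \<cdot> (?d \<odot> d) =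
     (mid A A' C C \<cdot> ((?p \<odot> ?q) \<odot> (\<i> C \<odot> \<i> C))) \<cdot> (?d \<odot> d)" by (rule tail) auto
  also have "\<dots> = mid A A' C C \<cdot> (\<i> (A \<otimes> A') \<odot> d)" by (simp add: proj_comult[OF A A'])
  finally have 1: "((?p \<odot> \<i> C) \<odot> (?q \<odot> \<i> C)) \<cdot> mid (A \<otimes> A') (A \<otimes> A') C C \<cdot> (?d \<odot> d) =
     mid A A' C C \<cdot> (\<i> (A \<otimes> A') \<odot> d)" .
  have "conv (tcomult (A \<otimes> A') ?d C d) m (x \<cdot> (?p \<odot> \<i> C)) (y \<cdot> (?q \<odot> \<i> C)) =
     m \<cdot> (x \<odot> y) \<cdot> (((?p \<odot> \<i> C) \<odot> (?q \<odot> \<i> C)) \<cdot> mid (A \<otimes> A') (A \<otimes> A') C C \<cdot> (?d \<odot> d))"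
    by (simp add: convolution_def tensor_comult_def[of V "A \<otimes> A'"])
  then show ?thesis unfolding 1 .
qed

text \<open>The two arrows look at complementary factors of \<open>A \<otimes> A\<close> and of
  \<open>C \<otimes> C\<close>, so \<open>proj_comult\<close> eliminates the comultiplications. The
  order of the two values is then reversed by commutativity of \<open>B\<close> and
  \<open>symm_mid\<close>.\<close>

lemma convolution_commute:
  assumes A: "is_comonoid V A dA eA" and C: "is_comonoid V C d e" and B: "is_commutative_monoid V B m u"
    and [simp]: "arr f" "dom f = A \<otimes> C" "cod f = B"
  shows "conv (tcomult (A \<otimes> A) (tcomult A dA A dA) (C \<otimes> C) (tcomult C d C d)) m
      (f \<cdot> (proj2 eA A \<odot> proj1 C e)) (f \<cdot> (proj1 A eA \<odot> proj2 e C)) =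
    conv (tcomult (A \<otimes> A) (tcomult A dA A dA) (C \<otimes> C) (tcomult C d C d)) m
      (f \<cdot> (proj1 A eA \<odot> proj2 e C)) (f \<cdot> (proj2 eA A \<odot> proj1 C e))"
proof -
  have BM: "is_monoid V B m u" and Bs: "m \<cdot> \<s> B B = m" using B by (auto simp: is_commutative_monoid_def)
  note [simp] = comonoidD(1-7)[OF A] comonoidD(1-7)[OF C] monoidD(1-7)[OF BM]
  let ?dA = "tcomult A dA A dA" and ?dC = "tcomult C d C d"
  let ?D = "tcomult (A \<otimes> A) ?dA (C \<otimes> C) ?dC"
  have gen: "conv ?D m (f \<cdot> (a \<odot> c)) (f \<cdot> (a' \<odot> c')) =
      m \<cdot> (f \<odot> f) \<cdot> mid A A C C \<cdot> (((a \<odot> a') \<cdot> ?dA) \<odot> ((c \<odot> c') \<cdot> ?dC))"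
    if [simp]: "arr a" "dom a = A \<otimes> A" "cod a = A" "arr a'" "dom a' = A \<otimes> A" "cod a' = A"
      "arr c" "dom c = C \<otimes> C" "cod c = C" "arr c'" "dom c' = C \<otimes> C" "cod c' = C" for a a' c c'
  proof -
    have "((a \<odot> c) \<odot> (a' \<odot> c')) \<cdot> mid (A \<otimes> A) (A \<otimes> A) (C \<otimes> C) (C \<otimes> C) = mid A A C C \<cdot> ((a \<odot> a') \<odot> (c \<odot> c'))"
      by (rule mid_nat[symmetric]) auto
    then have 1: "((a \<odot> c) \<odot> (a' \<odot> c')) \<cdot> mid (A \<otimes> A) (A \<otimes> A) (C \<otimes> C) (C \<otimes> C) \<cdot> (?dA \<odot> ?dC) =
      (mid A A C C \<cdot> ((a \<odot> a') \<odot> (c \<odot> c'))) \<cdot> (?dA \<odot> ?dC)" by (rule tail) auto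
    have "conv ?D m (f \<cdot> (a \<odot> c)) (f \<cdot> (a' \<odot> c')) = m \<cdot> (f \<odot> f) \<cdot>
      (((a \<odot> c) \<odot> (a' \<odot> c')) \<cdot> mid (A \<otimes> A) (A \<otimes> A) (C \<otimes> C) (C \<otimes> C) \<cdot> (?dA \<odot> ?dC))"
      by (simp add: convolution_def tensor_comult_def[of V "A \<otimes> A"])
    then show ?thesis unfolding 1 by simp
  qed
  have "conv ?D m (f \<cdot> (proj2 eA A \<odot> proj1 C e)) (f \<cdot> (proj1 A eA \<odot> proj2 e C)) =
      (m \<cdot> \<s> B B) \<cdot> (f \<odot> f) \<cdot> mid A A C C \<cdot> (\<s> A A \<odot> \<i> (C \<otimes> C))"
    unfolding Bs by (subst gen) (auto simp: proj_comult[OF A A] proj_comult[OF C C])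
  also have "\<dots> = m \<cdot> (\<s> B B \<cdot> (f \<odot> f)) \<cdot> mid A A C C \<cdot> (\<s> A A \<odot> \<i> (C \<otimes> C))" by simp
  also have "\<s> B B \<cdot> (f \<odot> f) = (f \<odot> f) \<cdot> \<s> (A \<otimes> C) (A \<otimes> C)" by (rule s_nat) auto
  also have "m \<cdot> \<dots> \<cdot> mid A A C C \<cdot> (\<s> A A \<odot> \<i> (C \<otimes> C)) =
     m \<cdot> (f \<odot> f) \<cdot> (\<s> (A \<otimes> C) (A \<otimes> C) \<cdot> mid A A C C) \<cdot> (\<s> A A \<odot> \<i> (C \<otimes> C))" by simp
  also have "\<s> (A \<otimes> C) (A \<otimes> C) \<cdot> mid A A C C = mid A A C C \<cdot> (\<s> A A \<odot> \<s> C C)" by (rule symm_mid) auto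
  also have "m \<cdot> (f \<odot> f) \<cdot> \<dots> \<cdot> (\<s> A A \<odot> \<i> (C \<otimes> C)) = m \<cdot> (f \<odot> f) \<cdot> mid A A C C \<cdot> (\<i> (A \<otimes> A) \<odot> \<s> C C)"
    by simp
  also have "\<dots> = conv ?D m (f \<cdot> (proj1 A eA \<odot> proj2 e C)) (f \<cdot> (proj2 eA A \<odot> proj1 C e))"
    by (subst gen) (auto simp: proj_comult[OF A A] proj_comult[OF C C])
  finally show ?thesis .
qed

subsection \<open>Pushouts and a quotient comonoid\<close>

text \<open>Written as a square of arrows instead of a diagram over a shape, because it is applied
  to given arrows. \<open>pushout_exists\<close> connects it with \<open>is_colimit\<close>.\<close>

definition pushout :: "'m \<Rightarrow> 'm \<Rightarrow> 'm \<Rightarrow> 'm \<Rightarrow> bool" where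
  "pushout f g q i \<longleftrightarrow> arr f \<and> arr g \<and> arr q \<and> arr i \<and> dom g = dom f \<and> dom q = cod f \<and> dom i = cod g \<and>
     cod i = cod q \<and> q \<cdot> f = i \<cdot> g \<and>
     (\<forall>k k'. arr k \<and> arr k' \<and> dom k = cod f \<and> dom k' = cod g \<and> cod k' = cod k \<and> k \<cdot> f = k' \<cdot> g \<longrightarrow>
        (\<exists>!t. t \<in> Hom V (cod q) (cod k) \<and> t \<cdot> q = k \<and> t \<cdot> i = k'))"

lemma pushout_exists:
  assumes lp: "locally_presentable TYPE('u) V" and [simp]: "arr f" "arr g" "dom g = dom f"
  shows "\<exists>q i. pushout f g q i"
proof -
  \<comment> \<open>The regular cardinal \<open>lam\<close> lives on \<open>'u\<close> and is
    infinite. Hence \<open>'u\<close> has enough elements to name a span, and finite sets are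
    small.\<close>
  have inf: "infinite (UNIV :: 'u set)"
    using lp unfolding locally_presentable_def cinfinite_def by (metis finite_subset subset_UNIV)
  then obtain n :: "nat \<Rightarrow> 'u" where n: "inj n" using infinite_countable_subset by blast
  define a b c u v where "a = n 0" and "b = n 1" and "c = n 2" and "u = n 3" and "v = n 4"
  have dist: "a \<noteq> b" "a \<noteq> c" "a \<noteq> u" "a \<noteq> v" "b \<noteq> c" "b \<noteq> u" "b \<noteq> v" "c \<noteq> u" "c \<noteq> v" "u \<noteq> v"
    using injD[OF n] unfolding a_def b_def c_def u_def v_def by force+
  note [simp] = dist dist[symmetric]
  \<comment> \<open>The span shape: \<open>a\<close>, \<open>b\<close>, \<open>c\<close> are the
    objects and also their own identities, with \<open>u\<close> from \<open>a\<close> to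
    \<open>b\<close> and \<open>v\<close> from \<open>a\<close> to \<open>c\<close>. In any
    composable pair at least one factor is an identity, so \<open>cmp\<close> returns the
    other.\<close>
  define J :: "('u, 'u) category" where "J = \<lparr>objects = {a, b, c}, arrows = {a, b, c, u, v},
    source = (\<lambda>x. if x = u \<or> x = v then a else x), target = (\<lambda>x. if x = u then b else if x = v then c else x),
    idn = (\<lambda>x. x), cmp = (\<lambda>y x. if y = u \<or> y = v then y else x)\<rparr>"
  define Do where "Do = (\<lambda>x. if x = a then dom f else if x = b then cod f else cod g)"
  define Da where "Da = (\<lambda>x. if x = u then f else if x = v then g else \<i> (Do x))"
  have J [simp]: "objects J = {a, b, c}" "arrows J = {a, b, c, u, v}"
    "source J = (\<lambda>x. if x = u \<or> x = v then a else x)" "target J = (\<lambda>x. if x = u then b else if x = v then c else x)"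
    "idn J = (\<lambda>x. x)" "cmp J = (\<lambda>y x. if y = u \<or> y = v then y else x)"
    by (simp_all add: J_def)
  have "category J" by unfold_locales (auto simp: Hom_def split: if_splits)
  then have "small_category J"
    using inf by (auto simp: small_category_def small_def Field_card_of
        intro!: finite_ordLess_infinite[OF card_of_Well_order card_of_Well_order])
  moreover have "is_functor J V Do Da"
    unfolding is_functor_def by (auto simp: Do_def Da_def)
  moreover have "cocomplete TYPE('u) V" using lp by (simp add: locally_presentable_def)
  ultimately obtain L \<kappa> where L: "is_colimit V J Do Da L \<kappa>" unfolding cocomplete_def by blast
  then have cc: "is_cocone V J Do Da L \<kappa>" by (simp add: is_colimit_def)
  have \<kappa> [simp]: "arr (\<kappa> a)" "arr (\<kappa> b)" "arr (\<kappa> c)" "dom (\<kappa> a) = dom f" "dom (\<kappa> b) = cod f" "dom (\<kappa> c) = cod g"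
    "cod (\<kappa> a) = L" "cod (\<kappa> b) = L" "cod (\<kappa> c) = L" "\<kappa> b \<cdot> f = \<kappa> a" "\<kappa> c \<cdot> g = \<kappa> a"
    using cc by (auto simp: is_cocone_def Do_def Da_def)
  have "\<exists>!t. t \<in> Hom V L (cod k) \<and> t \<cdot> \<kappa> b = k \<and> t \<cdot> \<kappa> c = k'"
    if k [simp]: "arr k" "arr k'" "dom k = cod f" "dom k' = cod g" "cod k' = cod k" and e: "k \<cdot> f = k' \<cdot> g" for k k'
  proof -
    define \<nu> where "\<nu> = (\<lambda>x. if x = a then k \<cdot> f else if x = b then k else k')"
    have \<nu>: "\<nu> a = k \<cdot> f" "\<nu> b = k" "\<nu> c = k'" by (auto simp: \<nu>_def)
    have "is_cocone V J Do Da (cod k) \<nu>" by (auto simp: is_cocone_def Do_def Da_def \<nu>_def e)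
    then have "\<exists>!t. t \<in> Hom V L (cod k) \<and> (\<forall>j\<in>objects J. t \<cdot> \<kappa> j = \<nu> j)" using L by (simp only: is_colimit_def)
    \<comment> \<open>The equation at \<open>a\<close> follows from the one at \<open>b\<close>,
      which leaves only the two legs of the square.\<close>
    moreover have "(t \<in> Hom V L (cod k) \<and> (\<forall>j\<in>objects J. t \<cdot> \<kappa> j = \<nu> j)) \<longleftrightarrow>
        (t \<in> Hom V L (cod k) \<and> t \<cdot> \<kappa> b = k \<and> t \<cdot> \<kappa> c = k')" for t
    proof -
      have "t \<cdot> \<kappa> a = k \<cdot> f" if t: "arr t" "dom t = L" "t \<cdot> \<kappa> b = k"
      proof -
        have "t \<cdot> \<kappa> a = t \<cdot> (\<kappa> b \<cdot> f)" by simp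
        also have "\<dots> = (t \<cdot> \<kappa> b) \<cdot> f" by (rule assoc[symmetric]) (use t in auto)
        finally show ?thesis unfolding t(3) .
      qed
      then show ?thesis using \<nu> by auto
    qed
    ultimately show ?thesis by simp
  qed
  then have "pushout f g (\<kappa> b) (\<kappa> c)" by (auto simp: pushout_def)
  then show ?thesis by blast
qed

lemma pushout_typing:
  assumes "pushout f g q i"
  shows "arr f" "arr g" "arr q" "arr i" "dom g = dom f" "dom q = cod f" "dom i = cod g" "cod i = cod q"
    "q \<cdot> f = i \<cdot> g"
  using assms unfolding pushout_def by auto

lemma pushout_universal:
  assumes "pushout f g q i" "arr k" "arr k'" "dom k = cod f" "dom k' = cod g" "cod k' = cod k" "k \<cdot> f = k' \<cdot> g"
  shows "\<exists>!t. t \<in> Hom V (cod q) (cod k) \<and> t \<cdot> q = k \<and> t \<cdot> i = k'"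
  using assms unfolding pushout_def by blast

lemma pushout_factor:
  assumes "pushout f g q i" "arr k" "arr k'" "dom k = cod f" "dom k' = cod g" "cod k' = cod k" "k \<cdot> f = k' \<cdot> g"
  obtains t where "arr t" "dom t = cod q" "cod t = cod k" "t \<cdot> q = k" "t \<cdot> i = k'"
  using ex1_implies_ex[OF pushout_universal[OF assms]] that unfolding Hom_iff by blast

lemma pushout_jointly_epic:
  assumes P: "pushout f g q i" and t: "arr t" "arr t'" "dom t = cod q" "dom t' = cod q" "cod t' = cod t"
    and e: "t \<cdot> q = t' \<cdot> q" "t \<cdot> i = t' \<cdot> i"
  shows "t = t'"
proof -
  note p [simp] = pushout_typing[OF P]
  have "(t \<cdot> q) \<cdot> f = (t \<cdot> i) \<cdot> g" using t by simp
  from pushout_universal[OF P _ _ _ _ _ this]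
  have "\<exists>!s. s \<in> Hom V (cod q) (cod (t \<cdot> q)) \<and> s \<cdot> q = t \<cdot> q \<and> s \<cdot> i = t \<cdot> i" using t by simp
  moreover have "t \<in> Hom V (cod q) (cod (t \<cdot> q))" "t' \<in> Hom V (cod q) (cod (t \<cdot> q))" using t by simp_all
  ultimately show ?thesis using e by metis
qed

text \<open>Since \<open>X \<otimes> -\<close> is a left adjoint, it preserves pushouts.\<close>

lemma pushout_tensor_jointly_epic:
  assumes P: "pushout f g q i" and [simp]: "ob X" and t [simp]: "arr t" "arr t'" "dom t = X \<otimes> cod q" "dom t' = X \<otimes> cod q" "cod t = Y" "cod t' = Y"
    and e: "t \<cdot> (\<i> X \<odot> q) = t' \<cdot> (\<i> X \<odot> q)" "t \<cdot> (\<i> X \<odot> i) = t' \<cdot> (\<i> X \<odot> i)"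
  shows "t = t'"
proof -
  note p [simp] = pushout_typing[OF P]
  let ?Q = "cod q"
  have obY [simp]: "ob Y" using t ob_cod by metis
  \<comment> \<open>The internal hom makes \<open>- \<otimes> X\<close> a left adjoint, so an arrow
    out of \<open>X \<otimes> ?Q\<close> is transposed after a symmetry.\<close>
  let ?T = "\<lambda>t. transpose V ?Q X Y (t \<cdot> \<s> ?Q X)"
  have T: "arr (?T t)" "dom (?T t) = ?Q" "cod (?T t) = \<lbrakk>X, Y\<rbrakk>" "\<e> X Y \<cdot> (?T t \<odot> \<i> X) = t \<cdot> \<s> ?Q X"
    if "arr t" "dom t = X \<otimes> ?Q" "cod t = Y" for t
    by (rule transpose_props; simp add: that)+
  have r: "?T t \<cdot> m = ?T t' \<cdot> m" if [simp]: "arr m" "cod m = ?Q" and m: "t \<cdot> (\<i> X \<odot> m) = t' \<cdot> (\<i> X \<odot> m)" for m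
  proof (rule ev_inject[of X Y])
    have c: "\<e> X Y \<cdot> ((?T t \<cdot> m) \<odot> \<i> X) = (t \<cdot> (\<i> X \<odot> m)) \<cdot> \<s> (dom m) X"
      if [simp]: "arr t" "dom t = X \<otimes> ?Q" "cod t = Y" for t
    proof -
      note [simp] = T(1-3)[OF that]
      have "\<e> X Y \<cdot> ((?T t \<cdot> m) \<odot> \<i> X) = (\<e> X Y \<cdot> (?T t \<odot> \<i> X)) \<cdot> (m \<odot> \<i> X)" by simp
      also have "\<dots> = t \<cdot> (\<s> ?Q X \<cdot> (m \<odot> \<i> X))" unfolding T(4)[OF that] by simp
      also have "\<s> ?Q X \<cdot> (m \<odot> \<i> X) = (\<i> X \<odot> m) \<cdot> \<s> (dom m) X" by (rule s_nat) auto
      finally show ?thesis by simp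
    qed
    show "\<e> X Y \<cdot> ((?T t \<cdot> m) \<odot> \<i> X) = \<e> X Y \<cdot> ((?T t' \<cdot> m) \<odot> \<i> X)"
      by (simp only: c t m)
  qed (use T(1-3)[of t] T(1-3)[of t'] in auto)
  have "?T t = ?T t'"
    by (rule pushout_jointly_epic[OF P]) (use T(1-3)[of t] T(1-3)[of t'] r[of q] r[of i] e in auto)
  then have "t \<cdot> \<s> ?Q X = t' \<cdot> \<s> ?Q X" using T(4)[OF t(1,3,5)] T(4)[OF t(2,4,6)] by metis
  then show ?thesis by (rule iso_epi[of _ _ _ "\<s> X ?Q" "X \<otimes> ?Q"]) auto
qed

text \<open>The existence half of preservation: the transposes of \<open>k\<close> and
  \<open>k'\<close> form a cocone, and evaluating their factorization \<open>u\<close> gives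
  \<open>?t\<close>.\<close>

lemma pushout_tensor_factor:
  assumes P: "pushout f g q i" and [simp]: "ob X" and k [simp]: "arr k" "arr k'" "dom k = X \<otimes> cod f" "dom k' = X \<otimes> cod g"
      "cod k = Y" "cod k' = Y"
    and e: "k \<cdot> (\<i> X \<odot> f) = k' \<cdot> (\<i> X \<odot> g)"
  obtains t where "arr t" "dom t = X \<otimes> cod q" "cod t = Y" "t \<cdot> (\<i> X \<odot> q) = k" "t \<cdot> (\<i> X \<odot> i) = k'"
proof -
  note p [simp] = pushout_typing[OF P]
  have obY [simp]: "ob Y" using k ob_cod by metis
  let ?T = "\<lambda>Z k. transpose V Z X Y (k \<cdot> \<s> Z X)"
  have T: "arr (?T Z k)" "dom (?T Z k) = Z" "cod (?T Z k) = \<lbrakk>X, Y\<rbrakk>" "\<e> X Y \<cdot> (?T Z k \<odot> \<i> X) = k \<cdot> \<s> Z X"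
    if "arr k" "dom k = X \<otimes> Z" "cod k = Y" "ob Z" for k Z
    by (rule transpose_props; simp add: that)+
  note [simp] = T(1-3)
  have c: "\<e> X Y \<cdot> ((?T (cod h) k \<cdot> h) \<odot> \<i> X) = (k \<cdot> (\<i> X \<odot> h)) \<cdot> \<s> (dom h) X"
    if [simp]: "arr k" "dom k = X \<otimes> cod h" "cod k = Y" "arr h" for k h
  proof -
    have "\<e> X Y \<cdot> ((?T (cod h) k \<cdot> h) \<odot> \<i> X) = (\<e> X Y \<cdot> (?T (cod h) k \<odot> \<i> X)) \<cdot> (h \<odot> \<i> X)" by simp
    also have "\<dots> = k \<cdot> (\<s> (cod h) X \<cdot> (h \<odot> \<i> X))" by (subst T(4)) auto
    also have "\<s> (cod h) X \<cdot> (h \<odot> \<i> X) = (\<i> X \<odot> h) \<cdot> \<s> (dom h) X" by (rule s_nat) auto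
    finally show ?thesis by simp
  qed
  have eq: "?T (cod f) k \<cdot> f = ?T (cod g) k' \<cdot> g"
    by (rule ev_inject[of X Y]) (auto simp: c e)
  obtain u where u [simp]: "arr u" "dom u = cod q" "cod u = \<lbrakk>X, Y\<rbrakk>" and uq: "u \<cdot> q = ?T (cod f) k" "u \<cdot> i = ?T (cod g) k'"
    by (rule pushout_factor[OF P _ _ _ _ _ eq]) auto
  let ?t = "\<e> X Y \<cdot> (u \<odot> \<i> X) \<cdot> \<s> X (cod q)"
  have f: "?t \<cdot> (\<i> X \<odot> m) = \<e> X Y \<cdot> ((u \<cdot> m) \<odot> \<i> X) \<cdot> \<s> X (dom m)" if [simp]: "arr m" "cod m = cod q" for m
  proof -
    have "?t \<cdot> (\<i> X \<odot> m) = \<e> X Y \<cdot> (u \<odot> \<i> X) \<cdot> (\<s> X (cod q) \<cdot> (\<i> X \<odot> m))" by simp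
    also have "\<s> X (cod q) \<cdot> (\<i> X \<odot> m) = (m \<odot> \<i> X) \<cdot> \<s> X (dom m)" by (rule s_nat) auto
    finally show ?thesis by simp
  qed
  have r: "\<e> X Y \<cdot> (?T Z k \<odot> \<i> X) \<cdot> \<s> X Z = k" if [simp]: "arr k" "dom k = X \<otimes> Z" "cod k = Y" "ob Z" for k Z
  proof -
    have "\<e> X Y \<cdot> (?T Z k \<odot> \<i> X) \<cdot> \<s> X Z = (k \<cdot> \<s> Z X) \<cdot> \<s> X Z" by (rule tail[OF T(4)]) auto
    then show ?thesis by simp
  qed
  show ?thesis
  proof (rule that[of ?t])
    show "?t \<cdot> (\<i> X \<odot> q) = k" "?t \<cdot> (\<i> X \<odot> i) = k'"
      by (subst f; simp add: uq r)+
  qed auto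
qed

section \<open>The quotient comonoid\<close>

lemma comonoid_axioms_along:
  assumes C: "is_comonoid V C d e" and [simp]: "arr f" "dom f = C" "cod f = Q" "arr dQ" "dom dQ = Q" "cod dQ = Q \<otimes> Q"
    "arr eQ" "dom eQ = Q" "cod eQ = \<I>" and d: "dQ \<cdot> f = (f \<odot> f) \<cdot> d" and e: "eQ \<cdot> f = e"
  shows "(\<a> Q Q Q \<cdot> (dQ \<odot> \<i> Q) \<cdot> dQ) \<cdot> f = ((\<i> Q \<odot> dQ) \<cdot> dQ) \<cdot> f"
    "(\<l> Q \<cdot> (eQ \<odot> \<i> Q) \<cdot> dQ) \<cdot> f = f" "(\<r> Q \<cdot> (\<i> Q \<odot> eQ) \<cdot> dQ) \<cdot> f = f"
proof -
  note [simp] = comonoidD(1-7)[OF C]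
  have [simp]: "ob Q" using ob_cod[of f] by simp
  have "(\<a> Q Q Q \<cdot> (dQ \<odot> \<i> Q) \<cdot> dQ) \<cdot> f = (\<a> Q Q Q \<cdot> ((f \<odot> f) \<odot> f)) \<cdot> (d \<odot> \<i> C) \<cdot> d"
    by (simp add: d)
  also have "\<a> Q Q Q \<cdot> ((f \<odot> f) \<odot> f) = (f \<odot> (f \<odot> f)) \<cdot> \<a> C C C" by (rule assoc_nat) auto
  also have "\<dots> \<cdot> (d \<odot> \<i> C) \<cdot> d = (f \<odot> (f \<odot> f)) \<cdot> (\<i> C \<odot> d) \<cdot> d"
    unfolding comonoidD(8)[OF C, symmetric] by simp
  also have "\<dots> = ((\<i> Q \<odot> dQ) \<cdot> dQ) \<cdot> f" by (simp add: d)
  finally show "(\<a> Q Q Q \<cdot> (dQ \<odot> \<i> Q) \<cdot> dQ) \<cdot> f = ((\<i> Q \<odot> dQ) \<cdot> dQ) \<cdot> f" .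
  have "(\<l> Q \<cdot> (eQ \<odot> \<i> Q) \<cdot> dQ) \<cdot> f = \<l> Q \<cdot> (\<i> \<I> \<odot> f) \<cdot> (e \<odot> \<i> C) \<cdot> d"
    by (simp add: d e)
  also have "\<dots> = f \<cdot> \<l> C \<cdot> (e \<odot> \<i> C) \<cdot> d" by (rule left_nat_tail) auto
  finally show "(\<l> Q \<cdot> (eQ \<odot> \<i> Q) \<cdot> dQ) \<cdot> f = f" unfolding comonoidD(9)[OF C] by simp
  have "(\<r> Q \<cdot> (\<i> Q \<odot> eQ) \<cdot> dQ) \<cdot> f = \<r> Q \<cdot> (f \<odot> \<i> \<I>) \<cdot> (\<i> C \<odot> e) \<cdot> d"
    by (simp add: d e)
  also have "\<dots> = f \<cdot> \<r> C \<cdot> (\<i> C \<odot> e) \<cdot> d" by (rule right_nat_tail) auto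
  finally show "(\<r> Q \<cdot> (\<i> Q \<odot> eQ) \<cdot> dQ) \<cdot> f = f" unfolding comonoidD(10)[OF C] by simp
qed

lemma comult_counit_counit:
  assumes C: "is_comonoid V C d e"
  shows "(e \<odot> e) \<cdot> d = \<l>\<^sup>- \<I> \<cdot> e" "tcounit e e \<cdot> d = e"
proof -
  note [simp] = comonoidD(1-7)[OF C]
  show 1: "(e \<odot> e) \<cdot> d = \<l>\<^sup>- \<I> \<cdot> e"
    using comonoid_hom_counit[OF C] by (simp add: comonoid_hom_iff unit_comult_def)
  show "tcounit e e \<cdot> d = e" by (simp add: tensor_counit_def 1)
qed

text \<open>In Sweedler notation, \<open>x\<^sub>1 \<otimes> x\<^sub>2\<close> in \<open>C \<otimes> C\<^sup>c\<^sup>o\<^sup>p\<close> has coproduct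
  \<open>(x\<^sub>1 \<otimes> x\<^sub>4) \<otimes> (x\<^sub>2 \<otimes> x\<^sub>3)\<close>, whose second factor is again of this form.\<close>

lemma comult_on_comult:
  assumes C: "is_comonoid V C d e"
  shows "tcomult C d C (op C d) \<cdot> d = (\<i> (C \<otimes> C) \<odot> d) \<cdot> \<a>\<^sup>- C C C \<cdot> (\<i> C \<odot> op C d) \<cdot> d"
proof -
  note [simp] = comonoidD(1-7)[OF C]
  have co: "\<a>\<^sup>- C C C \<cdot> (\<i> C \<odot> d) \<cdot> d = (d \<odot> \<i> C) \<cdot> d"
    unfolding comonoidD(8)[OF C, symmetric] by simp
  have "tcomult C d C (op C d) \<cdot> d =
      \<a>\<^sup>- C C (C \<otimes> C) \<cdot> (\<i> C \<odot> sw C C C) \<cdot> (\<a> C C (C \<otimes> C) \<cdot> ((\<i> C \<odot> \<i> C) \<odot> op C d)) \<cdot> (d \<odot> \<i> C) \<cdot> d"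
    by (simp add: tensor_comult_def mid_sw)
  also have "\<a> C C (C \<otimes> C) \<cdot> ((\<i> C \<odot> \<i> C) \<odot> op C d) = (\<i> C \<odot> (\<i> C \<odot> op C d)) \<cdot> \<a> C C C"
    by (rule assoc_nat) auto
  also have "\<a>\<^sup>- C C (C \<otimes> C) \<cdot> (\<i> C \<odot> sw C C C) \<cdot> \<dots> \<cdot> (d \<odot> \<i> C) \<cdot> d =
      \<a>\<^sup>- C C (C \<otimes> C) \<cdot> (\<i> C \<odot> ((sw C C C \<cdot> (\<i> C \<odot> \<s> C C)) \<cdot> (\<i> C \<odot> d))) \<cdot> (\<a> C C C \<cdot> (d \<odot> \<i> C) \<cdot> d)"
    by simp
  also have "\<dots> = \<a>\<^sup>- C C (C \<otimes> C) \<cdot> (\<i> C \<odot> (\<s> (C \<otimes> C) C \<cdot> (\<a>\<^sup>- C C C \<cdot> (\<i> C \<odot> d) \<cdot> d))) \<cdot> d"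
    unfolding comonoidD(8)[OF C] by (subst hexagon_inv[symmetric]) auto
  also have "\<dots> = \<a>\<^sup>- C C (C \<otimes> C) \<cdot> (\<i> C \<odot> ((\<s> (C \<otimes> C) C \<cdot> (d \<odot> \<i> C)) \<cdot> d)) \<cdot> d"
    unfolding co by simp
  also have "\<s> (C \<otimes> C) C \<cdot> (d \<odot> \<i> C) = (\<i> C \<odot> d) \<cdot> \<s> C C" by (rule s_nat) auto
  also have "\<a>\<^sup>- C C (C \<otimes> C) \<cdot> (\<i> C \<odot> (\<dots> \<cdot> d)) \<cdot> d =
      (\<a>\<^sup>- C C (C \<otimes> C) \<cdot> (\<i> C \<odot> (\<i> C \<odot> d))) \<cdot> (\<i> C \<odot> op C d) \<cdot> d" by simp
  also have "\<a>\<^sup>- C C (C \<otimes> C) \<cdot> (\<i> C \<odot> (\<i> C \<odot> d)) = ((\<i> C \<odot> \<i> C) \<odot> d) \<cdot> \<a>\<^sup>- C C C"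
    by (rule inv_assoc_nat) auto
  finally show ?thesis by simp
qed

text \<open>The coproduct descends because, by \<open>comult_on_comult\<close>, the second factor of
  the coproduct of an element in the image of \<open>d\<close> lies in that image again, where
  \<open>q\<close> replaces it by \<open>i \<cdot> e\<close>. The counit law then leaves
  \<open>q \<cdot> d = i \<cdot> e\<close> in the first factor as well.\<close>

lemma quotient_comonoid:
  assumes C: "is_comonoid V C d e" and P: "pushout d e q i"
  obtains dQ eQ where "is_comonoid V (cod q) dQ eQ"
    "q \<in> comonoid_homs V (C \<otimes> C) (tcomult C d C (op C d)) (tcounit e e) (cod q) dQ eQ"
    "i \<in> comonoid_homs V \<I> (unit_comult V) (unit_counit V) (cod q) dQ eQ"
proof -
  note [simp] = comonoidD(1-7)[OF C]
  have p [simp]: "arr q" "arr i" "dom q = C \<otimes> C" "dom i = \<I>" "cod i = cod q" "q \<cdot> d = i \<cdot> e"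
    using pushout_typing[OF P] by auto
  let ?Q = "cod q" and ?d = "tcomult C d C (op C d)" and ?e = "tcounit e e"
  \<comment> \<open>The counit law of the co-opposite, solved for the inverse unitor. It absorbs the
    second factor once that has become a counit.\<close>
  have cu: "(\<i> C \<odot> e) \<cdot> op C d = \<r>\<^sup>- C"
    by (rule iso_mono[of "\<r> C" _ _ "\<r>\<^sup>- C"]) (use comonoidD(10)[OF comonoid_cop[OF C]] in auto)
  have tr: "\<a>\<^sup>- C C \<I> \<cdot> (\<i> C \<odot> \<r>\<^sup>- C) = \<r>\<^sup>- (C \<otimes> C)"
  proof (rule iso_mono[of "\<r> (C \<otimes> C)" _ _ "\<r>\<^sup>- (C \<otimes> C)"])
    have "\<r> (C \<otimes> C) \<cdot> \<a>\<^sup>- C C \<I> \<cdot> (\<i> C \<odot> \<r>\<^sup>- C) = ((\<i> C \<odot> \<r> C) \<cdot> \<a> C C \<I>) \<cdot> \<a>\<^sup>- C C \<I> \<cdot> (\<i> C \<odot> \<r>\<^sup>- C)"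
      by (subst triangle_right) auto
    then show "\<r> (C \<otimes> C) \<cdot> \<a>\<^sup>- C C \<I> \<cdot> (\<i> C \<odot> \<r>\<^sup>- C) = \<r> (C \<otimes> C) \<cdot> \<r>\<^sup>- (C \<otimes> C)" by simp
  qed auto
  have runit: "\<r>\<^sup>- \<I> = \<l>\<^sup>- \<I>" by (simp only: unitors_unit)
  \<comment> \<open>The cocone condition for \<open>dQ\<close>. The relation
    \<open>q \<cdot> d = i \<cdot> e\<close> is used twice, first in the right tensor factor and
    then in the left.\<close>
  have "((q \<odot> q) \<cdot> ?d) \<cdot> d = (q \<odot> (q \<cdot> d)) \<cdot> \<a>\<^sup>- C C C \<cdot> (\<i> C \<odot> op C d) \<cdot> d"
    by (simp add: comult_on_comult[OF C])
  also have "\<dots> = (q \<odot> i) \<cdot> (((\<i> C \<odot> \<i> C) \<odot> e) \<cdot> \<a>\<^sup>- C C C) \<cdot> (\<i> C \<odot> op C d) \<cdot> d" by simp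
  also have "((\<i> C \<odot> \<i> C) \<odot> e) \<cdot> \<a>\<^sup>- C C C = \<a>\<^sup>- C C \<I> \<cdot> (\<i> C \<odot> (\<i> C \<odot> e))"
    by (rule inv_assoc_nat[symmetric]) auto
  also have "(q \<odot> i) \<cdot> \<dots> \<cdot> (\<i> C \<odot> op C d) \<cdot> d = (q \<odot> i) \<cdot> \<a>\<^sup>- C C \<I> \<cdot> (\<i> C \<odot> ((\<i> C \<odot> e) \<cdot> op C d)) \<cdot> d"
    by simp
  also have "\<dots> = (q \<odot> i) \<cdot> (\<a>\<^sup>- C C \<I> \<cdot> (\<i> C \<odot> \<r>\<^sup>- C)) \<cdot> d" unfolding cu by simp
  also have "\<dots> = (\<i> ?Q \<odot> i) \<cdot> ((q \<odot> \<i> \<I>) \<cdot> \<r>\<^sup>- (C \<otimes> C)) \<cdot> d" unfolding tr by simp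
  also have "(q \<odot> \<i> \<I>) \<cdot> \<r>\<^sup>- (C \<otimes> C) = \<r>\<^sup>- ?Q \<cdot> q" by (rule inv_right_nat[symmetric]) auto
  also have "(\<i> ?Q \<odot> i) \<cdot> \<dots> \<cdot> d = (\<i> ?Q \<odot> i) \<cdot> (\<r>\<^sup>- ?Q \<cdot> i) \<cdot> e" by simp
  also have "\<r>\<^sup>- ?Q \<cdot> i = (i \<odot> \<i> \<I>) \<cdot> \<r>\<^sup>- \<I>" by (rule inv_right_nat) auto
  also have "(\<i> ?Q \<odot> i) \<cdot> \<dots> \<cdot> e = ((i \<odot> i) \<cdot> \<l>\<^sup>- \<I>) \<cdot> e" unfolding runit by simp
  finally have eq: "((q \<odot> q) \<cdot> ?d) \<cdot> d = ((i \<odot> i) \<cdot> \<l>\<^sup>- \<I>) \<cdot> e" .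
  obtain dQ where dQ [simp]: "arr dQ" "dom dQ = ?Q" "cod dQ = ?Q \<otimes> ?Q" and dQ': "dQ \<cdot> q = (q \<odot> q) \<cdot> ?d" "dQ \<cdot> i = (i \<odot> i) \<cdot> \<l>\<^sup>- \<I>"
    by (rule pushout_factor[OF P _ _ _ _ _ eq]) auto
  have eq': "?e \<cdot> d = \<i> \<I> \<cdot> e" using comult_counit_counit(2)[OF C] by simp
  obtain eQ where eQ [simp]: "arr eQ" "dom eQ = ?Q" "cod eQ = \<I>" and eQ': "eQ \<cdot> q = ?e" "eQ \<cdot> i = \<i> \<I>"
    by (rule pushout_factor[OF P _ _ _ _ _ eq']) auto
  have q: "q \<in> comonoid_homs V (C \<otimes> C) ?d ?e ?Q dQ eQ" using dQ' eQ' by (simp add: comonoid_hom_iff)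
  have i: "i \<in> comonoid_homs V \<I> (unit_comult V) (unit_counit V) ?Q dQ eQ"
    using dQ' eQ' by (simp add: comonoid_hom_iff unit_comult_def unit_counit_def)
  \<comment> \<open>Both \<open>q\<close> and \<open>i\<close> respect the new structure, so each
    axiom holds after composition with either. As they are jointly epic, it holds on
    \<open>?Q\<close>.\<close>
  note lq = comonoid_axioms_along[OF comonoid_tensor[OF C comonoid_cop[OF C]] p(1,3) refl dQ eQ dQ'(1) eQ'(1)]
  have i': "dQ \<cdot> i = (i \<odot> i) \<cdot> unit_comult V" "eQ \<cdot> i = unit_counit V" using i by (auto simp: comonoid_hom_iff)
  note li = comonoid_axioms_along[OF comonoid_unit p(2,4,5) dQ eQ i']
  have "is_comonoid V ?Q dQ eQ" unfolding is_comonoid_def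
  proof (intro conjI)
    show "\<a> ?Q ?Q ?Q \<cdot> (dQ \<odot> \<i> ?Q) \<cdot> dQ = (\<i> ?Q \<odot> dQ) \<cdot> dQ"
      by (rule pushout_jointly_epic[OF P]) (use lq li in auto)
    show "\<l> ?Q \<cdot> (eQ \<odot> \<i> ?Q) \<cdot> dQ = \<i> ?Q"
      by (rule pushout_jointly_epic[OF P]) (use lq li in auto)
    show "\<r> ?Q \<cdot> (\<i> ?Q \<odot> eQ) \<cdot> dQ = \<i> ?Q"
      by (rule pushout_jointly_epic[OF P]) (use lq li in auto)
  qed auto
  then show ?thesis using that q i by blast
qed

end

subsection \<open>The bimonoid structure\<close>

locale measuring_comonoid = symmetric_monoidal_closed_category V
  for V :: "('o, 'm) smcc" (structure) +
  fixes A :: 'o and mA uA :: 'm and B :: 'o and mB uB :: 'm and P :: 'o and dP eP :: 'm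
    and \<phi> :: "'o \<Rightarrow> 'm \<Rightarrow> 'm \<Rightarrow> 'm \<Rightarrow> 'm"
  assumes monoid_A: "is_monoid V A mA uA"
    and commutative_B: "is_commutative_monoid V B mB uB"
    and universal: "is_universal_measuring_comonoid V A mA uA B mB uB P dP eP \<phi>"
begin

lemma monoid_B: "is_monoid V B mB uB" and mB_symm: "mB \<cdot> \<s> B B = mB"
  using commutative_B by (auto simp: is_commutative_monoid_def)

lemma comonoid_P: "is_comonoid V P dP eP"
  using universal by (simp add: is_universal_measuring_comonoid_def)

lemmas [simp] = monoidD(1-7)[OF monoid_A] monoidD(1-7)[OF monoid_B] comonoidD(1-7)[OF comonoid_P]

abbreviation pair :: "'o \<Rightarrow> 'm \<Rightarrow> 'm \<Rightarrow> 'm \<Rightarrow> bool" where "pair \<equiv> pairing A mA uA B mB uB"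
abbreviation chom :: "'o \<Rightarrow> 'm \<Rightarrow> 'm \<Rightarrow> 'm set" where "chom C d e \<equiv> comonoid_homs V C d e P dP eP"
abbreviation \<eta> :: 'm where "\<eta> \<equiv> universal_measuring V A mA uA B mB uB P dP eP \<phi>"

definition \<epsilon> :: 'm where "\<epsilon> = \<e> P B \<cdot> (\<eta> \<odot> \<i> P)"

section \<open>Representability in terms of pairings\<close>

lemma \<phi>_bij: "is_comonoid V C d e \<Longrightarrow>
    bij_betw (\<phi> C d e) (measurings V A mA uA B mB uB C d e) (chom C d e)"
  using universal by (simp add: is_universal_measuring_comonoid_def)

lemma \<phi>_nat:
  "is_comonoid V C d e \<Longrightarrow> is_comonoid V C' d' e' \<Longrightarrow> h \<in> comonoid_homs V C' d' e' C d e \<Longrightarrow>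
    f \<in> measurings V A mA uA B mB uB C d e \<Longrightarrow> \<phi> C' d' e' (ihom_map V h (\<i> B) \<cdot> f) = \<phi> C d e f \<cdot> h"
  using universal unfolding is_universal_measuring_comonoid_def by blast

lemma \<eta>_measuring: "\<eta> \<in> measurings V A mA uA B mB uB P dP eP" and \<phi>_\<eta>: "\<phi> P dP eP \<eta> = \<i> P"
proof -
  note b = \<phi>_bij[OF comonoid_P]
  have i: "\<i> P \<in> \<phi> P dP eP ` measurings V A mA uA B mB uB P dP eP"
    using b comonoid_hom_id[OF comonoid_P] by (simp add: bij_betw_def)
  show "\<eta> \<in> measurings V A mA uA B mB uB P dP eP"
    unfolding universal_measuring_def by (rule the_inv_into_into[OF bij_betw_imp_inj_on[OF b] i]) simp
  show "\<phi> P dP eP \<eta> = \<i> P"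
    unfolding universal_measuring_def by (rule f_the_inv_into_f[OF bij_betw_imp_inj_on[OF b] i])
qed

lemma \<eta>_typing [simp]: "arr \<eta>" "dom \<eta> = A" "cod \<eta> = \<lbrakk>P, B\<rbrakk>"
  using \<eta>_measuring by (auto simp: measurings_def monoid_homs_def)

lemma \<epsilon>_typing [simp]: "arr \<epsilon>" "dom \<epsilon> = A \<otimes> P" "cod \<epsilon> = B"
  by (auto simp: \<epsilon>_def)

lemma \<epsilon>_pairing: "pair P dP eP \<epsilon>"
  unfolding \<epsilon>_def using \<eta>_measuring by (subst measuring_iff_pairing[symmetric, OF monoid_A monoid_B comonoid_P]) auto

text \<open>Links the naturality of \<open>\<phi>\<close>, formulated with \<open>ihom_map\<close>,
  to composition with \<open>\<epsilon>\<close>.\<close>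

lemma ev_ihom_map_\<eta>:
  assumes [simp]: "arr h" "dom h = C" "cod h = P"
  shows "arr (ihom_map V h (\<i> B) \<cdot> \<eta>)" "dom (ihom_map V h (\<i> B) \<cdot> \<eta>) = A" "cod (ihom_map V h (\<i> B) \<cdot> \<eta>) = \<lbrakk>C, B\<rbrakk>"
    "\<e> C B \<cdot> ((ihom_map V h (\<i> B) \<cdot> \<eta>) \<odot> \<i> C) = \<epsilon> \<cdot> (\<i> A \<odot> h)"
proof -
  have [simp]: "ob C" using assms ob_dom by blast
  note [simp] = ihom_map_props(1-3)
  show "arr (ihom_map V h (\<i> B) \<cdot> \<eta>)" "dom (ihom_map V h (\<i> B) \<cdot> \<eta>) = A" "cod (ihom_map V h (\<i> B) \<cdot> \<eta>) = \<lbrakk>C, B\<rbrakk>"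
    by simp_all
  have "\<e> C B \<cdot> ((ihom_map V h (\<i> B) \<cdot> \<eta>) \<odot> \<i> C) = (\<e> C B \<cdot> (ihom_map V h (\<i> B) \<odot> \<i> C)) \<cdot> (\<eta> \<odot> \<i> C)" by simp
  also have "\<dots> = (\<e> P B \<cdot> (\<i> \<lbrakk>P, B\<rbrakk> \<odot> h)) \<cdot> (\<eta> \<odot> \<i> C)"
    using ihom_map_props(4)[of h "\<i> B"] by simp
  also have "\<dots> = \<epsilon> \<cdot> (\<i> A \<odot> h)" by (simp add: \<epsilon>_def)
  finally show "\<e> C B \<cdot> ((ihom_map V h (\<i> B) \<cdot> \<eta>) \<odot> \<i> C) = \<epsilon> \<cdot> (\<i> A \<odot> h)" .
qed

text \<open>The Yoneda argument: by naturality \<open>\<phi>\<close> sends the restriction of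
  \<open>\<eta>\<close> along \<open>?h\<close> to \<open>?h\<close> itself, and injectivity of
  \<open>\<phi>\<close> identifies this restriction with the measuring that defined
  \<open>?h\<close>.\<close>

lemma classifying:
  assumes C: "is_comonoid V C d e" and f: "pair C d e f"
  shows "\<phi> C d e (transpose V A C B f) \<in> chom C d e"
    "\<epsilon> \<cdot> (\<i> A \<odot> \<phi> C d e (transpose V A C B f)) = f"
proof -
  let ?g = "transpose V A C B f"
  let ?h = "\<phi> C d e ?g"
  note [simp] = comonoidD(1-7)[OF C]
  have [simp]: "arr f" "dom f = A \<otimes> C" "cod f = B" using f by (auto simp: pairing_def)
  have g: "?g \<in> measurings V A mA uA B mB uB C d e" by (rule transpose_measuring[OF monoid_A monoid_B C f])
  then show h: "?h \<in> chom C d e" using \<phi>_bij[OF C] by (auto simp: bij_betw_def)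
  then have [simp]: "arr ?h" "dom ?h = C" "cod ?h = P" by (auto simp: comonoid_hom_iff)
  let ?k = "ihom_map V ?h (\<i> B) \<cdot> \<eta>"
  note k = ev_ihom_map_\<eta>[of ?h C, simplified]
  have "?k \<in> measurings V A mA uA B mB uB C d e"
    using measuring_iff_pairing[OF monoid_A monoid_B C, of ?k] k
      pairing_comonoid_hom[OF monoid_A monoid_B comonoid_P C \<epsilon>_pairing h] by simp
  moreover have "\<phi> C d e ?k = ?h"
    using \<phi>_nat[OF comonoid_P C h \<eta>_measuring] by (simp add: \<phi>_\<eta>)
  ultimately have "?k = ?g"
    using g bij_betw_imp_inj_on[OF \<phi>_bij[OF C]] by (metis inj_onD)
  then show "\<epsilon> \<cdot> (\<i> A \<odot> ?h) = f"
    using k(4) transpose_props(4)[of f A C B] by simp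
qed

text \<open>A comonoid morphism is \<open>\<phi>\<close> of the restriction of \<open>\<eta>\<close>
  along it, and the restriction is determined by its transpose. The monoid laws of \<open>P\<close>
  and the factorizations through \<open>Q\<close> are proved in this way.\<close>

lemma classifying_unique:
  assumes C: "is_comonoid V C d e" and h: "h \<in> chom C d e" "h' \<in> chom C d e"
    and eq: "\<epsilon> \<cdot> (\<i> A \<odot> h) = \<epsilon> \<cdot> (\<i> A \<odot> h')"
  shows "h = h'"
proof -
  note [simp] = comonoidD(1-7)[OF C]
  have t: "arr h" "dom h = C" "cod h = P" "arr h'" "dom h' = C" "cod h' = P"
    using h by (auto simp: comonoid_hom_iff)
  have "ihom_map V h (\<i> B) \<cdot> \<eta> = ihom_map V h' (\<i> B) \<cdot> \<eta>"
    by (rule ev_inject[of C B]) (use ev_ihom_map_\<eta>[OF t(1-3)] ev_ihom_map_\<eta>[OF t(4-6)] eq in auto)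
  moreover have "\<phi> C d e (ihom_map V h (\<i> B) \<cdot> \<eta>) = h"
    unfolding \<phi>_nat[OF comonoid_P C h(1) \<eta>_measuring] \<phi>_\<eta> using t by simp
  moreover have "\<phi> C d e (ihom_map V h' (\<i> B) \<cdot> \<eta>) = h'"
    unfolding \<phi>_nat[OF comonoid_P C h(2) \<eta>_measuring] \<phi>_\<eta> using t by simp
  ultimately show ?thesis by metis
qed

end

locale measuring_bimonoid = measuring_comonoid V A mA uA B mB uB P dP eP \<phi>
  for V :: "('o, 'm) smcc" (structure) and A mA uA B mB uB P dP eP \<phi> +
  fixes dA eA :: 'm
  assumes bimonoid_A: "is_bimonoid V A mA uA dA eA"
begin

lemma comonoid_A: "is_comonoid V A dA eA"
  using bimonoid_A by (simp add: is_bimonoid_def)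

lemma mA_comonoid_hom: "mA \<in> comonoid_homs V (A \<otimes> A) (tcomult A dA A dA) (tcounit eA eA) A dA eA"
  and uA_comonoid_hom: "uA \<in> comonoid_homs V \<I> (unit_comult V) (unit_counit V) A dA eA"
  using bimonoid_A by (auto simp: is_bimonoid_def)

lemmas [simp] = comonoidD(2-7)[OF comonoid_A]

abbreviation \<mu> :: 'm where "\<mu> \<equiv> measuring_mult V A mA uA dA B mB uB P dP eP \<phi>"
abbreviation \<upsilon> :: 'm where "\<upsilon> \<equiv> measuring_unit V eA B uB \<phi>"

section \<open>The unit of \<open>P\<close>\<close>

lemma unit_unit_conv:
  assumes "is_comonoid V C d e"
  shows "conv d mB (uB \<cdot> e) (uB \<cdot> e) = uB \<cdot> e"
  by (rule conv_unit[OF assms monoid_B]) (use comonoidD(1-7)[OF assms] in auto)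

lemma comonoid_hom_tensor_idn:
  assumes "f \<in> comonoid_homs V X dX eX Y dY eY" "is_comonoid V X dX eX" "is_comonoid V Y dY eY" "is_comonoid V C d e"
  shows "f \<odot> \<i> C \<in> comonoid_homs V (X \<otimes> C) (tcomult X dX C d) (tcounit eX e) (Y \<otimes> C) (tcomult Y dY C d) (tcounit eY e)"
    "\<i> C \<odot> f \<in> comonoid_homs V (C \<otimes> X) (tcomult C d X dX) (tcounit e eX) (C \<otimes> Y) (tcomult C d Y dY) (tcounit e eY)"
  using assms comonoid_hom_tensor comonoid_hom_id by blast+

text \<open>The convolution unit on \<open>A \<otimes> C\<close> is a pairing: \<open>mA\<close> and
  both projections of \<open>A \<otimes> A\<close> preserve counits, so all values involved become
  one convolution unit, which squares to itself.\<close>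

lemma unit_pairing:
  assumes C: "is_comonoid V C d e"
  shows "pair C d e (uB \<cdot> tcounit eA e)"
proof -
  note [simp] = comonoidD(1-7)[OF C]
  note AA = comonoid_tensor[OF comonoid_A comonoid_A]
  let ?f = "uB \<cdot> tcounit eA e"
  let ?D = "tcomult (A \<otimes> A) (tcomult A dA A dA) C d" and ?e = "tcounit (tcounit eA eA) e"
  have h: "tcounit eA e \<cdot> (f \<odot> \<i> C) = ?e"
    if "f \<in> comonoid_homs V (A \<otimes> A) (tcomult A dA A dA) (tcounit eA eA) A dA eA" for f
    using comonoid_hom_tensor_idn(1)[OF that AA comonoid_A C] by (simp add: comonoid_hom_iff)
  have "mB \<cdot> (?f \<odot> ?f) \<cdot> mid A A C C \<cdot> (\<i> (A \<otimes> A) \<odot> d) =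
     conv ?D mB (?f \<cdot> (proj1 A eA \<odot> \<i> C)) (?f \<cdot> (proj2 eA A \<odot> \<i> C))"
    by (rule conv_proj_left[OF comonoid_A comonoid_A C, symmetric]) auto
  also have "\<dots> = uB \<cdot> ?e"
    using h[OF comonoid_hom_proj1[OF comonoid_A comonoid_A]] h[OF comonoid_hom_proj2[OF comonoid_A comonoid_A]]
      unit_unit_conv[OF comonoid_tensor[OF AA C]] by simp
  finally have 1: "?f \<cdot> (mA \<odot> \<i> C) = mB \<cdot> (?f \<odot> ?f) \<cdot> mid A A C C \<cdot> (\<i> (A \<otimes> A) \<odot> d)"
    using h[OF mA_comonoid_hom] by simp
  have "tcounit eA e \<cdot> (uA \<odot> \<i> C) = tcounit (unit_counit V) e"
    using comonoid_hom_tensor_idn(1)[OF uA_comonoid_hom comonoid_unit comonoid_A C] by (simp add: comonoid_hom_iff)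
  also have "\<dots> = e \<cdot> \<l> C"
    using left_nat[of e C \<I>] by (simp add: tensor_counit_def unit_counit_def)
  finally show ?thesis using 1 by (simp add: pairing_def)
qed

text \<open>\<open>measuring_unit\<close> goes through the isomorphism of \<open>B\<close> with
  \<open>\<lbrakk>\<I>, B\<rbrakk>\<close>. Transposing shows that its pairing is the convolution
  unit, to which \<open>unit_pairing\<close> applies.\<close>

lemma unit_hom: "\<upsilon> \<in> chom \<I> (unit_comult V) (unit_counit V)"
  and \<epsilon>_unit: "\<epsilon> \<cdot> (\<i> A \<odot> \<upsilon>) = uB \<cdot> tcounit eA (unit_counit V)"
proof -
  note u = unit_pairing[OF comonoid_unit]
  have c: "arr (unit_counit V)" "dom (unit_counit V) = \<I>" "cod (unit_counit V) = \<I>" by (auto simp: unit_counit_def)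
  have t: "arr (transpose V B \<I> B (\<r> B))" "dom (transpose V B \<I> B (\<r> B)) = B" "cod (transpose V B \<I> B (\<r> B)) = \<lbrakk>\<I>, B\<rbrakk>"
    "\<e> \<I> B \<cdot> (transpose V B \<I> B (\<r> B) \<odot> \<i> \<I>) = \<r> B"
    by (rule transpose_props; simp)+
  let ?f = "uB \<cdot> tcounit eA (unit_counit V)"
  have t': "arr (transpose V A \<I> B ?f)" "dom (transpose V A \<I> B ?f) = A" "cod (transpose V A \<I> B ?f) = \<lbrakk>\<I>, B\<rbrakk>"
    "\<e> \<I> B \<cdot> (transpose V A \<I> B ?f \<odot> \<i> \<I>) = ?f"
    by (rule transpose_props; simp add: c)+
  have "transpose V B \<I> B (\<r> B) \<cdot> uB \<cdot> eA = transpose V A \<I> B ?f"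
  proof (rule ev_inject)
    have "\<e> \<I> B \<cdot> ((transpose V B \<I> B (\<r> B) \<cdot> uB \<cdot> eA) \<odot> \<i> \<I>) =
      (\<e> \<I> B \<cdot> (transpose V B \<I> B (\<r> B) \<odot> \<i> \<I>)) \<cdot> ((uB \<cdot> eA) \<odot> \<i> \<I>)" using t(1-3) by simp
    also have "\<dots> = \<r> B \<cdot> (uB \<odot> \<i> \<I>) \<cdot> (eA \<odot> \<i> \<I>)" unfolding t(4) by simp
    also have "\<dots> = uB \<cdot> \<r> \<I> \<cdot> (eA \<odot> \<i> \<I>)" by (rule right_nat_tail) auto
    also have "\<dots> = ?f" by (simp add: tensor_counit_def unit_counit_def unitors_unit)
    finally show "\<e> \<I> B \<cdot> ((transpose V B \<I> B (\<r> B) \<cdot> uB \<cdot> eA) \<odot> \<i> \<I>) =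
       \<e> \<I> B \<cdot> (transpose V A \<I> B ?f \<odot> \<i> \<I>)" unfolding t'(4) .
  qed (use t(1-3) t'(1-3) in auto)
  then have "\<upsilon> = \<phi> \<I> (unit_comult V) (unit_counit V) (transpose V A \<I> B ?f)"
    by (simp add: measuring_unit_def)
  with classifying[OF comonoid_unit u]
  show "\<upsilon> \<in> chom \<I> (unit_comult V) (unit_counit V)" "\<epsilon> \<cdot> (\<i> A \<odot> \<upsilon>) = uB \<cdot> tcounit eA (unit_counit V)"
    by simp_all
qed

text \<open>In Sweedler notation
  \<open>\<epsilon> (a\<^sub>1, p) \<epsilon> (a\<^sub>2, p')\<close>, which is to be the pairing of
  \<open>a\<close> with the product of \<open>p\<close> and \<open>p'\<close>.\<close>

definition pairing_mult :: 'm where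
  "pairing_mult = mB \<cdot> (\<epsilon> \<odot> \<epsilon>) \<cdot> mid A A P P \<cdot> (dA \<odot> \<i> (P \<otimes> P))"

lemma pairing_mult_typing [simp]:
  "arr pairing_mult" "dom pairing_mult = A \<otimes> (P \<otimes> P)" "cod pairing_mult = B"
  by (auto simp: pairing_mult_def)

abbreviation "dPP \<equiv> tcomult P dP P dP"
abbreviation "ePP \<equiv> tcounit eP eP"
abbreviation "dAA \<equiv> tcomult A dA A dA"
abbreviation "eAA \<equiv> tcounit eA eA"

lemmas comonoid_PP = comonoid_tensor[OF comonoid_P comonoid_P]
lemmas comonoid_AA = comonoid_tensor[OF comonoid_A comonoid_A]

lemma pairing_mult_conv:
  "pairing_mult = conv (tcomult A dA (P \<otimes> P) dPP) mB (\<epsilon> \<cdot> (\<i> A \<odot> proj1 P eP)) (\<epsilon> \<cdot> (\<i> A \<odot> proj2 eP P))"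
  unfolding pairing_mult_def
  by (rule conv_proj_right[OF comonoid_A comonoid_P comonoid_P, symmetric]) auto

text \<open>In Sweedler notation both sides of the measuring condition are products of four values of
  \<open>\<epsilon>\<close>; they differ by the exchange of the two middle factors.\<close>

lemma pairing_mult_pairing: "pair (P \<otimes> P) dPP ePP pairing_mult"
proof -
  let ?D = "tcomult (A \<otimes> A) dAA (P \<otimes> P) dPP" and ?eD = "tcounit eAA ePP"
  note D = comonoid_tensor[OF comonoid_AA comonoid_PP]
  note APP = comonoid_tensor[OF comonoid_A comonoid_PP]
  note AAP = comonoid_tensor[OF comonoid_AA comonoid_P]
  let ?p = "proj1 P eP" and ?q = "proj2 eP P" and ?a = "proj1 A eA" and ?b = "proj2 eA A"
  note hp = comonoid_hom_proj1[OF comonoid_P comonoid_P] and hq = comonoid_hom_proj2[OF comonoid_P comonoid_P]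
  note ha = comonoid_hom_proj1[OF comonoid_A comonoid_A] and hb = comonoid_hom_proj2[OF comonoid_A comonoid_A]
  \<comment> \<open>\<open>?a\<close> and \<open>?b\<close> select the factor of
    \<open>A \<otimes> A\<close>, \<open>?p\<close> and \<open>?q\<close> that of
    \<open>P \<otimes> P\<close>, so these are the four values that get multiplied.\<close>
  let ?x1 = "\<epsilon> \<cdot> (?a \<odot> ?p)" and ?x2 = "\<epsilon> \<cdot> (?b \<odot> ?p)" and ?x3 = "\<epsilon> \<cdot> (?a \<odot> ?q)" and ?x4 = "\<epsilon> \<cdot> (?b \<odot> ?q)"
  have \<epsilon>m: "\<epsilon> \<cdot> (mA \<odot> \<i> P) = conv (tcomult (A \<otimes> A) dAA P dP) mB (\<epsilon> \<cdot> (?a \<odot> \<i> P)) (\<epsilon> \<cdot> (?b \<odot> \<i> P))"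
    using \<epsilon>_pairing by (subst conv_proj_left[OF comonoid_A comonoid_A comonoid_P]) (auto simp: pairing_def)
  have m: "\<epsilon> \<cdot> (mA \<odot> h) = conv ?D mB (\<epsilon> \<cdot> (?a \<odot> h)) (\<epsilon> \<cdot> (?b \<odot> h))"
    if h: "h \<in> comonoid_homs V (P \<otimes> P) dPP ePP P dP eP" for h
  proof -
    have [simp]: "arr h" "dom h = P \<otimes> P" "cod h = P" using h by (auto simp: comonoid_hom_iff)
    have "\<epsilon> \<cdot> (mA \<odot> h) = (\<epsilon> \<cdot> (mA \<odot> \<i> P)) \<cdot> (\<i> (A \<otimes> A) \<odot> h)" by simp
    also have "\<dots> = conv ?D mB ((\<epsilon> \<cdot> (?a \<odot> \<i> P)) \<cdot> (\<i> (A \<otimes> A) \<odot> h)) ((\<epsilon> \<cdot> (?b \<odot> \<i> P)) \<cdot> (\<i> (A \<otimes> A) \<odot> h))"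
      unfolding \<epsilon>m
      by (rule conv_comonoid_hom[OF comonoid_hom_tensor_idn(2)[OF h comonoid_PP comonoid_P comonoid_AA] AAP D]) auto
    finally show ?thesis by simp
  qed
  \<comment> \<open>For \<open>f = mA\<close> this is where the compatibility of multiplication and
    comultiplication in \<open>A\<close> enters; the projections serve the other side of the
    measuring condition.\<close>
  have r: "pairing_mult \<cdot> (f \<odot> \<i> (P \<otimes> P)) = conv ?D mB (\<epsilon> \<cdot> (f \<odot> ?p)) (\<epsilon> \<cdot> (f \<odot> ?q))"
    if f: "f \<in> comonoid_homs V (A \<otimes> A) dAA eAA A dA eA" for f
  proof -
    have [simp]: "arr f" "dom f = A \<otimes> A" "cod f = A" using f by (auto simp: comonoid_hom_iff)
    show ?thesis unfolding pairing_mult_conv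
      by (subst conv_comonoid_hom[OF comonoid_hom_tensor_idn(1)[OF f comonoid_AA comonoid_A comonoid_PP] APP D]) auto
  qed
  have "pairing_mult \<cdot> (mA \<odot> \<i> (P \<otimes> P)) = conv ?D mB (conv ?D mB ?x1 ?x2) (conv ?D mB ?x3 ?x4)"
    by (simp add: r[OF mA_comonoid_hom] m[OF hp] m[OF hq])
  also have "\<dots> = conv ?D mB ?x1 (conv ?D mB (conv ?D mB ?x2 ?x3) ?x4)"
    by (simp add: conv_assoc[OF D monoid_B])
  also have "conv ?D mB ?x2 ?x3 = conv ?D mB ?x3 ?x2"
    by (rule convolution_commute[OF comonoid_A comonoid_P commutative_B]) auto
  also have "conv ?D mB ?x1 (conv ?D mB \<dots> ?x4) = conv ?D mB (conv ?D mB ?x1 ?x3) (conv ?D mB ?x2 ?x4)"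
    by (simp add: conv_assoc[OF D monoid_B])
  also have "\<dots> = conv ?D mB (pairing_mult \<cdot> (?a \<odot> \<i> (P \<otimes> P))) (pairing_mult \<cdot> (?b \<odot> \<i> (P \<otimes> P)))"
    by (simp add: r[OF ha] r[OF hb])
  also have "\<dots> = mB \<cdot> (pairing_mult \<odot> pairing_mult) \<cdot> mid A A (P \<otimes> P) (P \<otimes> P) \<cdot> (\<i> (A \<otimes> A) \<odot> dPP)"
    by (rule conv_proj_left[OF comonoid_A comonoid_A comonoid_PP]) auto
  finally have 1: "pairing_mult \<cdot> (mA \<odot> \<i> (P \<otimes> P)) =
    mB \<cdot> (pairing_mult \<odot> pairing_mult) \<cdot> mid A A (P \<otimes> P) (P \<otimes> P) \<cdot> (\<i> (A \<otimes> A) \<odot> dPP)" .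
  let ?I = "tcomult \<I> (unit_comult V) (P \<otimes> P) dPP" and ?eI = "tcounit (unit_counit V) ePP"
  note IPP = comonoid_tensor[OF comonoid_unit comonoid_PP]
  have eI: "?eI = ePP \<cdot> \<l> (P \<otimes> P)"
  proof -
    have "\<l> \<I> \<cdot> (\<i> \<I> \<odot> ePP) = ePP \<cdot> \<l> (P \<otimes> P)" by (rule left_nat) auto
    then show ?thesis by (simp add: tensor_counit_def[of V "\<i> \<I>"] unit_counit_def)
  qed
  have u: "\<epsilon> \<cdot> (uA \<odot> h) = uB \<cdot> ?eI" if h: "h \<in> comonoid_homs V (P \<otimes> P) dPP ePP P dP eP" for h
  proof -
    have [simp]: "arr h" "dom h = P \<otimes> P" "cod h = P" and e: "eP \<cdot> h = ePP" using h by (auto simp: comonoid_hom_iff)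
    have "\<epsilon> \<cdot> (uA \<odot> h) = (\<epsilon> \<cdot> (uA \<odot> \<i> P)) \<cdot> (\<i> \<I> \<odot> h)" by simp
    also have "\<dots> = uB \<cdot> eP \<cdot> (\<l> P \<cdot> (\<i> \<I> \<odot> h))" using \<epsilon>_pairing by (simp add: pairing_def)
    also have "\<l> P \<cdot> (\<i> \<I> \<odot> h) = h \<cdot> \<l> (P \<otimes> P)" by (rule left_nat) auto
    also have "uB \<cdot> eP \<cdot> h \<cdot> \<l> (P \<otimes> P) = uB \<cdot> (eP \<cdot> h) \<cdot> \<l> (P \<otimes> P)" by simp
    finally show ?thesis unfolding e eI .
  qed
  have "pairing_mult \<cdot> (uA \<odot> \<i> (P \<otimes> P)) = conv ?I mB ((\<epsilon> \<cdot> (\<i> A \<odot> ?p)) \<cdot> (uA \<odot> \<i> (P \<otimes> P))) ((\<epsilon> \<cdot> (\<i> A \<odot> ?q)) \<cdot> (uA \<odot> \<i> (P \<otimes> P)))"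
    unfolding pairing_mult_conv
    by (rule conv_comonoid_hom[OF comonoid_hom_tensor_idn(1)[OF uA_comonoid_hom comonoid_unit comonoid_A comonoid_PP] APP IPP]) auto
  also have "\<dots> = conv ?I mB (\<epsilon> \<cdot> (uA \<odot> ?p)) (\<epsilon> \<cdot> (uA \<odot> ?q))" by simp
  also have "\<dots> = uB \<cdot> ePP \<cdot> \<l> (P \<otimes> P)"
    unfolding u[OF hp] u[OF hq] unit_unit_conv[OF IPP] by (simp add: eI)
  finally show ?thesis using 1 by (simp add: pairing_def)
qed

lemma mult_hom: "\<mu> \<in> chom (P \<otimes> P) dPP ePP"
  and \<epsilon>_mult: "\<epsilon> \<cdot> (\<i> A \<odot> \<mu>) = pairing_mult"
proof -
  let ?k = "ihom_map V (\<i> (P \<otimes> P)) mB \<cdot> ihom_tensor V P B P B \<cdot> (\<eta> \<odot> \<eta>)"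
  note [simp] = ihom_map_props(1-3) ihom_tensor_props(1-3)
  note t = transpose_props[of pairing_mult A "P \<otimes> P" B, simplified]
  have "?k \<cdot> dA = transpose V A (P \<otimes> P) B pairing_mult"
  proof (rule ev_inject)
    have "\<e> (P \<otimes> P) B \<cdot> (?k \<odot> \<i> (P \<otimes> P)) = mB \<cdot> (\<epsilon> \<odot> \<epsilon>) \<cdot> mid A A P P"
      using ev_ihom_map_tensor[of \<eta> P B \<eta> P B "\<i> (P \<otimes> P)" mB] by (simp add: \<epsilon>_def)
    then have "\<e> (P \<otimes> P) B \<cdot> (?k \<odot> \<i> (P \<otimes> P)) \<cdot> (dA \<odot> \<i> (P \<otimes> P)) = (mB \<cdot> (\<epsilon> \<odot> \<epsilon>) \<cdot> mid A A P P) \<cdot> (dA \<odot> \<i> (P \<otimes> P))"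
      by (rule tail) auto
    then show "\<e> (P \<otimes> P) B \<cdot> ((?k \<cdot> dA) \<odot> \<i> (P \<otimes> P)) = \<e> (P \<otimes> P) B \<cdot> (transpose V A (P \<otimes> P) B pairing_mult \<odot> \<i> (P \<otimes> P))"
      unfolding t(4) by (simp add: pairing_mult_def)
  qed (use t(1-3) in auto)
  then have "\<mu> = \<phi> (P \<otimes> P) dPP ePP (transpose V A (P \<otimes> P) B pairing_mult)"
    by (simp add: measuring_mult_def)
  with classifying[OF comonoid_PP pairing_mult_pairing]
  show "\<mu> \<in> chom (P \<otimes> P) dPP ePP" "\<epsilon> \<cdot> (\<i> A \<odot> \<mu>) = pairing_mult" by simp_all
qed

lemma mult_typing [simp]:
  "arr \<mu>" "dom \<mu> = P \<otimes> P" "cod \<mu> = P" "arr \<upsilon>" "dom \<upsilon> = \<I>" "cod \<upsilon> = P"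
  using mult_hom unit_hom by (auto simp: comonoid_hom_iff)

section \<open>The monoid laws of \<open>P\<close>\<close>

lemma \<epsilon>_mult_tensor:
  assumes [simp]: "arr h" "dom h = C" "cod h = P" "arr h'" "dom h' = C'" "cod h' = P"
  shows "\<epsilon> \<cdot> (\<i> A \<odot> (\<mu> \<cdot> (h \<odot> h'))) =
    mB \<cdot> ((\<epsilon> \<cdot> (\<i> A \<odot> h)) \<odot> (\<epsilon> \<cdot> (\<i> A \<odot> h'))) \<cdot> mid A A C C' \<cdot> (dA \<odot> \<i> (C \<otimes> C'))"
proof -
  have [simp]: "ob C" "ob C'" using assms ob_dom by blast+
  have "\<epsilon> \<cdot> (\<i> A \<odot> (\<mu> \<cdot> (h \<odot> h'))) = (\<epsilon> \<cdot> (\<i> A \<odot> \<mu>)) \<cdot> (\<i> A \<odot> (h \<odot> h'))" by simp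
  also have "\<dots> = mB \<cdot> (\<epsilon> \<odot> \<epsilon>) \<cdot> (mid A A P P \<cdot> ((\<i> A \<odot> \<i> A) \<odot> (h \<odot> h'))) \<cdot> (dA \<odot> \<i> (C \<otimes> C'))"
    unfolding \<epsilon>_mult by (simp add: pairing_mult_def)
  also have "mid A A P P \<cdot> ((\<i> A \<odot> \<i> A) \<odot> (h \<odot> h')) = ((\<i> A \<odot> h) \<odot> (\<i> A \<odot> h')) \<cdot> mid A A C C'"
    by (rule mid_nat) auto
  finally show ?thesis by simp
qed

text \<open>Both sides are comonoid morphisms, so their pairings decide. Each pairing multiplies
  three values of \<open>\<epsilon>\<close> on an iterated coproduct of \<open>A\<close>;
  associativity of \<open>B\<close> and coassociativity of \<open>A\<close> bring both to
  \<open>?S\<close>, with \<open>mid_hexagon_inv\<close> rearranging the factors.\<close>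

lemma mult_assoc: "\<mu> \<cdot> (\<mu> \<odot> \<i> P) = \<mu> \<cdot> (\<i> P \<odot> \<mu>) \<cdot> \<a> P P P"
proof (rule classifying_unique)
  note PPP = comonoid_tensor[OF comonoid_PP comonoid_P] and PPP' = comonoid_tensor[OF comonoid_P comonoid_PP]
  show "is_comonoid V ((P \<otimes> P) \<otimes> P) (tcomult (P \<otimes> P) dPP P dP) (tcounit ePP eP)" by (rule PPP)
  show "\<mu> \<cdot> (\<mu> \<odot> \<i> P) \<in> chom ((P \<otimes> P) \<otimes> P) (tcomult (P \<otimes> P) dPP P dP) (tcounit ePP eP)"
    by (rule comonoid_hom_cmp[OF comonoid_hom_tensor_idn(1)[OF mult_hom comonoid_PP comonoid_P comonoid_P] mult_hom PPP comonoid_PP comonoid_P])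
  show "\<mu> \<cdot> (\<i> P \<odot> \<mu>) \<cdot> \<a> P P P \<in> chom ((P \<otimes> P) \<otimes> P) (tcomult (P \<otimes> P) dPP P dP) (tcounit ePP eP)"
    by (rule comonoid_hom_cmp[OF comonoid_hom_cmp[OF comonoid_hom_associator[OF comonoid_P comonoid_P comonoid_P]
          comonoid_hom_tensor_idn(2)[OF mult_hom comonoid_PP comonoid_P comonoid_P] PPP PPP' comonoid_PP] mult_hom PPP comonoid_PP comonoid_P])
  let ?M = "mid A A P P"
  have e: "\<epsilon> \<cdot> (\<i> A \<odot> \<mu>) = mB \<cdot> (\<epsilon> \<odot> \<epsilon>) \<cdot> ?M \<cdot> (dA \<odot> \<i> (P \<otimes> P))"
    unfolding \<epsilon>_mult by (simp add: pairing_mult_def)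
  have n1: "((dA \<odot> \<i> (P \<otimes> P)) \<odot> \<i> (A \<otimes> P)) \<cdot> mid A A (P \<otimes> P) P = mid (A \<otimes> A) A (P \<otimes> P) P \<cdot> ((dA \<odot> \<i> A) \<odot> \<i> ((P \<otimes> P) \<otimes> P))"
    using mid_nat[of dA "\<i> A" "\<i> (P \<otimes> P)" "\<i> P", symmetric] by simp
  have n2: "(\<i> (A \<otimes> P) \<odot> (dA \<odot> \<i> (P \<otimes> P))) \<cdot> mid A A P (P \<otimes> P) = mid A (A \<otimes> A) P (P \<otimes> P) \<cdot> ((\<i> A \<odot> dA) \<odot> \<i> (P \<otimes> (P \<otimes> P)))"
    using mid_nat[of "\<i> A" dA "\<i> P" "\<i> (P \<otimes> P)", symmetric] by simp
  let ?S = "mB \<cdot> (\<i> B \<odot> mB) \<cdot> (\<epsilon> \<odot> (\<epsilon> \<odot> \<epsilon>)) \<cdot> (\<i> (A \<otimes> P) \<odot> ?M) \<cdot> mid A (A \<otimes> A) P (P \<otimes> P) \<cdot> (((\<i> A \<odot> dA) \<cdot> dA) \<odot> \<a> P P P)"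
  have "\<epsilon> \<cdot> (\<i> A \<odot> (\<mu> \<cdot> (\<mu> \<odot> \<i> P))) =
      (mB \<cdot> (mB \<odot> \<i> B)) \<cdot> ((\<epsilon> \<odot> \<epsilon>) \<odot> \<epsilon>) \<cdot> (?M \<odot> \<i> (A \<otimes> P)) \<cdot>
      (((dA \<odot> \<i> (P \<otimes> P)) \<odot> \<i> (A \<otimes> P)) \<cdot> mid A A (P \<otimes> P) P) \<cdot> (dA \<odot> \<i> ((P \<otimes> P) \<otimes> P))"
    by (subst \<epsilon>_mult_tensor) (auto simp: e)
  also have "\<dots> = (mB \<cdot> (\<i> B \<odot> mB) \<cdot> \<a> B B B) \<cdot> ((\<epsilon> \<odot> \<epsilon>) \<odot> \<epsilon>) \<cdot> (?M \<odot> \<i> (A \<otimes> P)) \<cdot>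
      mid (A \<otimes> A) A (P \<otimes> P) P \<cdot> (((dA \<odot> \<i> A) \<cdot> dA) \<odot> \<i> ((P \<otimes> P) \<otimes> P))"
    unfolding monoidD(8)[OF monoid_B] n1 by simp
  also have "\<dots> = mB \<cdot> (\<i> B \<odot> mB) \<cdot> (\<a> B B B \<cdot> ((\<epsilon> \<odot> \<epsilon>) \<odot> \<epsilon>)) \<cdot> (?M \<odot> \<i> (A \<otimes> P)) \<cdot>
      mid (A \<otimes> A) A (P \<otimes> P) P \<cdot> (((dA \<odot> \<i> A) \<cdot> dA) \<odot> \<i> ((P \<otimes> P) \<otimes> P))" by simp
  also have "\<a> B B B \<cdot> ((\<epsilon> \<odot> \<epsilon>) \<odot> \<epsilon>) = (\<epsilon> \<odot> (\<epsilon> \<odot> \<epsilon>)) \<cdot> \<a> (A \<otimes> P) (A \<otimes> P) (A \<otimes> P)" by (rule assoc_nat) auto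
  also have "mB \<cdot> (\<i> B \<odot> mB) \<cdot> \<dots> \<cdot> (?M \<odot> \<i> (A \<otimes> P)) \<cdot>
      mid (A \<otimes> A) A (P \<otimes> P) P \<cdot> (((dA \<odot> \<i> A) \<cdot> dA) \<odot> \<i> ((P \<otimes> P) \<otimes> P)) =
    mB \<cdot> (\<i> B \<odot> mB) \<cdot> (\<epsilon> \<odot> (\<epsilon> \<odot> \<epsilon>)) \<cdot> (\<a> (A \<otimes> P) (A \<otimes> P) (A \<otimes> P) \<cdot> (?M \<odot> \<i> (A \<otimes> P)) \<cdot>
      mid (A \<otimes> A) A (P \<otimes> P) P) \<cdot> (((dA \<odot> \<i> A) \<cdot> dA) \<odot> \<i> ((P \<otimes> P) \<otimes> P))" by simp
  also have "\<dots> = mB \<cdot> (\<i> B \<odot> mB) \<cdot> (\<epsilon> \<odot> (\<epsilon> \<odot> \<epsilon>)) \<cdot> (\<i> (A \<otimes> P) \<odot> ?M) \<cdot>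
      mid A (A \<otimes> A) P (P \<otimes> P) \<cdot> ((\<a> A A A \<cdot> (dA \<odot> \<i> A) \<cdot> dA) \<odot> \<a> P P P)"
    by (subst mid_hexagon_inv) auto
  also have "\<dots> = ?S" unfolding comonoidD(8)[OF comonoid_A] ..
  finally have L: "\<epsilon> \<cdot> (\<i> A \<odot> (\<mu> \<cdot> (\<mu> \<odot> \<i> P))) = ?S" .
  have "\<epsilon> \<cdot> (\<i> A \<odot> (\<mu> \<cdot> (\<i> P \<odot> \<mu>) \<cdot> \<a> P P P)) = (\<epsilon> \<cdot> (\<i> A \<odot> (\<mu> \<cdot> (\<i> P \<odot> \<mu>)))) \<cdot> (\<i> A \<odot> \<a> P P P)" by simp
  also have "\<dots> = mB \<cdot> (\<i> B \<odot> mB) \<cdot> (\<epsilon> \<odot> (\<epsilon> \<odot> \<epsilon>)) \<cdot> (\<i> (A \<otimes> P) \<odot> ?M) \<cdot>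
      ((\<i> (A \<otimes> P) \<odot> (dA \<odot> \<i> (P \<otimes> P))) \<cdot> mid A A P (P \<otimes> P)) \<cdot> (dA \<odot> \<a> P P P)"
    by (subst \<epsilon>_mult_tensor) (auto simp: e)
  also have "\<dots> = ?S" unfolding n2 by simp
  finally show "\<epsilon> \<cdot> (\<i> A \<odot> (\<mu> \<cdot> (\<mu> \<odot> \<i> P))) = \<epsilon> \<cdot> (\<i> A \<odot> (\<mu> \<cdot> (\<i> P \<odot> \<mu>) \<cdot> \<a> P P P))" using L by simp
qed

lemma \<epsilon>_unit_along:
  assumes C: "is_comonoid V C d e" and h: "h \<in> comonoid_homs V C d e \<I> (unit_comult V) (unit_counit V)"
  shows "\<epsilon> \<cdot> (\<i> A \<odot> (\<upsilon> \<cdot> h)) = uB \<cdot> tcounit eA e"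
proof -
  have [simp]: "arr h" "cod h = \<I>" using h by (auto simp: comonoid_hom_iff)
  have [simp]: "arr (unit_counit V)" "dom (unit_counit V) = \<I>" "cod (unit_counit V) = \<I>" by (auto simp: unit_counit_def)
  have "\<epsilon> \<cdot> (\<i> A \<odot> (\<upsilon> \<cdot> h)) = (\<epsilon> \<cdot> (\<i> A \<odot> \<upsilon>)) \<cdot> (\<i> A \<odot> h)" by simp
  then show ?thesis
    using comonoid_hom_tensor_idn(2)[OF h C comonoid_unit comonoid_A] by (simp add: \<epsilon>_unit comonoid_hom_iff)
qed

text \<open>The pairing of \<open>\<upsilon>\<close>, restricted along a projection, is a
  convolution unit. The product therefore reduces to the pairing of the other projection, which is
  \<open>\<l> P\<close>.\<close>

lemma mult_unit_left: "\<mu> \<cdot> (\<upsilon> \<odot> \<i> P) = \<l> P"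
proof (rule classifying_unique)
  let ?d = "tcomult \<I> (unit_comult V) P dP" and ?e = "tcounit (unit_counit V) eP"
  note IP = comonoid_tensor[OF comonoid_unit comonoid_P]
  note h = comonoid_hom_tensor_idn(1)[OF unit_hom comonoid_unit comonoid_P comonoid_P]
  show "is_comonoid V (\<I> \<otimes> P) ?d ?e" by (rule IP)
  show "\<mu> \<cdot> (\<upsilon> \<odot> \<i> P) \<in> chom (\<I> \<otimes> P) ?d ?e" by (rule comonoid_hom_cmp[OF h mult_hom IP comonoid_PP comonoid_P])
  show "\<l> P \<in> chom (\<I> \<otimes> P) ?d ?e" by (rule comonoid_hom_left_unitor[OF comonoid_P])
  have c [simp]: "arr (unit_counit V)" "dom (unit_counit V) = \<I>" "cod (unit_counit V) = \<I>" by (auto simp: unit_counit_def)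
  have "\<epsilon> \<cdot> (\<i> A \<odot> (\<mu> \<cdot> (\<upsilon> \<odot> \<i> P))) =
      mB \<cdot> ((\<epsilon> \<cdot> (\<i> A \<odot> \<upsilon>)) \<odot> \<epsilon>) \<cdot> mid A A \<I> P \<cdot> (dA \<odot> \<i> (\<I> \<otimes> P))"
    using \<epsilon>_mult_tensor[of \<upsilon> \<I> "\<i> P" P] by simp
  also have "\<dots> = conv (tcomult A dA (\<I> \<otimes> P) ?d) mB
      ((\<epsilon> \<cdot> (\<i> A \<odot> \<upsilon>)) \<cdot> (\<i> A \<odot> proj1 \<I> eP)) (\<epsilon> \<cdot> (\<i> A \<odot> proj2 (unit_counit V) P))"
    by (rule conv_proj_right[OF comonoid_A comonoid_unit comonoid_P, symmetric]) auto
  also have "\<dots> = conv (tcomult A dA (\<I> \<otimes> P) ?d) mB (uB \<cdot> tcounit eA ?e) (\<epsilon> \<cdot> (\<i> A \<odot> proj2 (unit_counit V) P))"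
    using \<epsilon>_unit_along[OF IP comonoid_hom_proj1[OF comonoid_unit comonoid_P]] by simp
  also have "\<dots> = \<epsilon> \<cdot> (\<i> A \<odot> proj2 (unit_counit V) P)"
    by (rule conv_unit[OF comonoid_tensor[OF comonoid_A IP] monoid_B]) auto
  also have "proj2 (unit_counit V) P = \<l> P" by (simp add: proj2_def unit_counit_def)
  finally show "\<epsilon> \<cdot> (\<i> A \<odot> (\<mu> \<cdot> (\<upsilon> \<odot> \<i> P))) = \<epsilon> \<cdot> (\<i> A \<odot> \<l> P)" .
qed

lemma mult_unit_right: "\<mu> \<cdot> (\<i> P \<odot> \<upsilon>) = \<r> P"
proof (rule classifying_unique)
  let ?d = "tcomult P dP \<I> (unit_comult V)" and ?e = "tcounit eP (unit_counit V)"
  note PI = comonoid_tensor[OF comonoid_P comonoid_unit]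
  note h = comonoid_hom_tensor_idn(2)[OF unit_hom comonoid_unit comonoid_P comonoid_P]
  show "is_comonoid V (P \<otimes> \<I>) ?d ?e" by (rule PI)
  show "\<mu> \<cdot> (\<i> P \<odot> \<upsilon>) \<in> chom (P \<otimes> \<I>) ?d ?e" by (rule comonoid_hom_cmp[OF h mult_hom PI comonoid_PP comonoid_P])
  show "\<r> P \<in> chom (P \<otimes> \<I>) ?d ?e" by (rule comonoid_hom_right_unitor[OF comonoid_P])
  have c [simp]: "arr (unit_counit V)" "dom (unit_counit V) = \<I>" "cod (unit_counit V) = \<I>" by (auto simp: unit_counit_def)
  have "\<epsilon> \<cdot> (\<i> A \<odot> (\<mu> \<cdot> (\<i> P \<odot> \<upsilon>))) =
      mB \<cdot> (\<epsilon> \<odot> (\<epsilon> \<cdot> (\<i> A \<odot> \<upsilon>))) \<cdot> mid A A P \<I> \<cdot> (dA \<odot> \<i> (P \<otimes> \<I>))"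
    using \<epsilon>_mult_tensor[of "\<i> P" P \<upsilon> \<I>] by simp
  also have "\<dots> = conv (tcomult A dA (P \<otimes> \<I>) ?d) mB
      (\<epsilon> \<cdot> (\<i> A \<odot> proj1 P (unit_counit V))) ((\<epsilon> \<cdot> (\<i> A \<odot> \<upsilon>)) \<cdot> (\<i> A \<odot> proj2 eP \<I>))"
    by (rule conv_proj_right[OF comonoid_A comonoid_P comonoid_unit, symmetric]) auto
  also have "\<dots> = conv (tcomult A dA (P \<otimes> \<I>) ?d) mB (\<epsilon> \<cdot> (\<i> A \<odot> proj1 P (unit_counit V))) (uB \<cdot> tcounit eA ?e)"
    using \<epsilon>_unit_along[OF PI comonoid_hom_proj2[OF comonoid_P comonoid_unit]] by simp
  also have "\<dots> = \<epsilon> \<cdot> (\<i> A \<odot> proj1 P (unit_counit V))"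
    by (rule conv_unit[OF comonoid_tensor[OF comonoid_A PI] monoid_B]) auto
  also have "proj1 P (unit_counit V) = \<r> P" by (simp add: proj1_def unit_counit_def)
  finally show "\<epsilon> \<cdot> (\<i> A \<odot> (\<mu> \<cdot> (\<i> P \<odot> \<upsilon>))) = \<epsilon> \<cdot> (\<i> A \<odot> \<r> P)" .
qed

lemma bimonoid_P: "is_bimonoid V P \<mu> \<upsilon> dP eP"
  using mult_assoc mult_unit_left mult_unit_right mult_hom unit_hom comonoid_P
  unfolding is_bimonoid_def is_monoid_def by simp

subsection \<open>The antipode\<close>

text \<open>A partial converse of \<open>pairing_comonoid_hom\<close>: the pairing equations for
  \<open>t\<close> hold after restriction along \<open>f\<close>. A jointly epic pair of such
  \<open>f\<close> then yields them for \<open>t\<close>.\<close>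

lemma pairing_along:
  assumes C: "is_comonoid V C d e" and D: "is_comonoid V D d' e'" and f: "f \<in> comonoid_homs V D d' e' C d e"
    and t [simp]: "arr t" "dom t = A \<otimes> C" "cod t = B" and p: "pair D d' e' (t \<cdot> (\<i> A \<odot> f))"
  shows "(t \<cdot> (mA \<odot> \<i> C)) \<cdot> (\<i> (A \<otimes> A) \<odot> f) =
      (mB \<cdot> (t \<odot> t) \<cdot> mid A A C C \<cdot> (\<i> (A \<otimes> A) \<odot> d)) \<cdot> (\<i> (A \<otimes> A) \<odot> f)"
    "(t \<cdot> (uA \<odot> \<i> C)) \<cdot> (\<i> \<I> \<odot> f) = (uB \<cdot> e \<cdot> \<l> C) \<cdot> (\<i> \<I> \<odot> f)"
proof -
  note [simp] = comonoidD(1-7)[OF C] comonoidD(1-7)[OF D]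
  have [simp]: "arr f" "dom f = D" "cod f = C" and df: "d \<cdot> f = (f \<odot> f) \<cdot> d'" and ef: "e \<cdot> f = e'"
    using f by (auto simp: comonoid_hom_iff)
  have "(t \<cdot> (mA \<odot> \<i> C)) \<cdot> (\<i> (A \<otimes> A) \<odot> f) = (t \<cdot> (\<i> A \<odot> f)) \<cdot> (mA \<odot> \<i> D)" by simp
  also have "\<dots> = mB \<cdot> (t \<odot> t) \<cdot> (((\<i> A \<odot> f) \<odot> (\<i> A \<odot> f)) \<cdot> mid A A D D) \<cdot> (\<i> (A \<otimes> A) \<odot> d')"
    using p by (simp add: pairing_def)
  also have "((\<i> A \<odot> f) \<odot> (\<i> A \<odot> f)) \<cdot> mid A A D D = mid A A C C \<cdot> ((\<i> A \<odot> \<i> A) \<odot> (f \<odot> f))"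
    by (rule mid_nat[symmetric]) auto
  finally show "(t \<cdot> (mA \<odot> \<i> C)) \<cdot> (\<i> (A \<otimes> A) \<odot> f) =
      (mB \<cdot> (t \<odot> t) \<cdot> mid A A C C \<cdot> (\<i> (A \<otimes> A) \<odot> d)) \<cdot> (\<i> (A \<otimes> A) \<odot> f)" by (simp add: df)
  have "(t \<cdot> (uA \<odot> \<i> C)) \<cdot> (\<i> \<I> \<odot> f) = (t \<cdot> (\<i> A \<odot> f)) \<cdot> (uA \<odot> \<i> D)" by simp
  also have "\<dots> = uB \<cdot> e' \<cdot> \<l> D" using p by (simp only: pairing_def)
  also have "\<dots> = uB \<cdot> e \<cdot> (f \<cdot> \<l> D)" by (simp flip: ef)
  also have "f \<cdot> \<l> D = \<l> C \<cdot> (\<i> \<I> \<odot> f)" by (rule left_nat[symmetric]) auto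
  finally show "(t \<cdot> (uA \<odot> \<i> C)) \<cdot> (\<i> \<I> \<odot> f) = (uB \<cdot> e \<cdot> \<l> C) \<cdot> (\<i> \<I> \<odot> f)" by simp
qed

text \<open>A comonoid morphism \<open>h : D \<rightarrow> P\<close> extends along \<open>q : D \<rightarrow> Q\<close>, because its pairing does. This turns an
  equation between the pairings of \<open>h \<cdot> \<delta>\<close> and \<open>\<upsilon> \<cdot> e\<close>, which are not comonoid morphisms, into one between
  the maps themselves.\<close>

lemma pushout_detects_unit:
  assumes D: "is_comonoid V D dD eD" and Q: "is_comonoid V (cod q) dQ eQ" and P: "pushout \<delta> e q i"
    and q: "q \<in> comonoid_homs V D dD eD (cod q) dQ eQ" and i: "i \<in> comonoid_homs V \<I> (unit_comult V) (unit_counit V) (cod q) dQ eQ"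
    and h: "h \<in> chom D dD eD" and eq: "\<epsilon> \<cdot> (\<i> A \<odot> (h \<cdot> \<delta>)) = uB \<cdot> tcounit eA e"
  shows "h \<cdot> \<delta> = \<upsilon> \<cdot> e"
proof -
  note [simp] = comonoidD(1-7)[OF D] comonoidD(1-7)[OF Q]
  have q' [simp]: "arr q" "dom q = D" using q by (auto simp: comonoid_hom_iff)
  have i' [simp]: "arr i" "dom i = \<I>" "cod i = cod q" using i by (auto simp: comonoid_hom_iff)
  have h' [simp]: "arr h" "dom h = D" "cod h = P" using h by (auto simp: comonoid_hom_iff)
  have p [simp]: "arr \<delta>" "cod \<delta> = D" "arr e" "cod e = \<I>" "dom e = dom \<delta>" and sq: "q \<cdot> \<delta> = i \<cdot> e"
    using pushout_typing[OF P] by auto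
  have c [simp]: "arr (unit_counit V)" "dom (unit_counit V) = \<I>" "cod (unit_counit V) = \<I>" by (auto simp: unit_counit_def)
  let ?Q = "cod q" and ?k = "\<epsilon> \<cdot> (\<i> A \<odot> h)" and ?u = "uB \<cdot> tcounit eA (unit_counit V)"
  have ku: "?k \<cdot> (\<i> A \<odot> \<delta>) = ?u \<cdot> (\<i> A \<odot> e)"
    using eq by (simp add: tensor_counit_def unit_counit_def)
  obtain t where t [simp]: "arr t" "dom t = A \<otimes> ?Q" "cod t = B" and tq: "t \<cdot> (\<i> A \<odot> q) = ?k" and ti: "t \<cdot> (\<i> A \<odot> i) = ?u"
    by (rule pushout_tensor_factor[OF P _ _ _ _ _ _ _ ku]) auto
  have pq: "pair D dD eD (t \<cdot> (\<i> A \<odot> q))"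
    unfolding tq by (rule pairing_comonoid_hom[OF monoid_A monoid_B comonoid_P D \<epsilon>_pairing h])
  have pi: "pair \<I> (unit_comult V) (unit_counit V) (t \<cdot> (\<i> A \<odot> i))"
    unfolding ti by (rule unit_pairing[OF comonoid_unit])
  note aq = pairing_along[OF Q D q t pq] and ai = pairing_along[OF Q comonoid_unit i t pi]
  \<comment> \<open>The two pairing equations compare arrows out of
    \<open>(A \<otimes> A) \<otimes> ?Q\<close> and \<open>\<I> \<otimes> ?Q\<close>, so joint
    epimorphy is needed after tensoring with these objects as well.\<close>
  have "t \<cdot> (mA \<odot> \<i> ?Q) = mB \<cdot> (t \<odot> t) \<cdot> mid A A ?Q ?Q \<cdot> (\<i> (A \<otimes> A) \<odot> dQ)"
    by (rule pushout_tensor_jointly_epic[OF P _ _ _ _ _ _ _ aq(1) ai(1)]) auto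
  moreover have "t \<cdot> (uA \<odot> \<i> ?Q) = uB \<cdot> eQ \<cdot> \<l> ?Q"
    by (rule pushout_tensor_jointly_epic[OF P _ _ _ _ _ _ _ aq(2) ai(2)]) auto
  ultimately have pt: "pair ?Q dQ eQ t" by (simp add: pairing_def)
  obtain T where T: "T \<in> chom ?Q dQ eQ" "\<epsilon> \<cdot> (\<i> A \<odot> T) = t"
    using classifying[OF Q pt] by blast
  have T' [simp]: "arr T" "dom T = ?Q" "cod T = P" using T by (auto simp: comonoid_hom_iff)
  have along: "\<epsilon> \<cdot> (\<i> A \<odot> (T \<cdot> m)) = t \<cdot> (\<i> A \<odot> m)" if [simp]: "arr m" "cod m = ?Q" for m
    unfolding T(2)[symmetric] by simp
  have "T \<cdot> q = h"
    by (rule classifying_unique[OF D comonoid_hom_cmp[OF q T(1) D Q comonoid_P] h]) (simp add: along tq)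
  moreover have "T \<cdot> i = \<upsilon>"
    by (rule classifying_unique[OF comonoid_unit comonoid_hom_cmp[OF i T(1) comonoid_unit Q comonoid_P] unit_hom])
      (simp add: along ti \<epsilon>_unit)
  \<comment> \<open>Only here does \<open>\<delta>\<close> enter an equation of maps into
    \<open>P\<close>: commutativity of the pushout square carries it over although it need not be a
    comonoid morphism.\<close>
  moreover have "(T \<cdot> q) \<cdot> \<delta> = (T \<cdot> i) \<cdot> e" by (simp add: sq)
  ultimately show ?thesis by simp
qed

text \<open>\<open>C\<close> will be \<open>P\<close> or its co-opposite, and the two alternatives
  for \<open>h\<close> match the two orders of convolution. One pushout serves both, because
  \<open>q\<close> and \<open>i\<close> stay comonoid morphisms when all comultiplications are
  reversed, and the co-opposite of \<open>C \<otimes> C\<^sup>c\<^sup>o\<^sup>p\<close> is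
  \<open>C\<^sup>c\<^sup>o\<^sup>p \<otimes> C\<close>.\<close>

lemma detect_unit:
  assumes lp: "locally_presentable TYPE('u) V" and C: "is_comonoid V C d e"
    and eq: "\<epsilon> \<cdot> (\<i> A \<odot> (h \<cdot> d)) = uB \<cdot> tcounit eA e"
    and h: "h \<in> chom (C \<otimes> C) (tcomult C d C (op C d)) (tcounit e e) \<or>
      h \<in> chom (C \<otimes> C) (tcomult C (op C d) C d) (tcounit e e)"
  shows "h \<cdot> d = \<upsilon> \<cdot> e"
proof -
  note [simp] = comonoidD(1-7)[OF C]
  note C' = comonoid_cop[OF C]
  obtain q i where P: "pushout d e q i" using pushout_exists[OF lp, of d e] by auto
  obtain dQ eQ where Q: "is_comonoid V (cod q) dQ eQ"
    and q: "q \<in> comonoid_homs V (C \<otimes> C) (tcomult C d C (op C d)) (tcounit e e) (cod q) dQ eQ"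
    and i: "i \<in> comonoid_homs V \<I> (unit_comult V) (unit_counit V) (cod q) dQ eQ"
    by (rule quotient_comonoid[OF C P])
  note D = comonoid_tensor[OF C C'] and D' = comonoid_tensor[OF C' C]
  have "op (C \<otimes> C) (tcomult C d C (op C d)) = tcomult C (op C d) C d"
    using cop_tensor[OF C C'] by simp
  then have q': "q \<in> comonoid_homs V (C \<otimes> C) (tcomult C (op C d) C d) (tcounit e e) (cod q) (op (cod q) dQ) eQ"
    using comonoid_hom_cop[OF q D Q] by simp
  have i': "i \<in> comonoid_homs V \<I> (unit_comult V) (unit_counit V) (cod q) (op (cod q) dQ) eQ"
    using comonoid_hom_cop[OF i comonoid_unit Q] unfolding cop_unit .
  show ?thesis
    using h pushout_detects_unit[OF D Q P q i _ eq] pushout_detects_unit[OF D' comonoid_cop[OF Q] P q' i' _ eq] by blast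
qed

section \<open>Convolution in \<open>P\<close> against convolution in \<open>A\<close>\<close>

lemma pairing_on_comult:
  assumes [simp]: "arr x" "dom x = A" "cod x = A \<otimes> A"
  shows "mB \<cdot> (\<epsilon> \<odot> \<epsilon>) \<cdot> mid A A P P \<cdot> (x \<odot> dP) = \<epsilon> \<cdot> ((mA \<cdot> x) \<odot> \<i> P)"
proof -
  have "\<epsilon> \<cdot> ((mA \<cdot> x) \<odot> \<i> P) = (\<epsilon> \<cdot> (mA \<odot> \<i> P)) \<cdot> (x \<odot> \<i> P)" by simp
  also have "\<epsilon> \<cdot> (mA \<odot> \<i> P) = mB \<cdot> (\<epsilon> \<odot> \<epsilon>) \<cdot> mid A A P P \<cdot> (\<i> (A \<otimes> A) \<odot> dP)"
    using \<epsilon>_pairing by (simp add: pairing_def)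
  finally show ?thesis by simp
qed

text \<open>When \<open>\<Sigma>\<close> is adjoint to \<open>\<sigma>\<close> and
  \<open>\<Sigma>'\<close> to \<open>\<sigma>'\<close> with respect to \<open>\<epsilon>\<close>, so
  are their convolutions, since \<open>\<epsilon>\<close> exchanges multiplication on one side with
  comultiplication on the other. For the co-opposite, commutativity of \<open>B\<close> moves the
  symmetry from \<open>P\<close> to \<open>A\<close>, which reverses \<open>\<sigma>\<close> and
  \<open>\<sigma>'\<close>.\<close>

lemma \<epsilon>_mult_comult:
  assumes s [simp]: "arr \<Sigma>" "dom \<Sigma> = P" "cod \<Sigma> = P" "arr \<Sigma>'" "dom \<Sigma>' = P" "cod \<Sigma>' = P"
      "arr \<sigma>" "dom \<sigma> = A" "cod \<sigma> = A" "arr \<sigma>'" "dom \<sigma>' = A" "cod \<sigma>' = A"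
    and e: "\<epsilon> \<cdot> (\<i> A \<odot> \<Sigma>) = \<epsilon> \<cdot> (\<sigma> \<odot> \<i> P)" "\<epsilon> \<cdot> (\<i> A \<odot> \<Sigma>') = \<epsilon> \<cdot> (\<sigma>' \<odot> \<i> P)"
  shows "\<epsilon> \<cdot> (\<i> A \<odot> (\<mu> \<cdot> (\<Sigma> \<odot> \<Sigma>') \<cdot> dP)) = \<epsilon> \<cdot> (conv dA mA \<sigma> \<sigma>' \<odot> \<i> P)"
    "\<epsilon> \<cdot> (\<i> A \<odot> (\<mu> \<cdot> (\<Sigma> \<odot> \<Sigma>') \<cdot> op P dP)) = \<epsilon> \<cdot> (conv (op A dA) mA \<sigma>' \<sigma> \<odot> \<i> P)"
proof -
  let ?x = "(\<sigma> \<odot> \<sigma>') \<cdot> dA"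
  have gen: "\<epsilon> \<cdot> (\<i> A \<odot> (\<mu> \<cdot> (\<Sigma> \<odot> \<Sigma>') \<cdot> d)) = mB \<cdot> (\<epsilon> \<odot> \<epsilon>) \<cdot> mid A A P P \<cdot> (?x \<odot> d)"
    if [simp]: "arr d" "dom d = P" "cod d = P \<otimes> P" for d
  proof -
    have "\<epsilon> \<cdot> (\<i> A \<odot> (\<mu> \<cdot> (\<Sigma> \<odot> \<Sigma>') \<cdot> d)) = (\<epsilon> \<cdot> (\<i> A \<odot> (\<mu> \<cdot> (\<Sigma> \<odot> \<Sigma>')))) \<cdot> (\<i> A \<odot> d)" by simp
    also have "\<dots> = mB \<cdot> (\<epsilon> \<odot> \<epsilon>) \<cdot> (((\<sigma> \<odot> \<i> P) \<odot> (\<sigma>' \<odot> \<i> P)) \<cdot> mid A A P P) \<cdot> (dA \<odot> d)"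
      by (subst \<epsilon>_mult_tensor[OF s(1-6)]) (simp add: e)
    also have "((\<sigma> \<odot> \<i> P) \<odot> (\<sigma>' \<odot> \<i> P)) \<cdot> mid A A P P = mid A A P P \<cdot> ((\<sigma> \<odot> \<sigma>') \<odot> (\<i> P \<odot> \<i> P))"
      by (rule mid_nat[symmetric]) auto
    finally show ?thesis by simp
  qed
  show "\<epsilon> \<cdot> (\<i> A \<odot> (\<mu> \<cdot> (\<Sigma> \<odot> \<Sigma>') \<cdot> dP)) = \<epsilon> \<cdot> (conv dA mA \<sigma> \<sigma>' \<odot> \<i> P)"
    by (subst gen) (simp_all add: pairing_on_comult convolution_def)
  have "\<epsilon> \<cdot> (\<i> A \<odot> (\<mu> \<cdot> (\<Sigma> \<odot> \<Sigma>') \<cdot> op P dP)) = (mB \<cdot> \<s> B B) \<cdot> (\<epsilon> \<odot> \<epsilon>) \<cdot> mid A A P P \<cdot> (?x \<odot> op P dP)"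
    unfolding mB_symm by (rule gen) auto
  also have "\<dots> = mB \<cdot> (\<s> B B \<cdot> (\<epsilon> \<odot> \<epsilon>)) \<cdot> mid A A P P \<cdot> (?x \<odot> op P dP)" by simp
  also have "\<s> B B \<cdot> (\<epsilon> \<odot> \<epsilon>) = (\<epsilon> \<odot> \<epsilon>) \<cdot> \<s> (A \<otimes> P) (A \<otimes> P)" by (rule s_nat) auto
  also have "mB \<cdot> \<dots> \<cdot> mid A A P P \<cdot> (?x \<odot> op P dP) =
      mB \<cdot> (\<epsilon> \<odot> \<epsilon>) \<cdot> (\<s> (A \<otimes> P) (A \<otimes> P) \<cdot> mid A A P P) \<cdot> (?x \<odot> op P dP)" by simp
  also have "\<s> (A \<otimes> P) (A \<otimes> P) \<cdot> mid A A P P = mid A A P P \<cdot> (\<s> A A \<odot> \<s> P P)" by (rule symm_mid) auto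
  also have "mB \<cdot> (\<epsilon> \<odot> \<epsilon>) \<cdot> \<dots> \<cdot> (?x \<odot> op P dP) =
      mB \<cdot> (\<epsilon> \<odot> \<epsilon>) \<cdot> mid A A P P \<cdot> (((\<s> A A \<cdot> (\<sigma> \<odot> \<sigma>')) \<cdot> dA) \<odot> dP)" by simp
  also have "\<s> A A \<cdot> (\<sigma> \<odot> \<sigma>') = (\<sigma>' \<odot> \<sigma>) \<cdot> \<s> A A" by (rule s_nat) auto
  finally show "\<epsilon> \<cdot> (\<i> A \<odot> (\<mu> \<cdot> (\<Sigma> \<odot> \<Sigma>') \<cdot> op P dP)) = \<epsilon> \<cdot> (conv (op A dA) mA \<sigma>' \<sigma> \<odot> \<i> P)"
    by (simp add: pairing_on_comult convolution_def)
qed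

text \<open>The right side is also the pairing of \<open>\<upsilon> \<cdot> eP\<close>, so the
  convolution units of \<open>A\<close> and \<open>P\<close> are adjoint.\<close>

lemma \<epsilon>_unit_counit: "\<epsilon> \<cdot> ((uA \<cdot> eA) \<odot> \<i> P) = uB \<cdot> tcounit eA eP"
proof -
  have "\<epsilon> \<cdot> ((uA \<cdot> eA) \<odot> \<i> P) = (\<epsilon> \<cdot> (uA \<odot> \<i> P)) \<cdot> (eA \<odot> \<i> P)" by simp
  also have "\<dots> = uB \<cdot> (eP \<cdot> \<l> P) \<cdot> (eA \<odot> \<i> P)" using \<epsilon>_pairing by (simp add: pairing_def)
  also have "eP \<cdot> \<l> P = \<l> \<I> \<cdot> (\<i> \<I> \<odot> eP)" by (rule left_nat[symmetric]) auto
  finally show ?thesis by (simp add: tensor_counit_def)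
qed

lemma antihom_pairing:
  assumes [simp]: "arr \<sigma>" "dom \<sigma> = A" "cod \<sigma> = A" and m: "\<sigma> \<cdot> mA = mA \<cdot> (\<sigma> \<odot> \<sigma>) \<cdot> \<s> A A" and u: "\<sigma> \<cdot> uA = uA"
  shows "pair P (op P dP) eP (\<epsilon> \<cdot> (\<sigma> \<odot> \<i> P))"
proof -
  let ?q = "\<epsilon> \<cdot> (\<sigma> \<odot> \<i> P)"
  have "?q \<cdot> (mA \<odot> \<i> P) = \<epsilon> \<cdot> ((\<sigma> \<cdot> mA) \<odot> \<i> P)" by simp
  also have "\<dots> = (\<epsilon> \<cdot> (mA \<odot> \<i> P)) \<cdot> (((\<sigma> \<odot> \<sigma>) \<cdot> \<s> A A) \<odot> \<i> P)" by (simp add: m)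
  also have "\<dots> = mB \<cdot> (\<epsilon> \<odot> \<epsilon>) \<cdot> (mid A A P P \<cdot> ((\<sigma> \<odot> \<sigma>) \<odot> (\<i> P \<odot> \<i> P))) \<cdot> (\<s> A A \<odot> dP)"
    using \<epsilon>_pairing by (simp add: pairing_def)
  also have "mid A A P P \<cdot> ((\<sigma> \<odot> \<sigma>) \<odot> (\<i> P \<odot> \<i> P)) = ((\<sigma> \<odot> \<i> P) \<odot> (\<sigma> \<odot> \<i> P)) \<cdot> mid A A P P"
    by (rule mid_nat) auto
  also have "mB \<cdot> (\<epsilon> \<odot> \<epsilon>) \<cdot> \<dots> \<cdot> (\<s> A A \<odot> dP) = (mB \<cdot> \<s> B B) \<cdot> (?q \<odot> ?q) \<cdot> mid A A P P \<cdot> (\<s> A A \<odot> dP)"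
    unfolding mB_symm by simp
  also have "\<dots> = mB \<cdot> (\<s> B B \<cdot> (?q \<odot> ?q)) \<cdot> mid A A P P \<cdot> (\<s> A A \<odot> dP)" by simp
  also have "\<s> B B \<cdot> (?q \<odot> ?q) = (?q \<odot> ?q) \<cdot> \<s> (A \<otimes> P) (A \<otimes> P)" by (rule s_nat) auto
  also have "mB \<cdot> \<dots> \<cdot> mid A A P P \<cdot> (\<s> A A \<odot> dP) =
      mB \<cdot> (?q \<odot> ?q) \<cdot> (\<s> (A \<otimes> P) (A \<otimes> P) \<cdot> mid A A P P) \<cdot> (\<s> A A \<odot> dP)" by simp
  also have "\<s> (A \<otimes> P) (A \<otimes> P) \<cdot> mid A A P P = mid A A P P \<cdot> (\<s> A A \<odot> \<s> P P)" by (rule symm_mid) auto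
  finally have 1: "?q \<cdot> (mA \<odot> \<i> P) = mB \<cdot> (?q \<odot> ?q) \<cdot> mid A A P P \<cdot> (\<i> (A \<otimes> A) \<odot> op P dP)" by simp
  have "?q \<cdot> (uA \<odot> \<i> P) = \<epsilon> \<cdot> (uA \<odot> \<i> P)" by (simp add: u)
  then show ?thesis using 1 \<epsilon>_pairing by (simp add: pairing_def)
qed

text \<open>Letting \<open>\<delta>A\<close> and \<open>\<delta>P\<close> range over both choices of
  comultiplication treats antipodes and opantipodes in one argument.\<close>

lemma antipode_P:
  assumes lp: "locally_presentable TYPE('u) V"
    and d: "\<delta>A = dA \<and> \<delta>P = dP \<or> \<delta>A = op A dA \<and> \<delta>P = op P dP"
    and inv: "convolution_inverse V A \<delta>A eA A mA uA (\<i> A) \<sigma>"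
  shows "\<exists>\<Sigma>. convolution_inverse V P \<delta>P eP P \<mu> \<upsilon> (\<i> P) \<Sigma>"
proof -
  note P' = comonoid_cop[OF comonoid_P]
  have bi: "is_bimonoid V A mA uA \<delta>A eA" using d bimonoid_A bimonoid_cop[OF bimonoid_A] by blast
  have C: "is_comonoid V P \<delta>P eP" using d comonoid_P P' by blast
  note [simp] = comonoidD(1-7)[OF C]
  have [simp]: "arr \<sigma>" "dom \<sigma> = A" "cod \<sigma> = A"
    and c: "conv \<delta>A mA (\<i> A) \<sigma> = uA \<cdot> eA" "conv \<delta>A mA \<sigma> (\<i> A) = uA \<cdot> eA"
    using inv by (auto simp: convolution_inverse_def)
  \<comment> \<open>\<open>\<Sigma>\<close> starts at \<open>P\<^sup>c\<^sup>o\<^sup>p\<close> for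
    either choice of \<open>\<delta>P\<close>, because the pairing equations involve
    \<open>\<sigma>\<close> only through its reversal of products in \<open>A\<close>.\<close>
  obtain \<Sigma> where \<Sigma>: "\<Sigma> \<in> chom P (op P dP) eP" and e: "\<epsilon> \<cdot> (\<i> A \<odot> \<Sigma>) = \<epsilon> \<cdot> (\<sigma> \<odot> \<i> P)"
    using classifying[OF P' antihom_pairing[OF _ _ _ antipode_antihom[OF bi inv]]] by auto
  have [simp]: "arr \<Sigma>" "dom \<Sigma> = P" "cod \<Sigma> = P" using \<Sigma> by (auto simp: comonoid_hom_iff)
  have L: "\<mu> \<cdot> (\<i> P \<odot> \<Sigma>) \<in> chom (P \<otimes> P) (tcomult P dP P (op P dP)) ePP"
    and R: "\<mu> \<cdot> (\<Sigma> \<odot> \<i> P) \<in> chom (P \<otimes> P) (tcomult P (op P dP) P dP) ePP"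
    using comonoid_hom_cmp[OF comonoid_hom_tensor_idn(2)[OF \<Sigma> P' comonoid_P comonoid_P] mult_hom]
      comonoid_hom_cmp[OF comonoid_hom_tensor_idn(1)[OF \<Sigma> P' comonoid_P comonoid_P] mult_hom]
      comonoid_PP comonoid_P comonoid_tensor[OF P' comonoid_P] comonoid_tensor[OF comonoid_P P'] by blast+
  have l: "\<epsilon> \<cdot> (\<i> A \<odot> (\<mu> \<cdot> (\<i> P \<odot> \<Sigma>) \<cdot> \<delta>P)) = uB \<cdot> tcounit eA eP"
    using d \<epsilon>_mult_comult[of "\<i> P" \<Sigma> "\<i> A" \<sigma>] e c by (auto simp: \<epsilon>_unit_counit)
  have r: "\<epsilon> \<cdot> (\<i> A \<odot> (\<mu> \<cdot> (\<Sigma> \<odot> \<i> P) \<cdot> \<delta>P)) = uB \<cdot> tcounit eA eP"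
    using d \<epsilon>_mult_comult[of \<Sigma> "\<i> P" \<sigma> "\<i> A"] e c by (auto simp: \<epsilon>_unit_counit)
  \<comment> \<open>If \<open>\<delta>P = dP\<close>, then \<open>L\<close> is the first alternative
    of \<open>detect_unit\<close> and \<open>R\<close> the second. If
    \<open>\<delta>P = op P dP\<close>, reversing it gives back \<open>dP\<close> and the two
    alternatives change roles.\<close>
  have "(\<mu> \<cdot> (\<i> P \<odot> \<Sigma>)) \<cdot> \<delta>P = \<upsilon> \<cdot> eP"
    by (rule detect_unit[OF lp C]) (use d L l in auto)
  moreover have "(\<mu> \<cdot> (\<Sigma> \<odot> \<i> P)) \<cdot> \<delta>P = \<upsilon> \<cdot> eP"
    by (rule detect_unit[OF lp C]) (use d R r in auto)
  ultimately show ?thesis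
    by (intro exI[of _ \<Sigma>]) (simp add: convolution_inverse_def convolution_def)
qed

end

theorem theorem10p11:
  fixes V :: "('o, 'm) smcc"
    and A B P :: 'o
    and mA uA dA eA mB uB dP eP :: 'm
    and \<phi> :: "'o \<Rightarrow> 'm \<Rightarrow> 'm \<Rightarrow> 'm \<Rightarrow> 'm"
  assumes "symmetric_monoidal_closed_category V"
    and "locally_presentable TYPE('u) V"
    and "fundamental_theorem_of_comodules V TYPE('u)"
    and "is_commutative_monoid V B mB uB"
    and "is_universal_measuring_comonoid V A mA uA B mB uB P dP eP \<phi>"
  shows "(is_hopf_monoid V A mA uA dA eA \<longrightarrow>
            is_hopf_monoid V P (measuring_mult V A mA uA dA B mB uB P dP eP \<phi>)
              (measuring_unit V eA B uB \<phi>) dP eP) \<and>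
         (is_op_hopf_monoid V A mA uA dA eA \<longrightarrow>
            is_op_hopf_monoid V P (measuring_mult V A mA uA dA B mB uB P dP eP \<phi>)
              (measuring_unit V eA B uB \<phi>) dP eP)"
proof -
  interpret symmetric_monoidal_closed_category V by fact
  have m: "measuring_bimonoid V A mA uA B mB uB P dP eP \<phi> dA eA" if "is_bimonoid V A mA uA dA eA"
    using that assms(4,5) by unfold_locales (auto simp: is_bimonoid_def)
  have c: "cop V A dA = op A dA" "cop V P dP = op P dP" if "is_bimonoid V A mA uA dA eA"
    using that comonoidD(1) assms(5) cop_eq
    unfolding is_bimonoid_def is_universal_measuring_comonoid_def by blast+
  show ?thesis
    using measuring_bimonoid.bimonoid_P[OF m] measuring_bimonoid.antipode_P[OF m assms(2)] c
    unfolding is_hopf_monoid_def is_op_hopf_monoid_def by metis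
qed

end
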